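(* Let $\beta,\gamma\in\mathbb{R}$ and $t>0$ be fixed. For $v>0$ let $\nu_v=\nu_{t,v}$ be the equilibrium measure of total mass $t$ in $[0,+\infty)$ in the external field $\phi(x)=\frac{x^2}{2}+\beta x+\gamma\log(x+v)$. (a) If $\gamma<0$, then $$\lim_{v\searrow 0}\nu_v=\sigma,$$ where $$\sigma'(x)=\frac1\pi\,\frac{(x-b_1)\sqrt{(x-a_2)(a_3-x)}}{x},\qquad x\in(a_2,a_3),$$ with $$a_2=-(b_1+\beta)-\sqrt{(b_1-\beta)^2-\beta^2-3b_1^2+2(t-\gamma)}>0,$$ $$a_3=-(b_1+\beta)+\sqrt{(b_1-\beta)^2-\beta^2-3b_1^2+2(t-\gamma)}>a_2>0,$$ where $b_1$ is a negative real root of the equation $$3y^4+4\beta y^3+(\beta^2+2(\gamma-t))y^2-\gamma^2=0$$ such that the corresponding values of $a_2,a_3$ are positive; and the convergence holds in the weak-* sense. Indeed, $\nu_v$ can be continued analytically for $v<0$. (b) If $\gamma>0$, then $$\lim_{v\searrow 0}\nu_v=\begin{cases}t\,\delta_0,& \text{if } t\le\gamma,\\ \gamma\,\delta_0+(t-\gamma)\,\rho,& \text{if } t>\gamma,\end{cases}$$ where $\rho$ is the unit equilibrium measure of $[0,+\infty)$ in the presence of the external field $\psi(x)=\frac{x^2}{2}+\beta x$.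
   Context: Equilibrium measure: for a closed set $\Sigma\subset\mathbb{R}$, an external field $\phi$ on $\Sigma$ and $t>0$, the equilibrium measure of total mass $t$ in $\Sigma$ in the external field $\phi$ is the unique positive Borel measure $\nu$ with $\nu(\Sigma)=t$ and compact support $S\subset\Sigma$ such that, for some constant $c$, $V^{\nu}(x)+\phi(x)=c$ for $x\in S$ and $V^{\nu}(x)+\phi(x)\ge c$ for $x\in\Sigma$, where $V^{\sigma}(x)=-\int\log|x-s|\,d\sigma(s)$. It minimizes $-\iint\log|x-z|\,d\sigma(x)\,d\sigma(z)+2\int\phi\,d\sigma$ over positive measures $\sigma$ on $\Sigma$ with total mass $t$. The unit equilibrium measure is the one of total mass $1$. $\sigma'$ denotes the density of $\sigma$ with respect to Lebesgue measure, and $\delta_0$ denotes the unit Dirac mass at $0$.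
   Formalization: In (b) for t > γ, ρ is taken as the unit equilibrium measure in the field ψ/(t−γ) instead of ψ; with ψ itself the stated limit is false unless t−γ = 1 (e.g. β=0, γ=1, t=3). *)

theory Defs
  imports "HOL-Analysis.Analysis" "HOL-Probability.Probability"
begin

definition measure_support :: "real measure \<Rightarrow> real set" where
  "measure_support \<mu> = {x. \<forall>U. open U \<and> x \<in> U \<longrightarrow> emeasure \<mu> U > 0}"

(* The kernel -log|x - s| takes the value \<infinity> on the diagonal. A real-valued kernel would not do:
   ln 0 = 0 would make the potential of a point mass finite at its atom. *)
definition log_kernel :: "real \<Rightarrow> real \<Rightarrow> ereal" where
  "log_kernel x s = (if x = s then \<infinity> else ereal (- ln \<bar>x - s\<bar>))"

(* Integral of the positive part minus integral of the negative part. For finite measures of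
   compact support the second term is finite, so the difference is never \<infinity> - \<infinity>. *)
definition log_potential :: "real measure \<Rightarrow> real \<Rightarrow> ereal" where
  "log_potential \<mu> x =
     enn2ereal (\<integral>\<^sup>+ s. e2ennreal (log_kernel x s) \<partial>\<mu>)
     - enn2ereal (\<integral>\<^sup>+ s. e2ennreal (- log_kernel x s) \<partial>\<mu>)"

(* Measures on \<Sigma> are Borel measures on the whole line whose support is contained in \<Sigma>. *)
definition equilibrium_measure ::
  "real set \<Rightarrow> (real \<Rightarrow> real) \<Rightarrow> real \<Rightarrow> real measure \<Rightarrow> bool" where
  "equilibrium_measure \<Sigma> \<phi> t \<nu> \<longleftrightarrow>
     sets \<nu> = sets borel \<and>
     emeasure \<nu> \<Sigma> = ennreal t \<and>
     compact (measure_support \<nu>) \<and> measure_support \<nu> \<subseteq> \<Sigma> \<and>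
     (\<exists>c::real.
        (\<forall>x\<in>measure_support \<nu>. log_potential \<nu> x + ereal (\<phi> x) = ereal c) \<and>
        (\<forall>x\<in>\<Sigma>. log_potential \<nu> x + ereal (\<phi> x) \<ge> ereal c))"

(* Test functions are bounded and continuous. For finite measures whose masses converge to that of
   the limit this agrees with testing against continuous functions of compact support. *)
definition weak_star_tendsto ::
  "(real \<Rightarrow> real measure) \<Rightarrow> real measure \<Rightarrow> real filter \<Rightarrow> bool" where
  "weak_star_tendsto N \<mu> F \<longleftrightarrow>
     (\<forall>f::real \<Rightarrow> real. continuous_on UNIV f \<and> bounded (range f) \<longrightarrow>
        ((\<lambda>v. \<integral>x. f x \<partial>N v) \<longlongrightarrow> (\<integral>x. f x \<partial>\<mu>)) F)"

definition dirac :: "real \<Rightarrow> real measure" where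
  "dirac a = return borel a"

definition measure_plus :: "real measure \<Rightarrow> real measure \<Rightarrow> real measure" where
  "measure_plus \<mu> \<nu> =
     measure_of (space \<mu>) (sets \<mu>) (\<lambda>A. emeasure \<mu> A + emeasure \<nu> A)"

definition real_analytic_at :: "(real \<Rightarrow> real) \<Rightarrow> real \<Rightarrow> bool" where
  "real_analytic_at f x \<longleftrightarrow> (\<exists>F. (\<lambda>h. f (x + h)) has_fps_expansion F)"

(* Analytic dependence on v is tested against functions that are real analytic on the support.
   Merely continuous test functions are too many: the endpoints of the support move with v, and
   then the integral of a nonsmooth function need not be analytic in v. Polynomials are among the
   test functions, so on an interval such a family is determined by its restriction to any
   nonempty open subinterval. *)
definition analytic_measure_family :: "real set \<Rightarrow> (real \<Rightarrow> real measure) \<Rightarrow> bool" where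
  "analytic_measure_family I N \<longleftrightarrow>
     (\<forall>v\<in>I. sets (N v) = sets borel \<and> finite_measure (N v) \<and> compact (measure_support (N v)) \<and>
        (\<forall>f. f \<in> borel_measurable borel \<and>
             (\<forall>x\<in>measure_support (N v). real_analytic_at f x) \<longrightarrow>
             real_analytic_at (\<lambda>w. \<integral>x. f x \<partial>N w) v))"

definition endpoint_a2 :: "real \<Rightarrow> real \<Rightarrow> real \<Rightarrow> real \<Rightarrow> real" where
  "endpoint_a2 \<beta> \<gamma> t b =
     - (b + \<beta>) - sqrt ((b - \<beta>)\<^sup>2 - \<beta>\<^sup>2 - 3 * b\<^sup>2 + 2 * (t - \<gamma>))"

definition endpoint_a3 :: "real \<Rightarrow> real \<Rightarrow> real \<Rightarrow> real \<Rightarrow> real" where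
  "endpoint_a3 \<beta> \<gamma> t b =
     - (b + \<beta>) + sqrt ((b - \<beta>)\<^sup>2 - \<beta>\<^sup>2 - 3 * b\<^sup>2 + 2 * (t - \<gamma>))"

(* The real function sqrt is odd, so a2 < a3 holds exactly when the radicand is positive; this
   condition also makes a2 and a3 the real numbers intended by the formulas. *)
definition admissible_root :: "real \<Rightarrow> real \<Rightarrow> real \<Rightarrow> real \<Rightarrow> bool" where
  "admissible_root \<beta> \<gamma> t b \<longleftrightarrow>
     b < 0 \<and>
     3 * b ^ 4 + 4 * \<beta> * b ^ 3 + (\<beta>\<^sup>2 + 2 * (\<gamma> - t)) * b\<^sup>2 - \<gamma>\<^sup>2 = 0 \<and>
     0 < endpoint_a2 \<beta> \<gamma> t b \<and> endpoint_a2 \<beta> \<gamma> t b < endpoint_a3 \<beta> \<gamma> t b"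

definition sigma_measure :: "real \<Rightarrow> real \<Rightarrow> real \<Rightarrow> real \<Rightarrow> real measure" where
  "sigma_measure \<beta> \<gamma> t b =
     (let a2 = endpoint_a2 \<beta> \<gamma> t b; a3 = endpoint_a3 \<beta> \<gamma> t b in
      density lborel (\<lambda>x.
        ennreal (indicator {a2<..<a3} x * (1 / pi * ((x - b) * sqrt ((x - a2) * (a3 - x)) / x)))))"

(* The external field for the measure rho of total mass 1 in the case T = t - \<gamma> > 0. Dividing
   V^\<tau> + x^2/2 + \<beta> x = const by T shows that \<tau> is the equilibrium measure of mass T in
   the field x^2/2 + \<beta> x iff \<tau>/T is the unit equilibrium measure in this field. *)
definition normalized_field :: "real \<Rightarrow> real \<Rightarrow> real \<Rightarrow> real" where
  "normalized_field \<beta> T x = (x\<^sup>2 / 2 + \<beta> * x) / T"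

end

theory Submission
  imports Defs "HOL-Complex_Analysis.Complex_Analysis" "HOL-Real_Asymp.Real_Asymp"
begin

text \<open>
  For two measures of equal mass on \<open>[0, R]\<close>, the logarithmic energy of their difference is at least
  \<open>(2 / R)\<close> times the squared \<open>L\<^sup>2\<close> distance of their distribution functions. This follows from
  \<open>- ln d = (\<integral>l\<in>{0<..<R}. max 0 (l - d) / l\<^sup>2) - d / R + 1 - ln R\<close> for \<open>0 < d \<le> R\<close>,
  where the first kernel is a superposition of products of indicators, hence positive definite, and
  \<open>- \<bar>x - y\<bar>\<close> is conditionally positive definite. Consequently a measure that satisfies the equilibrium
  conditions up to a small error is close to the equilibrium measure, and an exact solution is unique.

  For \<open>\<gamma> < 0\<close> the solution is explicit: push forward a density on the circle under \<open>\<theta> \<mapsto> m + R cos \<theta>\<close>.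
  Its potential is computed from Cauchy's formula for \<open>ln (1 - w z)\<close>, where \<open>x = m + (R / 2) (w + 1 / w)\<close>.
  All data depend analytically on one parameter \<open>p \<in> (0, 1)\<close>, which is an analytic function of \<open>v \<in> \<real>\<close>.

  For \<open>\<gamma> > 0\<close> the field \<open>\<gamma> ln (x + v)\<close> is cancelled up to a constant by \<open>\<gamma>\<close> times the balayage of the point
  mass at \<open>-v\<close>, and the balayage tends to the point mass at \<open>0\<close>.
\<close>

section \<open>The logarithmic kernel as a superposition of window functions\<close>

text \<open>The point mass at 0 has infinite logarithmic energy, so for \<gamma> > 0 the limit
  itself cannot serve as comparison measure. Its place is taken by a balayage that depends on
  \<open>v\<close>: its energy is finite, and the growth of that energy like \<open>- ln v\<close>
  is compensated by the integral of the field. Energies and potentials are formed with the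
  nonnegative kernel \<open>logk\<close>, in \<open>ennreal\<close>, so that Tonelli applies and
  \<infinity> - \<infinity> cannot arise; the passage back to \<open>- ln\<close> costs the bounded
  term \<open>d / R\<close> and a constant. If t \<le> \<gamma>, a separate estimate of order
  \<open>1 / (- ln v)\<close> bounds the mass away from 0. For \<gamma> < 0 the support is repelled
  from 0, so for small \<open>v\<close> the constraint x \<ge> 0 is inactive, and the formula for
  the measure makes sense for all real \<open>v\<close>. The parameter \<open>p\<close> is chosen so
  that the charge sits at \<open>w = - p\<close> in the coordinate of the arc. The angle runs over a
  fixed interval although the endpoints of the support move with \<open>v\<close>; this is what
  allows complex values of \<open>v\<close> under the integral sign.\<close>

definition window :: "real \<Rightarrow> real \<times> real \<Rightarrow> real \<Rightarrow> ennreal" where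
  "window R p x = (if 0 < fst p \<and> fst p < R \<and> snd p \<le> x \<and> x \<le> snd p + fst p then 1 else 0)"

text \<open>A pair \<open>(l, z)\<close> stands for the interval from \<open>z\<close> to
  \<open>z + l\<close>. The weight \<open>1 / l\<^sup>2\<close> is the second derivative of
  \<open>- ln\<close>, so integrating \<open>max 0 (l - d)\<close> against it reproduces
  \<open>- ln d\<close> up to an affine function of \<open>d\<close>; the cutoff
  \<open>l < R\<close> keeps the integral finite for \<open>d > 0\<close>.\<close>

definition logk :: "real \<Rightarrow> real \<Rightarrow> real \<Rightarrow> ennreal" where
  "logk R x y = (\<integral>\<^sup>+p. ennreal (1 / (fst p)\<^sup>2) * (window R p x * window R p y) \<partial>(lborel \<Otimes>\<^sub>M lborel))"

definition pot :: "real \<Rightarrow> real measure \<Rightarrow> real \<Rightarrow> ennreal" where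
  "pot R \<mu> x = (\<integral>\<^sup>+y. logk R x y \<partial>\<mu>)"

definition energy :: "real \<Rightarrow> real measure \<Rightarrow> real measure \<Rightarrow> ennreal" where
  "energy R \<mu> \<kappa> = (\<integral>\<^sup>+x. pot R \<mu> x \<partial>\<kappa>)"

lemma measurable_window [measurable]:
  assumes [measurable]: "f \<in> borel_measurable M" "g \<in> borel_measurable M" "h \<in> borel_measurable M"
  shows "(\<lambda>z. window R (f z, g z) (h z)) \<in> borel_measurable M"
  unfolding window_def by measurable

lemma measurable_window2 [measurable]:
  assumes [measurable]: "f \<in> measurable M (lborel \<Otimes>\<^sub>M lborel)" "h \<in> borel_measurable M"
  shows "(\<lambda>z. window R (f z) (h z)) \<in> borel_measurable M"
proof -
  have [measurable]: "f \<in> measurable M (borel \<Otimes>\<^sub>M borel)"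
    using assms(1) by (simp cong: measurable_cong_sets)
  show ?thesis unfolding window_def by measurable
qed

lemma measurable_weight [measurable]:
  assumes [measurable]: "f \<in> measurable M (lborel \<Otimes>\<^sub>M lborel)"
  shows "(\<lambda>z. ennreal (1 / (fst (f z))\<^sup>2)) \<in> borel_measurable M"
proof -
  have [measurable]: "f \<in> measurable M (borel \<Otimes>\<^sub>M borel)"
    using assms(1) by (simp cong: measurable_cong_sets)
  show ?thesis by measurable
qed

lemma measurable_logk [measurable]:
  "(\<lambda>z. logk R (fst z) (snd z)) \<in> borel_measurable (borel \<Otimes>\<^sub>M borel)"
  unfolding logk_def by measurable

lemma measurable_logk' [measurable]:
  assumes [measurable]: "f \<in> borel_measurable M" "g \<in> borel_measurable M"
  shows "(\<lambda>z. logk R (f z) (g z)) \<in> borel_measurable M"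
  using measurable_compose[OF measurable_Pair[OF assms] measurable_logk] by simp

lemma nn_integral_swap:
  fixes M :: "'a measure" and N :: "'b measure"
  assumes "sigma_finite_measure M" "sigma_finite_measure N"
    and "case_prod f \<in> borel_measurable (M \<Otimes>\<^sub>M N)"
  shows "(\<integral>\<^sup>+y. (\<integral>\<^sup>+x. f x y \<partial>M) \<partial>N) = (\<integral>\<^sup>+x. (\<integral>\<^sup>+y. f x y \<partial>N) \<partial>M)"
  using pair_sigma_finite.Fubini'[OF pair_sigma_finite.intro[OF assms(1,2)] assms(3)] by simp

lemma measurable_pot:
  assumes "finite_measure \<mu>" and [measurable_cong]: "sets \<mu> = sets borel"
  shows "pot R \<mu> \<in> borel_measurable borel"
proof -
  interpret finite_measure \<mu> by fact
  show ?thesis unfolding pot_def[abs_def] by measurable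
qed

lemma sigma_finite_ll: "sigma_finite_measure (lborel \<Otimes>\<^sub>M lborel :: (real \<times> real) measure)"
  unfolding lborel_prod by (rule sigma_finite_lborel)

lemma pot_window:
  assumes "finite_measure \<mu>" and [measurable_cong]: "sets \<mu> = sets borel"
  shows "pot R \<mu> x = (\<integral>\<^sup>+p. ennreal (1 / (fst p)\<^sup>2) * (window R p x * (\<integral>\<^sup>+y. window R p y \<partial>\<mu>)) \<partial>(lborel \<Otimes>\<^sub>M lborel))"
proof -
  interpret finite_measure \<mu> by fact
  have "pot R \<mu> x = (\<integral>\<^sup>+p. (\<integral>\<^sup>+y. ennreal (1 / (fst p)\<^sup>2) * (window R p x * window R p y) \<partial>\<mu>) \<partial>(lborel \<Otimes>\<^sub>M lborel))"
    unfolding pot_def logk_def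
    by (rule nn_integral_swap[OF sigma_finite_ll]) (unfold_locales, measurable)
  also have "\<dots> = (\<integral>\<^sup>+p. ennreal (1 / (fst p)\<^sup>2) * (window R p x * (\<integral>\<^sup>+y. window R p y \<partial>\<mu>)) \<partial>(lborel \<Otimes>\<^sub>M lborel))"
    by (intro nn_integral_cong) (simp add: nn_integral_cmult)
  finally show ?thesis .
qed

text \<open>After Tonelli the energy is a weighted integral of products of the masses that the two
  measures give to the same interval; this is the positive definiteness of the kernel in explicit
  form.\<close>

lemma energy_window:
  assumes "finite_measure \<mu>" and [measurable_cong]: "sets \<mu> = sets borel"
    and "finite_measure \<kappa>" and [measurable_cong]: "sets \<kappa> = sets borel"
  shows "energy R \<mu> \<kappa> = (\<integral>\<^sup>+p. ennreal (1 / (fst p)\<^sup>2) * ((\<integral>\<^sup>+x. window R p x \<partial>\<kappa>) * (\<integral>\<^sup>+y. window R p y \<partial>\<mu>)) \<partial>(lborel \<Otimes>\<^sub>M lborel))"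
proof -
  interpret finite_measure \<mu> by fact
  interpret k: finite_measure \<kappa> by fact
  have "energy R \<mu> \<kappa> = (\<integral>\<^sup>+p. (\<integral>\<^sup>+x. ennreal (1 / (fst p)\<^sup>2) * (window R p x * (\<integral>\<^sup>+y. window R p y \<partial>\<mu>)) \<partial>\<kappa>) \<partial>(lborel \<Otimes>\<^sub>M lborel))"
    unfolding energy_def pot_window[OF assms(1,2)]
    by (rule nn_integral_swap[OF sigma_finite_ll]) (unfold_locales, measurable)
  also have "\<dots> = (\<integral>\<^sup>+p. ennreal (1 / (fst p)\<^sup>2) * ((\<integral>\<^sup>+x. window R p x \<partial>\<kappa>) * (\<integral>\<^sup>+y. window R p y \<partial>\<mu>)) \<partial>(lborel \<Otimes>\<^sub>M lborel))"
    by (intro nn_integral_cong) (simp add: nn_integral_cmult nn_integral_multc)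
  finally show ?thesis .
qed

lemma energy_commute:
  assumes "finite_measure \<mu>" "sets \<mu> = sets borel" "finite_measure \<kappa>" "sets \<kappa> = sets borel"
  shows "energy R \<mu> \<kappa> = energy R \<kappa> \<mu>"
  unfolding energy_window[OF assms] energy_window[OF assms(3,4,1,2)] by (simp add: mult.commute)

lemma window_le_1: "window R p x \<le> 1" by (simp add: window_def)

lemma ennreal_two_mult_le:
  fixes a b :: ennreal assumes "a < top" "b < top" shows "2 * (a * b) \<le> a * a + b * b"
proof -
  obtain x where x: "a = ennreal x" "0 \<le> x" using assms(1) by (cases a) auto
  obtain y where y: "b = ennreal y" "0 \<le> y" using assms(2) by (cases b) auto
  have "2 * (a * b) = ennreal (2 * (x * y))" using x y by (simp add: ennreal_mult)
  also have "\<dots> \<le> ennreal (x * x + y * y)"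
    using sum_squares_bound[of x y] by (intro ennreal_leI) (simp add: power2_eq_square)
  also have "\<dots> = a * a + b * b" using x y by (simp add: ennreal_mult)
  finally show ?thesis .
qed

text \<open>Under the integral of \<open>energy_window\<close> this is
  \<open>2 * a * b \<le> a\<^sup>2 + b\<^sup>2\<close>. The form without subtraction is meaningful
  for infinite energies as well.\<close>

lemma energy_psd:
  assumes "finite_measure \<mu>" and [measurable_cong]: "sets \<mu> = sets borel"
    and "finite_measure \<kappa>" and [measurable_cong]: "sets \<kappa> = sets borel"
  shows "2 * energy R \<mu> \<kappa> \<le> energy R \<mu> \<mu> + energy R \<kappa> \<kappa>"
proof -
  interpret finite_measure \<mu> by fact
  interpret k: finite_measure \<kappa> by fact
  let ?w = "\<lambda>p::real\<times>real. ennreal (1 / (fst p)\<^sup>2)"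
  let ?m = "\<lambda>p. \<integral>\<^sup>+x. window R p x \<partial>\<mu>" and ?k = "\<lambda>p. \<integral>\<^sup>+x. window R p x \<partial>\<kappa>"
  have fin: "?m p < top" "?k p < top" for p
  proof -
    have "?m p \<le> (\<integral>\<^sup>+x. 1 \<partial>\<mu>)" "?k p \<le> (\<integral>\<^sup>+x. 1 \<partial>\<kappa>)"
      by (intro nn_integral_mono window_le_1)+
    thus "?m p < top" "?k p < top"
      by (auto simp: less_top[symmetric] top_unique)
  qed
  have [measurable]: "?m \<in> borel_measurable (lborel \<Otimes>\<^sub>M lborel)" "?k \<in> borel_measurable (lborel \<Otimes>\<^sub>M lborel)"
    by measurable
  have "2 * energy R \<mu> \<kappa> = (\<integral>\<^sup>+p. ?w p * (2 * (?k p * ?m p)) \<partial>(lborel \<Otimes>\<^sub>M lborel))"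
    unfolding energy_window[OF assms] by (subst nn_integral_cmult[symmetric]) (auto simp: mult_ac)
  also have "\<dots> \<le> (\<integral>\<^sup>+p. ?w p * (?m p * ?m p) + ?w p * (?k p * ?k p) \<partial>(lborel \<Otimes>\<^sub>M lborel))"
  proof (intro nn_integral_mono)
    fix p
    have "2 * (?k p * ?m p) \<le> ?m p * ?m p + ?k p * ?k p"
      using ennreal_two_mult_le[OF fin] by (simp add: mult.commute)
    hence "?w p * (2 * (?k p * ?m p)) \<le> ?w p * (?m p * ?m p + ?k p * ?k p)"
      by (intro mult_left_mono) auto
    thus "?w p * (2 * (?k p * ?m p)) \<le> ?w p * (?m p * ?m p) + ?w p * (?k p * ?k p)"
      by (simp add: distrib_left)
  qed
  also have "\<dots> = energy R \<mu> \<mu> + energy R \<kappa> \<kappa>"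
    unfolding energy_window[OF assms(1,2,1,2)] energy_window[OF assms(3,4,3,4)]
    by (rule nn_integral_add) measurable
  finally show ?thesis .
qed

lemma logk_inner:
  "logk R x y = (\<integral>\<^sup>+l. (if 0 < l \<and> l < R then ennreal (1 / l\<^sup>2) * ennreal (l - \<bar>x - y\<bar>) else 0) \<partial>lborel)"
proof -
  have "logk R x y = (\<integral>\<^sup>+l. (\<integral>\<^sup>+z. ennreal (1 / l\<^sup>2) * (window R (l, z) x * window R (l, z) y) \<partial>lborel) \<partial>lborel)"
    unfolding logk_def by (subst lborel.nn_integral_fst[symmetric]) (simp_all add: split_beta')
  also have "\<dots> = (\<integral>\<^sup>+l. (if 0 < l \<and> l < R then ennreal (1 / l\<^sup>2) * ennreal (l - \<bar>x - y\<bar>) else 0) \<partial>lborel)"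
  proof (intro nn_integral_cong)
    fix l :: real
    show "(\<integral>\<^sup>+z. ennreal (1 / l\<^sup>2) * (window R (l, z) x * window R (l, z) y) \<partial>lborel) =
      (if 0 < l \<and> l < R then ennreal (1 / l\<^sup>2) * ennreal (l - \<bar>x - y\<bar>) else 0)"
    proof (cases "0 < l \<and> l < R")
      case True
      have eq: "window R (l, z) x * window R (l, z) y = indicator {max x y - l..min x y} z" for z
        using True by (auto simp: window_def indicator_def)
      have "(\<integral>\<^sup>+z. ennreal (1 / l\<^sup>2) * (window R (l, z) x * window R (l, z) y) \<partial>lborel)
        = ennreal (1 / l\<^sup>2) * emeasure lborel {max x y - l..min x y}"
        unfolding eq by (simp add: nn_integral_cmult)
      also have "emeasure lborel {max x y - l..min x y} = ennreal (l - \<bar>x - y\<bar>)"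
        by (simp add: emeasure_lborel_Icc_eq ennreal_neg max_def min_def abs_if)
      finally show ?thesis using True by simp
    qed (auto simp: window_def)
  qed
  finally show ?thesis .
qed

lemma logk_off_diag:
  assumes "x \<noteq> y" "\<bar>x - y\<bar> \<le> R"
  shows "logk R x y = ennreal (\<bar>x - y\<bar> / R - 1 - ln (\<bar>x - y\<bar> / R))"
proof -
  define d where "d = \<bar>x - y\<bar>"
  have d: "0 < d" "d \<le> R" using assms by (auto simp: d_def)
  have "logk R x y = (\<integral>\<^sup>+l. ennreal (1 / l - d / l\<^sup>2) * indicator {d..R} l \<partial>lborel)"
    unfolding logk_inner d_def[symmetric]
  proof (rule nn_integral_cong_AE)
    have "AE l in lborel. l \<noteq> R" by (rule AE_lborel_singleton)
    thus "AE l in lborel. (if 0 < l \<and> l < R then ennreal (1 / l\<^sup>2) * ennreal (l - d) else 0) =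
            ennreal (1 / l - d / l\<^sup>2) * indicator {d..R} l"
    proof eventually_elim
      case (elim l)
      show ?case
      proof (cases "d \<le> l \<and> l < R")
        case True
        thus ?thesis using d
          by (simp add: ennreal_mult[symmetric]) (simp add: field_simps power2_eq_square)
      next
        case False
        thus ?thesis using d elim by (auto simp: ennreal_neg)
      qed
    qed
  qed
  also have "\<dots> = ennreal ((ln R + d / R) - (ln d + d / d))"
  proof (rule nn_integral_FTC_Icc)
    fix l assume "l \<in> {d..R}"
    hence l: "0 < l" "d \<le> l" using d by auto
    show "DERIV (\<lambda>l. ln l + d / l) l :> 1 / l - d / l\<^sup>2"
      using l by (auto intro!: derivative_eq_intros simp: power2_eq_square)
    show "0 \<le> 1 / l - d / l\<^sup>2" using l d by (simp add: field_simps power2_eq_square)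
  qed (use d in auto)
  also have "(ln R + d / R) - (ln d + d / d) = d / R - 1 - ln (d / R)"
    using d by (simp add: ln_div)
  finally show ?thesis by (simp add: d_def)
qed

text \<open>The kernel decreases with the distance, so the diagonal value dominates all values off
  the diagonal, and these are unbounded.\<close>

lemma logk_diag:
  assumes "0 < R" shows "logk R x x = \<infinity>"
proof -
  have *: "ennreal (d / R - 1 - ln (d / R)) \<le> logk R x x" if "0 < d" "d \<le> R" for d
  proof -
    have "ennreal (d / R - 1 - ln (d / R)) = logk R x (x + d)"
      using logk_off_diag[of x "x + d" R] that by simp
    also have "\<dots> \<le> logk R x x"
      unfolding logk_inner using that by (intro nn_integral_mono) (auto intro!: mult_left_mono ennreal_leI)
    finally show ?thesis .
  qed
  have "ennreal n \<le> logk R x x" if "n \<ge> 0" for n :: real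
  proof -
    have "ennreal n \<le> ennreal ((R * exp (-(n + 1))) / R - 1 - ln ((R * exp (-(n + 1))) / R))"
      using assms by (intro ennreal_leI) simp
    also have "\<dots> \<le> logk R x x" using assms that by (intro *) (auto simp: mult_le_cancel_left1)
    finally show ?thesis .
  qed
  thus ?thesis
    by (metis ennreal_cases enn2real_nonneg ennreal_le_iff infinity_ennreal_def linorder_not_less
        less_add_one add_nonneg_nonneg zero_le_one)
qed

section \<open>Potentials and energies\<close>

text \<open>The condition on the support is stated as a null set, which passes directly to
  push-forwards and linear combinations. The conjunct \<open>0 \<le> t\<close> makes
  \<open>t\<close> recoverable from \<open>ennreal t\<close>.\<close>

definition mass_on :: "real \<Rightarrow> real \<Rightarrow> real measure \<Rightarrow> bool" where
  "mass_on R t \<mu> \<longleftrightarrow> sets \<mu> = sets borel \<and> 0 \<le> t \<and> emeasure \<mu> UNIV = ennreal t \<and> emeasure \<mu> (- {0..R}) = 0"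

lemma mass_on_sets: "mass_on R t \<mu> \<Longrightarrow> sets \<mu> = sets borel"
  by (simp add: mass_on_def)

lemma mass_on_space: "mass_on R t \<mu> \<Longrightarrow> space \<mu> = UNIV"
  using sets_eq_imp_space_eq[of \<mu> borel] by (simp add: mass_on_def)

lemma mass_on_finite: "mass_on R t \<mu> \<Longrightarrow> finite_measure \<mu>"
  using mass_on_space[of R t \<mu>] by (intro finite_measureI) (simp add: mass_on_def)

lemma mass_on_measure: "mass_on R t \<mu> \<Longrightarrow> measure \<mu> UNIV = t"
  by (simp add: mass_on_def measure_def)

lemma mass_on_AE: "mass_on R t \<mu> \<Longrightarrow> AE x in \<mu>. x \<in> {0..R}"
  by (rule AE_I[where N="- {0..R}"]) (auto simp: mass_on_def)

lemma borel_measurable_sets_borel: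
  assumes "f \<in> borel_measurable borel" "sets \<mu> = sets borel"
  shows "f \<in> borel_measurable \<mu>"
  using assms measurable_cong_sets[OF assms(2) refl] by auto

lemma mass_on_integrable_bounded:
  assumes m: "mass_on R t \<mu>" and f: "f \<in> borel_measurable borel"
    and B: "\<And>x. x \<in> {0..R} \<Longrightarrow> \<bar>f x\<bar> \<le> (B::real)"
  shows "integrable \<mu> f"
proof -
  interpret finite_measure \<mu> by (rule mass_on_finite[OF m])
  show ?thesis
    by (rule integrable_const_bound[where B=B])
       (use mass_on_AE[OF m] B f mass_on_sets[OF m] in \<open>auto intro: borel_measurable_sets_borel\<close>)
qed

lemma log_potential_eq_integral:
  assumes s: "sets \<mu> = sets borel" and int: "integrable \<mu> (\<lambda>s. ln \<bar>x - s\<bar>)"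
    and ae: "AE s in \<mu>. s \<noteq> x"
  shows "log_potential \<mu> x = ereal (- (\<integral>s. ln \<bar>x - s\<bar> \<partial>\<mu>))"
proof -
  let ?u = "\<lambda>s. - ln \<bar>x - s\<bar>"
  have int': "integrable \<mu> ?u" using int by simp
  have 1: "(\<integral>\<^sup>+ s. e2ennreal (log_kernel x s) \<partial>\<mu>) = (\<integral>\<^sup>+ s. ennreal (?u s) \<partial>\<mu>)"
    by (rule nn_integral_cong_AE) (use ae in eventually_elim, auto simp: log_kernel_def)
  have 2: "(\<integral>\<^sup>+ s. e2ennreal (- log_kernel x s) \<partial>\<mu>) = (\<integral>\<^sup>+ s. ennreal (- ?u s) \<partial>\<mu>)"
    by (rule nn_integral_cong_AE) (use ae in eventually_elim, auto simp: log_kernel_def)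
  have f1: "(\<integral>\<^sup>+ s. ennreal (?u s) \<partial>\<mu>) \<noteq> \<infinity>" and f2: "(\<integral>\<^sup>+ s. ennreal (- ?u s) \<partial>\<mu>) \<noteq> \<infinity>"
    using int' by (auto simp: real_integrable_def)
  have "log_potential \<mu> x = ereal (enn2real (\<integral>\<^sup>+ s. ennreal (?u s) \<partial>\<mu>) - enn2real (\<integral>\<^sup>+ s. ennreal (- ?u s) \<partial>\<mu>))"
    unfolding log_potential_def 1 2 using f1 f2
    by (metis enn2ereal_ennreal enn2real_nonneg ennreal_enn2real_if ereal_minus(1) infinity_ennreal_def)
  also have "enn2real (\<integral>\<^sup>+ s. ennreal (?u s) \<partial>\<mu>) - enn2real (\<integral>\<^sup>+ s. ennreal (- ?u s) \<partial>\<mu>) = (\<integral>s. ?u s \<partial>\<mu>)"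
    by (rule real_lebesgue_integral_def[OF int', symmetric])
  finally show ?thesis by simp
qed

lemma logk_eq_log_kernel:
  assumes "s \<noteq> x" "\<bar>x - s\<bar> \<le> R" "0 < R"
  shows "logk R x s = ennreal (- ln \<bar>x - s\<bar> + (\<bar>x - s\<bar> / R - (1 - ln R)))"
  using assms by (subst logk_off_diag) (auto simp: ln_div algebra_simps)

lemma neg_kernel_bound:
  assumes m: "mass_on R t \<mu>" and R: "0 < R" and x: "x \<in> {0..R}"
  shows "(\<integral>\<^sup>+ s. e2ennreal (- log_kernel x s) \<partial>\<mu>) < \<infinity>"
proof -
  have "(\<integral>\<^sup>+ s. e2ennreal (- log_kernel x s) \<partial>\<mu>) \<le> (\<integral>\<^sup>+ s. ennreal \<bar>ln R\<bar> \<partial>\<mu>)"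
  proof (rule nn_integral_mono_AE)
    show "AE s in \<mu>. e2ennreal (- log_kernel x s) \<le> ennreal \<bar>ln R\<bar>"
      using mass_on_AE[OF m]
    proof eventually_elim
      case (elim s)
      show ?case
      proof (cases "x = s")
        case False
        hence "ln \<bar>x - s\<bar> \<le> ln R" using elim x by (subst ln_le_cancel_iff) auto
        thus ?thesis using False by (auto simp: log_kernel_def intro!: ennreal_leI)
      qed (auto simp: log_kernel_def e2ennreal_neg)
    qed
  qed
  also have "\<dots> < \<infinity>" using m mass_on_space[OF m] by (simp add: mass_on_def ennreal_mult_less_top)
  finally show ?thesis .
qed

lemma abs_moment_bound:
  assumes m: "mass_on R t \<mu>" and x: "x \<in> {0..R}"
  shows "(\<integral>s. \<bar>x - s\<bar> \<partial>\<mu>) \<in> {0..R * t}" and "integrable \<mu> (\<lambda>s. \<bar>x - s\<bar>)"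
proof -
  interpret finite_measure \<mu> by (rule mass_on_finite[OF m])
  show i: "integrable \<mu> (\<lambda>s. \<bar>x - s\<bar>)"
    by (rule mass_on_integrable_bounded[OF m, where B=R]) (use x in auto)
  have "(\<integral>s. \<bar>x - s\<bar> \<partial>\<mu>) \<le> (\<integral>s. R \<partial>\<mu>)"
  proof (intro integral_mono_AE i)
    show "AE s in \<mu>. \<bar>x - s\<bar> \<le> R" using mass_on_AE[OF m] by eventually_elim (use x in auto)
  qed simp
  thus "(\<integral>s. \<bar>x - s\<bar> \<partial>\<mu>) \<in> {0..R * t}"
    using mass_on_measure[OF m] mass_on_space[OF m] by (simp add: mult.commute)
qed

lemma pot_finite_imp:
  assumes m: "mass_on R t \<mu>" and R: "0 < R" and x: "x \<in> {0..R}" and fin: "pot R \<mu> x \<noteq> \<infinity>"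
  shows "AE s in \<mu>. s \<noteq> x" "integrable \<mu> (\<lambda>s. ln \<bar>x - s\<bar>)"
proof -
  interpret finite_measure \<mu> by (rule mass_on_finite[OF m])
  note s[measurable_cong] = mass_on_sets[OF m]
  have dist: "AE s in \<mu>. \<bar>x - s\<bar> \<le> R"
    using mass_on_AE[OF m] by eventually_elim (use x in auto)
  have "AE s in \<mu>. logk R x s \<noteq> \<infinity>"
    using fin unfolding pot_def by (intro nn_integral_PInf_AE) auto
  thus ne: "AE s in \<mu>. s \<noteq> x" by eventually_elim (use logk_diag[OF R] in auto)
  let ?k = "\<lambda>s. - ln \<bar>x - s\<bar> + (\<bar>x - s\<bar> / R - (1 - ln R))"
  have k: "AE s in \<mu>. logk R x s = ennreal (?k s)"
    using ne dist by eventually_elim (rule logk_eq_log_kernel[OF _ _ R])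
  have k0: "AE s in \<mu>. 0 \<le> ?k s"
    using ne dist
  proof eventually_elim
    case (elim s)
    have "ln (\<bar>x - s\<bar> / R) \<le> \<bar>x - s\<bar> / R - 1" using elim R by (intro ln_le_minus_one) auto
    thus ?case using elim R by (simp add: ln_div)
  qed
  have pk: "pot R \<mu> x = (\<integral>\<^sup>+ s. ennreal (?k s) \<partial>\<mu>)"
    unfolding pot_def by (rule nn_integral_cong_AE[OF k])
  have ik: "integrable \<mu> ?k"
    by (rule integrableI_nonneg) (use k0 fin pk in \<open>auto simp: less_top\<close>)
  have "integrable \<mu> (\<lambda>s. (\<bar>x - s\<bar> / R - (1 - ln R)) - ?k s)"
    by (intro Bochner_Integration.integrable_diff ik) (use abs_moment_bound(2)[OF m x] in auto)
  thus "integrable \<mu> (\<lambda>s. ln \<bar>x - s\<bar>)" by simp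
qed

text \<open>Where both sides are finite, the identity integrates \<open>logk_eq_log_kernel\<close>.
  Where \<open>pot\<close> is infinite, the infinity must come from the positive part of the
  logarithmic kernel, because the negative part is bounded on the interval; hence the difference in
  \<open>log_potential\<close> is \<infinity> as well.\<close>

lemma pot_eq_log_potential:
  assumes m: "mass_on R t \<mu>" and R: "0 < R" and x: "x \<in> {0..R}"
  shows "enn2ereal (pot R \<mu> x) = log_potential \<mu> x + ereal ((\<integral>s. \<bar>x - s\<bar> \<partial>\<mu>) / R - t * (1 - ln R))"
proof -
  interpret finite_measure \<mu> by (rule mass_on_finite[OF m])
  note s[measurable_cong] = mass_on_sets[OF m]
  note intd = abs_moment_bound(2)[OF m x]
  have dist: "AE s in \<mu>. \<bar>x - s\<bar> \<le> R"
    using mass_on_AE[OF m] by eventually_elim (use x in auto)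
  show ?thesis
  proof (cases "pot R \<mu> x = \<infinity>")
    case True
    let ?pos = "\<integral>\<^sup>+ s. e2ennreal (log_kernel x s) \<partial>\<mu>"
    have "pot R \<mu> x \<le> (\<integral>\<^sup>+ s. e2ennreal (log_kernel x s) + ennreal (1 + \<bar>ln R\<bar>) \<partial>\<mu>)"
      unfolding pot_def
    proof (rule nn_integral_mono_AE)
      show "AE s in \<mu>. logk R x s \<le> e2ennreal (log_kernel x s) + ennreal (1 + \<bar>ln R\<bar>)"
        using dist
      proof eventually_elim
        case (elim s)
        show ?case
        proof (cases "s = x")
          case False
          have q: "\<bar>x - s\<bar> / R \<le> 1" using elim R by simp
          have "logk R x s \<le> ennreal (max 0 (- ln \<bar>x - s\<bar>) + (1 + \<bar>ln R\<bar>))"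
            unfolding logk_eq_log_kernel[OF False elim R] using q by (intro ennreal_leI) auto
          also have "\<dots> = ennreal (- ln \<bar>x - s\<bar>) + ennreal (1 + \<bar>ln R\<bar>)"
            by (subst ennreal_plus) (auto simp: ennreal_neg max_def)
          finally show ?thesis using False by (simp add: log_kernel_def)
        qed (simp add: log_kernel_def)
      qed
    qed
    also have "\<dots> \<le> ?pos + ennreal (1 + \<bar>ln R\<bar>) * ennreal t"
    proof (subst nn_integral_add)
      have "Measurable.pred borel (\<lambda>s::real. x = s)" by measurable
      hence [measurable]: "(\<lambda>s. log_kernel x s) \<in> borel_measurable borel"
        unfolding log_kernel_def by measurable
      have "(\<lambda>s. e2ennreal (log_kernel x s)) \<in> borel_measurable borel" by measurable
      thus "(\<lambda>s. e2ennreal (log_kernel x s)) \<in> borel_measurable \<mu>"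
        using s by (rule borel_measurable_sets_borel)
    qed (use m mass_on_space[OF m] in \<open>auto simp: mass_on_def\<close>)
    finally have "?pos = \<infinity>"
      using True by (auto simp: top_unique ennreal_mult[symmetric] ennreal_add_eq_top ennreal_mult_eq_top_iff)
    moreover obtain y where "(\<integral>\<^sup>+ s. e2ennreal (- log_kernel x s) \<partial>\<mu>) = ennreal y" "0 \<le> y"
      using neg_kernel_bound[OF m R x] by (cases "\<integral>\<^sup>+ s. e2ennreal (- log_kernel x s) \<partial>\<mu>") auto
    ultimately show ?thesis unfolding log_potential_def True by simp
  next
    case False
    note ne = pot_finite_imp(1)[OF m R x False] and il = pot_finite_imp(2)[OF m R x False]
    let ?k = "\<lambda>s. - ln \<bar>x - s\<bar> + (\<bar>x - s\<bar> / R - (1 - ln R))"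
    have k: "AE s in \<mu>. logk R x s = ennreal (?k s)"
      using ne dist by eventually_elim (rule logk_eq_log_kernel[OF _ _ R])
    have k0: "AE s in \<mu>. 0 \<le> ?k s"
      using ne dist
    proof eventually_elim
      case (elim s)
      have "ln (\<bar>x - s\<bar> / R) \<le> \<bar>x - s\<bar> / R - 1" using elim R by (intro ln_le_minus_one) auto
      thus ?case using elim R by (simp add: ln_div)
    qed
    have pk: "pot R \<mu> x = (\<integral>\<^sup>+ s. ennreal (?k s) \<partial>\<mu>)"
      unfolding pot_def by (rule nn_integral_cong_AE[OF k])
    have ik: "integrable \<mu> ?k" using il intd by simp
    have pk': "pot R \<mu> x = ennreal (\<integral>s. ?k s \<partial>\<mu>)"
      unfolding pk by (rule nn_integral_eq_integral[OF ik k0])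
    have "(\<integral>s. ?k s \<partial>\<mu>) = - (\<integral>s. ln \<bar>x - s\<bar> \<partial>\<mu>) + ((\<integral>s. \<bar>x - s\<bar> \<partial>\<mu>) / R - t * (1 - ln R))"
      using il intd mass_on_measure[OF m] mass_on_space[OF m] by simp
    moreover have "0 \<le> (\<integral>s. ?k s \<partial>\<mu>)" by (rule integral_nonneg_AE[OF k0])
    ultimately show ?thesis
      unfolding log_potential_eq_integral[OF s il ne] pk' by simp
  qed
qed

lemma log_potential_finite_imp:
  assumes m: "mass_on R t \<mu>" and R: "0 < R" and x: "x \<in> {0..R}" and fin: "log_potential \<mu> x = ereal u"
  shows "AE s in \<mu>. s \<noteq> x" "integrable \<mu> (\<lambda>s. ln \<bar>x - s\<bar>)" "u = - (\<integral>s. ln \<bar>x - s\<bar> \<partial>\<mu>)"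
proof -
  have "pot R \<mu> x \<noteq> \<infinity>" using pot_eq_log_potential[OF m R x] fin by auto
  from pot_finite_imp[OF m R x this] show *: "AE s in \<mu>. s \<noteq> x" "integrable \<mu> (\<lambda>s. ln \<bar>x - s\<bar>)" .
  show "u = - (\<integral>s. ln \<bar>x - s\<bar> \<partial>\<mu>)"
    using fin log_potential_eq_integral[OF mass_on_sets[OF m] *(2,1)] by simp
qed

lemma log_potential_lower_bound:
  assumes m: "mass_on R t \<mu>" and R: "0 < R" and x: "x \<in> {0..R}"
  shows "ereal (- t * ln R) \<le> log_potential \<mu> x"
proof -
  have "(\<integral>s. \<bar>x - s\<bar> \<partial>\<mu>) \<le> R * t" using abs_moment_bound(1)[OF m x] by simp
  hence a: "(\<integral>s. \<bar>x - s\<bar> \<partial>\<mu>) / R - t * (1 - ln R) \<le> t * ln R"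
    using R by (simp add: field_simps)
  have "0 \<le> log_potential \<mu> x + ereal ((\<integral>s. \<bar>x - s\<bar> \<partial>\<mu>) / R - t * (1 - ln R))"
    using pot_eq_log_potential[OF m R x] enn2ereal_nonneg[of "pot R \<mu> x"] by simp
  thus ?thesis using a by (cases "log_potential \<mu> x") auto
qed

section \<open>Energies as real numbers\<close>

text \<open>The energy for the kernel \<open>\<bar>x - s\<bar>\<close>, which is the part by which
  \<open>logk\<close> and \<open>- ln\<close> differ beyond a constant.\<close>

definition cdist :: "real measure \<Rightarrow> real measure \<Rightarrow> real" where
  "cdist \<mu> \<kappa> = (\<integral>x. (\<integral>s. \<bar>x - s\<bar> \<partial>\<mu>) \<partial>\<kappa>)"

text \<open>The logarithmic energy; unlike \<^term>\<open>energy R\<close> it does not depend on \<^term>\<open>R\<close>.\<close>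
definition menergy :: "real \<Rightarrow> real measure \<Rightarrow> real measure \<Rightarrow> real" where
  "menergy R \<mu> \<kappa> = enn2real (energy R \<mu> \<kappa>) - cdist \<mu> \<kappa> / R + measure \<mu> UNIV * measure \<kappa> UNIV * (1 - ln R)"

lemma measurable_abs_moment:
  assumes m: "mass_on R t \<mu>"
  shows "(\<lambda>x. \<integral>s. \<bar>x - s\<bar> \<partial>\<mu>) \<in> borel_measurable borel"
proof -
  interpret finite_measure \<mu> by (rule mass_on_finite[OF m])
  note s[measurable_cong] = mass_on_sets[OF m]
  show ?thesis by measurable
qed

lemma abs_moment_integrable:
  assumes m: "mass_on R t \<mu>" and k: "mass_on R b \<kappa>"
  shows "integrable \<kappa> (\<lambda>x. \<integral>s. \<bar>x - s\<bar> \<partial>\<mu>)"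
  by (rule mass_on_integrable_bounded[OF k measurable_abs_moment[OF m], where B="R * t"])
     (use abs_moment_bound[OF m] in fastforce)

lemma cdist_integrand:
  assumes m: "mass_on R a \<mu>" and k: "mass_on R b \<kappa>" and f: "integrable \<kappa> f"
  shows "integrable \<kappa> (\<lambda>x. f x + ((\<integral>s. \<bar>x - s\<bar> \<partial>\<mu>) / R - a * (1 - ln R)))"
    and "(\<integral>x. f x + ((\<integral>s. \<bar>x - s\<bar> \<partial>\<mu>) / R - a * (1 - ln R)) \<partial>\<kappa>)
       = (\<integral>x. f x \<partial>\<kappa>) + cdist \<mu> \<kappa> / R - measure \<mu> UNIV * measure \<kappa> UNIV * (1 - ln R)"
proof -
  interpret finite_measure \<kappa> by (rule mass_on_finite[OF k])
  show "integrable \<kappa> (\<lambda>x. f x + ((\<integral>s. \<bar>x - s\<bar> \<partial>\<mu>) / R - a * (1 - ln R)))"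
    using f abs_moment_integrable[OF m k] by simp
  show "(\<integral>x. f x + ((\<integral>s. \<bar>x - s\<bar> \<partial>\<mu>) / R - a * (1 - ln R)) \<partial>\<kappa>)
       = (\<integral>x. f x \<partial>\<kappa>) + cdist \<mu> \<kappa> / R - measure \<mu> UNIV * measure \<kappa> UNIV * (1 - ln R)"
    using f abs_moment_integrable[OF m k] mass_on_measure[OF m] mass_on_measure[OF k] mass_on_space[OF k]
    by (simp add: cdist_def)
qed

text \<open>A lower bound for the potential is integrated. \<open>enn2real\<close> sends \<infinity>
  to 0, so an infinite energy would destroy the inequality; hence the assumption of finiteness,
  which \<open>menergy_le\<close> supplies.\<close>

lemma menergy_ge:
  assumes m: "mass_on R a \<mu>" and k: "mass_on R b \<kappa>" and R: "0 < R" and f: "integrable \<kappa> f"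
    and le: "AE x in \<kappa>. ereal (f x) \<le> log_potential \<mu> x" and fin: "energy R \<mu> \<kappa> < \<infinity>"
  shows "(\<integral>x. f x \<partial>\<kappa>) \<le> menergy R \<mu> \<kappa>"
proof -
  let ?g = "\<lambda>x. f x + ((\<integral>s. \<bar>x - s\<bar> \<partial>\<mu>) / R - a * (1 - ln R))"
  note g = cdist_integrand[OF m k f]
  have "ennreal (\<integral>x. ?g x \<partial>\<kappa>) \<le> ennreal (\<integral>x. max 0 (?g x) \<partial>\<kappa>)"
    using g(1) by (intro ennreal_leI integral_mono) auto
  also have "\<dots> = (\<integral>\<^sup>+x. ennreal (max 0 (?g x)) \<partial>\<kappa>)"
    using g(1) by (intro nn_integral_eq_integral[symmetric]) auto
  also have "\<dots> \<le> energy R \<mu> \<kappa>"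
    unfolding energy_def
  proof (rule nn_integral_mono_AE)
    show "AE x in \<kappa>. ennreal (max 0 (?g x)) \<le> pot R \<mu> x"
      using le mass_on_AE[OF k]
    proof eventually_elim
      case (elim x)
      have "ereal (?g x) \<le> enn2ereal (pot R \<mu> x)"
        unfolding pot_eq_log_potential[OF m R elim(2)] plus_ereal.simps(1)[symmetric]
        by (rule add_right_mono[OF elim(1)])
      thus ?case
        by (metis e2ennreal_enn2ereal e2ennreal_ereal e2ennreal_mono ennreal_max_0)
    qed
  qed
  finally have "(\<integral>x. ?g x \<partial>\<kappa>) \<le> enn2real (energy R \<mu> \<kappa>)"
    using fin by (metis enn2real_nonneg ennreal_enn2real ennreal_le_iff infinity_ennreal_def)
  thus ?thesis unfolding g(2) menergy_def by simp
qed

lemma menergy_le: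
  assumes m: "mass_on R a \<mu>" and k: "mass_on R b \<kappa>" and R: "0 < R" and f: "integrable \<kappa> f"
    and le: "AE x in \<kappa>. log_potential \<mu> x \<le> ereal (f x)"
  shows "energy R \<mu> \<kappa> < \<infinity>" "menergy R \<mu> \<kappa> \<le> (\<integral>x. f x \<partial>\<kappa>)"
proof -
  let ?g = "\<lambda>x. f x + ((\<integral>s. \<bar>x - s\<bar> \<partial>\<mu>) / R - a * (1 - ln R))"
  note g = cdist_integrand[OF m k f]
  have *: "AE x in \<kappa>. enn2ereal (pot R \<mu> x) \<le> ereal (?g x)"
    using le mass_on_AE[OF k]
  proof eventually_elim
    case (elim x)
    show ?case
      unfolding pot_eq_log_potential[OF m R elim(2)] plus_ereal.simps(1)[symmetric]
      by (rule add_right_mono[OF elim(1)])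
  qed
  have 0: "AE x in \<kappa>. 0 \<le> ?g x"
    using * by eventually_elim (metis enn2ereal_nonneg ereal_less_eq(5) order_trans)
  have "energy R \<mu> \<kappa> \<le> (\<integral>\<^sup>+x. ennreal (?g x) \<partial>\<kappa>)"
    unfolding energy_def
  proof (rule nn_integral_mono_AE)
    show "AE x in \<kappa>. pot R \<mu> x \<le> ennreal (?g x)"
      using * by eventually_elim (metis e2ennreal_enn2ereal e2ennreal_ereal e2ennreal_mono)
  qed
  also have "\<dots> = ennreal (\<integral>x. ?g x \<partial>\<kappa>)"
    by (rule nn_integral_eq_integral[OF g(1) 0])
  finally have e: "energy R \<mu> \<kappa> \<le> ennreal (\<integral>x. ?g x \<partial>\<kappa>)" .
  show "energy R \<mu> \<kappa> < \<infinity>" using e by (metis ennreal_less_top infinity_ennreal_def le_less_trans)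
  have "enn2real (energy R \<mu> \<kappa>) \<le> (\<integral>x. ?g x \<partial>\<kappa>)"
    using e integral_nonneg_AE[OF 0] by (intro enn2real_leI)
  thus "menergy R \<mu> \<kappa> \<le> (\<integral>x. f x \<partial>\<kappa>)" unfolding g(2) menergy_def by simp
qed

lemma nn_cdist:
  assumes m: "mass_on R a \<mu>" and k: "mass_on R b \<kappa>"
  shows "(\<integral>\<^sup>+x. (\<integral>\<^sup>+s. ennreal \<bar>x - s\<bar> \<partial>\<mu>) \<partial>\<kappa>) = ennreal (cdist \<mu> \<kappa>)" "0 \<le> cdist \<mu> \<kappa>"
proof -
  have "(\<integral>\<^sup>+x. (\<integral>\<^sup>+s. ennreal \<bar>x - s\<bar> \<partial>\<mu>) \<partial>\<kappa>) = (\<integral>\<^sup>+x. ennreal (\<integral>s. \<bar>x - s\<bar> \<partial>\<mu>) \<partial>\<kappa>)"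
  proof (rule nn_integral_cong_AE)
    show "AE x in \<kappa>. (\<integral>\<^sup>+s. ennreal \<bar>x - s\<bar> \<partial>\<mu>) = ennreal (\<integral>s. \<bar>x - s\<bar> \<partial>\<mu>)"
      using mass_on_AE[OF k]
      by eventually_elim (intro nn_integral_eq_integral abs_moment_bound[OF m], auto)
  qed
  also have "\<dots> = ennreal (cdist \<mu> \<kappa>)"
    unfolding cdist_def by (intro nn_integral_eq_integral abs_moment_integrable[OF m k]) auto
  finally show "(\<integral>\<^sup>+x. (\<integral>\<^sup>+s. ennreal \<bar>x - s\<bar> \<partial>\<mu>) \<partial>\<kappa>) = ennreal (cdist \<mu> \<kappa>)" .
  show "0 \<le> cdist \<mu> \<kappa>" unfolding cdist_def by (intro Bochner_Integration.integral_nonneg) auto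
qed

section \<open>Distribution functions and energy distance\<close>

lemma measurable_cdf: 
  assumes "finite_measure \<mu>" and [measurable_cong]: "sets \<mu> = sets borel"
  shows "cdf \<mu> \<in> borel_measurable borel"
proof -
  interpret finite_measure \<mu> by fact
  have "mono (cdf \<mu>)"
    unfolding mono_def cdf_def by (auto intro!: finite_measure_mono simp: assms(2))
  thus ?thesis by (rule borel_measurable_mono)
qed

lemma mass_on_cdf:
  assumes m: "mass_on R a \<mu>"
  shows "cdf \<mu> z \<in> {0..a}" "z < 0 \<Longrightarrow> cdf \<mu> z = 0" "R \<le> z \<Longrightarrow> cdf \<mu> z = a"
    "emeasure \<mu> {..z} = ennreal (cdf \<mu> z)" "emeasure \<mu> {z<..} = ennreal (a - cdf \<mu> z)"
proof -
  interpret finite_measure \<mu> by (rule mass_on_finite[OF m])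
  note [simp] = mass_on_sets[OF m] mass_on_space[OF m]
  have c: "cdf \<mu> z \<le> a"
    unfolding cdf_def mass_on_measure[OF m, symmetric] by (rule finite_measure_mono) auto
  thus "cdf \<mu> z \<in> {0..a}" by (simp add: cdf_def)
  show "emeasure \<mu> {..z} = ennreal (cdf \<mu> z)" by (simp add: cdf_def emeasure_eq_measure)
  have "{z<..} = UNIV - {..z}" by auto
  hence z: "measure \<mu> {z<..} = a - cdf \<mu> z"
    using finite_measure_Diff[of UNIV "{..z}"] mass_on_measure[OF m] by (simp add: cdf_def)
  thus "emeasure \<mu> {z<..} = ennreal (a - cdf \<mu> z)" by (simp add: emeasure_eq_measure)
  have 0: "measure \<mu> (- {0..R}) = 0" using m by (simp add: mass_on_def measure_def)
  { assume "z < 0"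
    hence "measure \<mu> {..z} \<le> measure \<mu> (- {0..R})" by (intro finite_measure_mono) auto
    thus "cdf \<mu> z = 0" using 0 measure_nonneg[of \<mu> "{..z}"] by (simp add: cdf_def) }
  { assume "R \<le> z"
    hence "measure \<mu> {z<..} \<le> measure \<mu> (- {0..R})" by (intro finite_measure_mono) auto
    thus "cdf \<mu> z = a" using 0 z measure_nonneg[of \<mu> "{z<..}"] by simp }
qed

text \<open>\<open>\<bar>x - s\<bar>\<close> is the length of the set of \<open>z\<close> that
  separate \<open>x\<close> from \<open>s\<close>. Exchanging the integrals counts, for each
  \<open>z\<close>, the mass of one measure to the left times that of the other to the
  right.\<close>

lemma cdist_cdf:
  assumes m: "mass_on R a \<mu>" and k: "mass_on R b \<kappa>" and R: "0 < R"
  shows "integrable lborel (\<lambda>z. cdf \<mu> z * (b - cdf \<kappa> z) + cdf \<kappa> z * (a - cdf \<mu> z))"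
    and "cdist \<mu> \<kappa> = (\<integral>z. cdf \<mu> z * (b - cdf \<kappa> z) + cdf \<kappa> z * (a - cdf \<mu> z) \<partial>lborel)"
proof -
  let ?h = "\<lambda>z. cdf \<mu> z * (b - cdf \<kappa> z) + cdf \<kappa> z * (a - cdf \<mu> z)"
  note s[measurable_cong] = mass_on_sets[OF m] mass_on_sets[OF k]
  interpret finite_measure \<mu> by (rule mass_on_finite[OF m])
  interpret k: finite_measure \<kappa> by (rule mass_on_finite[OF k])
  have [measurable]: "cdf \<mu> \<in> borel_measurable borel" "cdf \<kappa> \<in> borel_measurable borel"
    by (intro measurable_cdf mass_on_finite[OF m] mass_on_finite[OF k] s)+
  note cm = mass_on_cdf[OF m] and ck = mass_on_cdf[OF k]
  have ab: "0 \<le> a" "0 \<le> b" using m k by (auto simp: mass_on_def)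
  have h0: "0 \<le> ?h z" for z using cm(1)[of z] ck(1)[of z] by (intro add_nonneg_nonneg mult_nonneg_nonneg) auto
  have hb: "?h z \<le> a * b + b * a" for z
    using cm(1)[of z] ck(1)[of z] ab by (intro add_mono mult_mono) auto
  have hz: "?h z = 0" if "z \<notin> {0..R}" for z
    using that cm(2,3)[of z] ck(2,3)[of z] by (cases "z < 0") auto
  show i: "integrable lborel ?h"
  proof (rule Bochner_Integration.integrable_bound[where f="\<lambda>z. indicator {0..R} z * (a * b + b * a)"])
    show "integrable lborel (\<lambda>z. indicator {0..R} z * (a * b + b * a))" using R by simp
    show "AE z in lborel. norm (?h z) \<le> norm (indicator {0..R} z * (a * b + b * a))"
      using h0 hb hz ab by (intro AE_I2) (auto simp: indicator_def)
  qed measurable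
  let ?I = "\<lambda>z s x::real. (if s \<le> z \<and> z < x then 1 else 0::ennreal)"
  have abs: "ennreal \<bar>x - s\<bar> = (\<integral>\<^sup>+z. ?I z s x + ?I z x s \<partial>lborel)" for x s :: real
  proof -
    have "(\<integral>\<^sup>+z. ?I z s x + ?I z x s \<partial>lborel) = (\<integral>\<^sup>+z. indicator {s..<x} z + indicator {x..<s} z \<partial>lborel)"
      by (intro nn_integral_cong) (auto simp: indicator_def)
    also have "\<dots> = emeasure lborel {s..<x} + emeasure lborel {x..<s}"
      by (simp add: nn_integral_add)
    also have "\<dots> = ennreal \<bar>x - s\<bar>" by (cases "s \<le> x") auto
    finally show ?thesis by simp
  qed
  have "ennreal (cdist \<mu> \<kappa>) = (\<integral>\<^sup>+x. (\<integral>\<^sup>+s. (\<integral>\<^sup>+z. ?I z s x + ?I z x s \<partial>lborel) \<partial>\<mu>) \<partial>\<kappa>)"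
    unfolding nn_cdist(1)[OF m k, symmetric] abs ..
  also have "\<dots> = (\<integral>\<^sup>+x. (\<integral>\<^sup>+z. (\<integral>\<^sup>+s. ?I z s x + ?I z x s \<partial>\<mu>) \<partial>lborel) \<partial>\<kappa>)"
    by (intro nn_integral_cong nn_integral_swap sigma_finite_lborel) (unfold_locales, measurable)
  also have "\<dots> = (\<integral>\<^sup>+z. (\<integral>\<^sup>+x. (\<integral>\<^sup>+s. ?I z s x + ?I z x s \<partial>\<mu>) \<partial>\<kappa>) \<partial>lborel)"
    by (intro nn_integral_swap sigma_finite_lborel) (unfold_locales, measurable)
  also have "\<dots> = (\<integral>\<^sup>+z. ennreal (?h z) \<partial>lborel)"
  proof (intro nn_integral_cong)
    fix z
    have "(\<integral>\<^sup>+x. (\<integral>\<^sup>+s. ?I z s x + ?I z x s \<partial>\<mu>) \<partial>\<kappa>)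
      = (\<integral>\<^sup>+x. (\<integral>\<^sup>+s. indicator {..z} s * indicator {z<..} x + indicator {..z} x * indicator {z<..} s \<partial>\<mu>) \<partial>\<kappa>)"
      by (intro nn_integral_cong) (auto simp: indicator_def)
    also have "\<dots> = (\<integral>\<^sup>+x. emeasure \<mu> {..z} * indicator {z<..} x + indicator {..z} x * emeasure \<mu> {z<..} \<partial>\<kappa>)"
      by (intro nn_integral_cong) (simp add: nn_integral_add nn_integral_cmult nn_integral_multc s)
    also have "\<dots> = emeasure \<mu> {..z} * emeasure \<kappa> {z<..} + emeasure \<kappa> {..z} * emeasure \<mu> {z<..}"
      by (simp add: nn_integral_add nn_integral_cmult nn_integral_multc s)
    also have "\<dots> = ennreal (?h z)"
      unfolding cm(4,5) ck(4,5) using cm(1)[of z] ck(1)[of z] by (simp add: ennreal_mult ennreal_plus)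
    finally show "(\<integral>\<^sup>+x. (\<integral>\<^sup>+s. ?I z s x + ?I z x s \<partial>\<mu>) \<partial>\<kappa>) = ennreal (?h z)" .
  qed
  also have "\<dots> = ennreal (\<integral>z. ?h z \<partial>lborel)"
    by (rule nn_integral_eq_integral[OF i]) (use h0 in auto)
  finally show "cdist \<mu> \<kappa> = (\<integral>z. ?h z \<partial>lborel)"
    using nn_cdist(2)[OF m k] h0 by (subst (asm) ennreal_inj) (auto intro!: Bochner_Integration.integral_nonneg)
qed

text \<open>Pointwise in \<open>z\<close>, with equal total masses, the terms linear in the
  distribution functions cancel and the square remains. This is the conditional definiteness of
  \<open>- \<bar>x - s\<bar>\<close> with an explicit gain.\<close>

lemma cdist_cdf_L2:
  assumes m: "mass_on R t \<mu>" and k: "mass_on R t \<kappa>" and R: "0 < R"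
  shows "integrable lborel (\<lambda>z. (cdf \<mu> z - cdf \<kappa> z)\<^sup>2)"
    and "2 * cdist \<mu> \<kappa> - cdist \<mu> \<mu> - cdist \<kappa> \<kappa> = 2 * (\<integral>z. (cdf \<mu> z - cdf \<kappa> z)\<^sup>2 \<partial>lborel)"
proof -
  note A = cdist_cdf[OF m k R] and B = cdist_cdf[OF m m R] and C = cdist_cdf[OF k k R]
  let ?A = "\<lambda>z. cdf \<mu> z * (t - cdf \<kappa> z) + cdf \<kappa> z * (t - cdf \<mu> z)"
  let ?B = "\<lambda>z. cdf \<mu> z * (t - cdf \<mu> z) + cdf \<mu> z * (t - cdf \<mu> z)"
  let ?C = "\<lambda>z. cdf \<kappa> z * (t - cdf \<kappa> z) + cdf \<kappa> z * (t - cdf \<kappa> z)"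
  have eq: "(\<lambda>z. 2 * ?A z - ?B z - ?C z) = (\<lambda>z. 2 * (cdf \<mu> z - cdf \<kappa> z)\<^sup>2)"
    by (intro ext) (simp add: power2_eq_square algebra_simps)
  have "integrable lborel (\<lambda>z. 2 * ?A z - ?B z - ?C z)"
    by (intro Bochner_Integration.integrable_diff integrable_mult_right A(1) B(1) C(1))
  thus "integrable lborel (\<lambda>z. (cdf \<mu> z - cdf \<kappa> z)\<^sup>2)" unfolding eq by simp
  have "2 * cdist \<mu> \<kappa> - cdist \<mu> \<mu> - cdist \<kappa> \<kappa> = (\<integral>z. 2 * ?A z - ?B z - ?C z \<partial>lborel)"
    unfolding A(2) B(2) C(2)
    by (subst Bochner_Integration.integral_diff[OF Bochner_Integration.integrable_diff[OF integrable_mult_right[OF A(1)] B(1)] C(1)],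
        subst Bochner_Integration.integral_diff[OF integrable_mult_right[OF A(1)] B(1)]) (simp only: integral_mult_right_zero)
  thus "2 * cdist \<mu> \<kappa> - cdist \<mu> \<mu> - cdist \<kappa> \<kappa> = 2 * (\<integral>z. (cdf \<mu> z - cdf \<kappa> z)\<^sup>2 \<partial>lborel)"
    unfolding eq by simp
qed

lemma menergy_commute:
  assumes m: "mass_on R a \<mu>" and k: "mass_on R b \<kappa>" and R: "0 < R"
  shows "menergy R \<mu> \<kappa> = menergy R \<kappa> \<mu>"
  unfolding menergy_def
  using energy_commute[OF mass_on_finite[OF m] mass_on_sets[OF m] mass_on_finite[OF k] mass_on_sets[OF k]]
    cdist_cdf(2)[OF m k R] cdist_cdf(2)[OF k m R]
  by (simp add: add.commute mult.commute)

text \<open>The window part of the energy contributes a nonnegative amount by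
  \<open>energy_psd\<close>, the constant \<open>1 - ln R\<close> cancels since the masses agree,
  and the distance kernel contributes the square integral.\<close>

lemma energy_distance:
  assumes m: "mass_on R t \<mu>" and k: "mass_on R t \<kappa>" and R: "0 < R"
    and f: "energy R \<mu> \<mu> < \<infinity>" "energy R \<kappa> \<kappa> < \<infinity>"
  shows "energy R \<mu> \<kappa> < \<infinity>"
    "2 / R * (\<integral>z. (cdf \<mu> z - cdf \<kappa> z)\<^sup>2 \<partial>lborel) \<le> menergy R \<mu> \<mu> + menergy R \<kappa> \<kappa> - 2 * menergy R \<mu> \<kappa>"
proof -
  have p: "2 * energy R \<mu> \<kappa> \<le> energy R \<mu> \<mu> + energy R \<kappa> \<kappa>"
    by (rule energy_psd[OF mass_on_finite[OF m] mass_on_sets[OF m] mass_on_finite[OF k] mass_on_sets[OF k]])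
  obtain x y where xy: "energy R \<mu> \<mu> = ennreal x" "energy R \<kappa> \<kappa> = ennreal y" "0 \<le> x" "0 \<le> y"
    using f by (cases "energy R \<mu> \<mu>"; cases "energy R \<kappa> \<kappa>") auto
  have le: "2 * energy R \<mu> \<kappa> \<le> ennreal (x + y)" using p xy by simp
  show fin: "energy R \<mu> \<kappa> < \<infinity>"
  proof (rule ccontr)
    assume "\<not> ?thesis"
    hence "energy R \<mu> \<kappa> = top" by (simp add: less_top[symmetric])
    hence "2 * energy R \<mu> \<kappa> = top" by (simp add: ennreal_mult_top)
    thus False using le by (simp add: top_unique)
  qed
  obtain z where z: "energy R \<mu> \<kappa> = ennreal z" "0 \<le> z" using fin by (cases "energy R \<mu> \<kappa>") auto
  have "ennreal (2 * z) \<le> ennreal (x + y)" using le z by (simp add: ennreal_mult)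
  hence "2 * z \<le> x + y" using xy by (subst (asm) ennreal_le_iff) auto
  hence e: "2 * enn2real (energy R \<mu> \<kappa>) \<le> enn2real (energy R \<mu> \<mu>) + enn2real (energy R \<kappa> \<kappa>)"
    using xy z by simp
  have "menergy R \<mu> \<mu> + menergy R \<kappa> \<kappa> - 2 * menergy R \<mu> \<kappa>
    = enn2real (energy R \<mu> \<mu>) + enn2real (energy R \<kappa> \<kappa>) - 2 * enn2real (energy R \<mu> \<kappa>)
      + (2 * cdist \<mu> \<kappa> - cdist \<mu> \<mu> - cdist \<kappa> \<kappa>) / R"
    unfolding menergy_def mass_on_measure[OF m] mass_on_measure[OF k] using R by (simp add: field_simps)
  also have "\<dots> \<ge> (2 * cdist \<mu> \<kappa> - cdist \<mu> \<mu> - cdist \<kappa> \<kappa>) / R" using e by simp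
  finally show "2 / R * (\<integral>z. (cdf \<mu> z - cdf \<kappa> z)\<^sup>2 \<partial>lborel) \<le> menergy R \<mu> \<mu> + menergy R \<kappa> \<kappa> - 2 * menergy R \<mu> \<kappa>"
    unfolding cdist_cdf_L2(2)[OF m k R] by simp
qed

text \<open>Both self-energies are bounded above by a constant times \<open>t\<close> minus the
  integral of the field, up to the error \<open>\<delta>'\<close>, and the mixed energy is bounded
  below twice, by integrating the potential of either measure against the other. In the sum the
  field and both constants \<open>c\<close> and \<open>C\<close> cancel and
  \<open>\<delta> * t + \<delta>'\<close> remains. For \<open>\<kappa>\<close> an upper bound is
  asked of the energy and not of the potential, because the comparison measures used below may have
  a potential that is too large on part of their support.\<close>

lemma equilibrium_stability:
  assumes m: "mass_on R t \<nu>" and k: "mass_on R t \<kappa>" and R: "0 < R"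
    and \<phi>: "integrable \<nu> \<phi>" "integrable \<kappa> \<phi>"
    and eq: "AE x in \<nu>. log_potential \<nu> x = ereal (c - \<phi> x)"
    and ge: "AE x in \<kappa>. ereal (c - \<phi> x) \<le> log_potential \<nu> x"
    and kge: "AE x in \<nu>. ereal (C - \<delta> - \<phi> x) \<le> log_potential \<kappa> x"
    and kfin: "energy R \<kappa> \<kappa> < \<infinity>"
    and kle: "menergy R \<kappa> \<kappa> \<le> C * t + \<delta>' - (\<integral>x. \<phi> x \<partial>\<kappa>)"
  shows "(\<integral>z. (cdf \<nu> z - cdf \<kappa> z)\<^sup>2 \<partial>lborel) \<le> R * (\<delta> * t + \<delta>') / 2"
proof -
  interpret finite_measure \<nu> by (rule mass_on_finite[OF m])
  interpret k: finite_measure \<kappa> by (rule mass_on_finite[OF k])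
  note sp = mass_on_space[OF m] mass_on_space[OF k] mass_on_measure[OF m] mass_on_measure[OF k]
  have i1: "integrable \<nu> (\<lambda>x. c - \<phi> x)" "integrable \<kappa> (\<lambda>x. c - \<phi> x)" "integrable \<nu> (\<lambda>x. C - \<delta> - \<phi> x)"
    using \<phi> by auto
  have "AE x in \<nu>. log_potential \<nu> x \<le> ereal (c - \<phi> x)" using eq by eventually_elim simp
  note nn = menergy_le[OF m m R i1(1) this]
  note fin = energy_distance[OF m k R nn(1) kfin]
  have 1: "(\<integral>x. c - \<phi> x \<partial>\<kappa>) \<le> menergy R \<nu> \<kappa>"
    by (rule menergy_ge[OF m k R i1(2) ge fin(1)])
  have 2: "(\<integral>x. C - \<delta> - \<phi> x \<partial>\<nu>) \<le> menergy R \<nu> \<kappa>"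
    unfolding menergy_commute[OF m k R]
    by (rule menergy_ge[OF k m R i1(3) kge])
       (use fin(1) energy_commute[OF mass_on_finite[OF m] mass_on_sets[OF m] mass_on_finite[OF k] mass_on_sets[OF k]] in simp)
  have "2 / R * (\<integral>z. (cdf \<nu> z - cdf \<kappa> z)\<^sup>2 \<partial>lborel) \<le> \<delta> * t + \<delta>'"
    using fin(2) nn(2) 1 2 kle \<phi> by (simp add: sp algebra_simps)
  thus ?thesis using R by (simp add: field_simps)
qed

lemma mass_on_finite_borel: "mass_on R t \<mu> \<Longrightarrow> finite_borel_measure \<mu>"
  unfolding finite_borel_measure_def finite_borel_measure_axioms_def
  using mass_on_finite mass_on_sets by blast

section \<open>Supports and the equilibrium conditions\<close>

text \<open>The complement is a union of null open sets, in general uncountable; the Lindelof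
  property leaves a countable subfamily.\<close>

lemma emeasure_compl_measure_support:
  assumes s: "sets \<mu> = sets borel"
  shows "emeasure \<mu> (- measure_support \<mu>) = 0"
proof -
  define \<U> where "\<U> = {U. open U \<and> emeasure \<mu> U = 0}"
  obtain \<F> where F: "\<F> \<subseteq> \<U>" "countable \<F>" "\<Union>\<F> = \<Union>\<U>"
    by (rule Lindelof[of \<U>]) (auto simp: \<U>_def)
  have "- measure_support \<mu> = \<Union>\<U>"
    by (auto simp: measure_support_def \<U>_def)
  moreover have "\<Union>\<F> \<in> null_sets \<mu>"
    using F(1,2) by (intro null_sets_UN'[of \<F> "\<lambda>x. x", simplified]) (auto simp: \<U>_def null_sets_def s)
  ultimately show ?thesis using F(3) by auto
qed

lemma closed_measure_support: "closed (measure_support \<mu>)"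
proof -
  have "- measure_support \<mu> = \<Union>{U. open U \<and> emeasure \<mu> U = 0}"
    by (auto simp: measure_support_def)
  hence "open (- measure_support \<mu>)" by (metis (no_types, lifting) mem_Collect_eq open_Union)
  thus ?thesis by (simp add: closed_def)
qed

lemma AE_measure_support:
  assumes s: "sets \<mu> = sets borel"
  shows "AE x in \<mu>. x \<in> measure_support \<mu>"
  by (rule AE_I[where N="- measure_support \<mu>"])
     (use emeasure_compl_measure_support[OF s] closed_measure_support[of \<mu>] in \<open>auto simp: s\<close>)

lemma emeasure_UNIV_of_support:
  assumes s: "sets \<mu> = sets borel" and sub: "measure_support \<mu> \<subseteq> A" and A: "A \<in> sets borel"
  shows "emeasure \<mu> A = emeasure \<mu> UNIV" "emeasure \<mu> (- A) = 0"
proof -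
  have "AE x in \<mu>. x \<in> A" using AE_measure_support[OF s] sub by (auto elim: eventually_mono)
  thus "emeasure \<mu> A = emeasure \<mu> UNIV"
    using A sets_eq_imp_space_eq[OF s] by (intro emeasure_eq_AE) (auto simp: s)
  show "emeasure \<mu> (- A) = 0"
    using emeasure_compl_measure_support[OF s] sub
      emeasure_mono[of "- A" "- measure_support \<mu>" \<mu>] closed_measure_support[of \<mu>]
    by (simp add: s)
qed

lemma equilibrium_mass_on:
  assumes e: "equilibrium_measure {0..} \<phi> t \<nu>" and t: "0 \<le> t" and R: "measure_support \<nu> \<subseteq> {..R}"
  shows "mass_on R t \<nu>"
proof -
  have s: "sets \<nu> = sets borel" and tot: "emeasure \<nu> {0..} = ennreal t" and S: "measure_support \<nu> \<subseteq> {0..}"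
    using e by (auto simp: equilibrium_measure_def)
  have S': "measure_support \<nu> \<subseteq> {0..R}" using S R by auto
  show ?thesis
    unfolding mass_on_def using s t tot emeasure_UNIV_of_support(1)[OF s S] emeasure_UNIV_of_support(2)[OF s S']
    by simp
qed

lemma equilibrium_potential:
  assumes e: "equilibrium_measure \<Sigma> \<phi> t \<nu>"
  obtains c where "\<And>x. x \<in> measure_support \<nu> \<Longrightarrow> log_potential \<nu> x = ereal (c - \<phi> x)"
    "\<And>x. x \<in> \<Sigma> \<Longrightarrow> ereal (c - \<phi> x) \<le> log_potential \<nu> x"
proof -
  obtain c where c: "\<forall>x\<in>measure_support \<nu>. log_potential \<nu> x + ereal (\<phi> x) = ereal c"
    "\<forall>x\<in>\<Sigma>. log_potential \<nu> x + ereal (\<phi> x) \<ge> ereal c"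
    using e unfolding equilibrium_measure_def by blast
  show thesis
  proof (rule that[of c])
    show "log_potential \<nu> x = ereal (c - \<phi> x)" if "x \<in> measure_support \<nu>" for x
      using c(1)[rule_format, OF that] by (cases "log_potential \<nu> x") auto
    show "ereal (c - \<phi> x) \<le> log_potential \<nu> x" if "x \<in> \<Sigma>" for x
      using c(2)[rule_format, OF that] by (cases "log_potential \<nu> x") auto
  qed
qed

section \<open>From close distribution functions to equality and weak convergence\<close>

text \<open>A vanishing integral gives equality almost everywhere; right continuity turns a
  difference at one point into a difference on an interval, so equality holds everywhere.\<close>

lemma cdf_L2_zero_imp_eq:
  assumes m: "mass_on R t \<mu>" and k: "mass_on R t \<kappa>" and R: "0 < R"
    and z: "(\<integral>z. (cdf \<mu> z - cdf \<kappa> z)\<^sup>2 \<partial>lborel) \<le> 0"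
  shows "\<mu> = \<kappa>"
proof -
  interpret m: finite_borel_measure \<mu> by (rule mass_on_finite_borel[OF m])
  interpret k: finite_borel_measure \<kappa> by (rule mass_on_finite_borel[OF k])
  let ?d = "\<lambda>z. cdf \<mu> z - cdf \<kappa> z"
  have i: "integrable lborel (\<lambda>z. (?d z)\<^sup>2)" by (rule cdist_cdf_L2[OF m k R])
  have "(\<integral>z. (?d z)\<^sup>2 \<partial>lborel) = 0"
    using z by (intro antisym Bochner_Integration.integral_nonneg) auto
  hence "AE z in lborel. (?d z)\<^sup>2 = 0"
    using integral_nonneg_eq_0_iff_AE[OF i] by simp
  hence ae: "AE z in lborel. ?d z = 0" by simp
  have "?d a = 0" for a
  proof (rule ccontr)
    assume a: "?d a \<noteq> 0"
    have "(?d \<longlongrightarrow> ?d a) (at_right a)"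
      using m.cdf_is_right_cont[of a] k.cdf_is_right_cont[of a] unfolding continuous_within by (intro tendsto_diff)
    hence "\<forall>\<^sub>F x in at_right a. ?d x \<noteq> 0" by (rule tendsto_imp_eventually_ne[OF _ a])
    then obtain b where b: "b > a" "\<And>x. a < x \<Longrightarrow> x < b \<Longrightarrow> ?d x \<noteq> 0"
      by (auto simp: eventually_at_right_field)
    have "AE x in lborel. x \<notin> {a<..<b}"
      using ae
    proof eventually_elim
      case (elim x)
      thus ?case using b(2)[of x] by auto
    qed
    hence "{a<..<b} \<in> null_sets lborel" by (subst AE_iff_null_sets) auto
    thus False using b by (auto simp: null_sets_def)
  qed
  hence "cdf \<mu> = cdf \<kappa>" by auto
  thus ?thesis by (rule cdf_unique'[OF m.finite_borel_measure_axioms k.finite_borel_measure_axioms])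
qed

lemma continuous_bounded_Icc:
  fixes h :: "real \<Rightarrow> real"
  assumes "continuous_on UNIV h"
  obtains B where "0 \<le> B" "\<And>x. x \<in> {a..b} \<Longrightarrow> \<bar>h x\<bar> \<le> B"
proof -
  have "compact (h ` {a..b})" using assms by (intro compact_continuous_image) (auto intro: continuous_on_subset)
  hence "bounded (h ` {a..b})" by (rule compact_imp_bounded)
  then obtain B where "\<forall>y\<in>h ` {a..b}. \<bar>y\<bar> \<le> B" by (auto simp: bounded_iff)
  thus thesis by (intro that[of "max 0 B"]) (auto simp: le_max_iff_disj)
qed

text \<open>Integration by parts: \<open>p x\<close> is \<open>p R\<close> minus the integral of
  \<open>p'\<close> from \<open>x\<close> to \<open>R\<close>, and Fubini turns the inner integral
  over \<mu> into \<open>cdf\<close>.\<close>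

lemma integral_by_cdf:
  assumes m: "mass_on R t \<mu>" and R: "0 < R"
    and d: "\<And>x. (p has_real_derivative p' x) (at x)" and c: "continuous_on UNIV p'"
  shows "integrable lborel (\<lambda>z. indicator {0..R} z * p' z * cdf \<mu> z)"
    and "(\<integral>x. p x \<partial>\<mu>) = p R * t - (\<integral>z. indicator {0..R} z * p' z * cdf \<mu> z \<partial>lborel)"
proof -
  interpret m: finite_borel_measure \<mu> by (rule mass_on_finite_borel[OF m])
  note s[measurable_cong] = mass_on_sets[OF m]
  have [measurable]: "p' \<in> borel_measurable borel" using c by (intro borel_measurable_continuous_onI)
  have [measurable]: "cdf \<mu> \<in> borel_measurable borel" by (rule measurable_cdf[OF mass_on_finite[OF m] s])
  obtain B where B0: "0 \<le> B" and B: "\<And>z. z \<in> {0..R} \<Longrightarrow> \<bar>p' z\<bar> \<le> B"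
    using continuous_bounded_Icc[OF c] by blast
  have t0: "0 \<le> t" using m by (simp add: mass_on_def)
  let ?f = "\<lambda>x z. indicator {0..R} z * p' z * (if x \<le> z then 1 else 0 :: real)"
  interpret pair_sigma_finite \<mu> lborel by unfold_locales
  have intp: "integrable (\<mu> \<Otimes>\<^sub>M lborel) (case_prod ?f)"
  proof (rule integrableI_bounded)
    show "case_prod ?f \<in> borel_measurable (\<mu> \<Otimes>\<^sub>M lborel)" by measurable
    have "(\<integral>\<^sup>+ z. ennreal (norm (case_prod ?f z)) \<partial>(\<mu> \<Otimes>\<^sub>M lborel))
       = (\<integral>\<^sup>+ x. (\<integral>\<^sup>+ z. ennreal (norm (?f x z)) \<partial>lborel) \<partial>\<mu>)"
      by (subst lborel.nn_integral_fst[symmetric]) (auto simp: split_beta')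
    also have "\<dots> \<le> (\<integral>\<^sup>+ x. (\<integral>\<^sup>+ z. ennreal B * indicator {0..R} z \<partial>lborel) \<partial>\<mu>)"
      by (intro nn_integral_mono) (auto simp: indicator_def B ennreal_leI)
    also have "\<dots> = ennreal (B * R * t)"
      using m R B0 t0 mass_on_space[OF m] by (simp add: nn_integral_cmult mass_on_def ennreal_mult)
    also have "\<dots> < \<infinity>" by simp
    finally show "(\<integral>\<^sup>+ z. ennreal (norm (case_prod ?f z)) \<partial>(\<mu> \<Otimes>\<^sub>M lborel)) < \<infinity>" .
  qed
  have in_mu: "(\<integral>x. ?f x z \<partial>\<mu>) = indicator {0..R} z * p' z * cdf \<mu> z" for z
  proof -
    have "(\<integral>x. ?f x z \<partial>\<mu>) = (\<integral>x. indicator {0..R} z * p' z * indicator {..z} x \<partial>\<mu>)"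
      by (intro Bochner_Integration.integral_cong) (auto simp: indicator_def)
    thus ?thesis by (simp add: cdf_def s)
  qed
  have in_z: "(\<integral>z. ?f x z \<partial>lborel) = p R - p x" if "x \<in> {0..R}" for x
  proof -
    have "(\<integral>z. ?f x z \<partial>lborel) = (\<integral>z. p' z * indicator {x..R} z \<partial>lborel)"
      using that by (intro Bochner_Integration.integral_cong) (auto simp: indicator_def)
    also have "\<dots> = p R - p x"
      using that c by (intro integral_FTC_Icc_real d) (auto simp: continuous_on_eq_continuous_at)
    finally show ?thesis .
  qed
  have "integrable lborel (\<lambda>z. \<integral>x. ?f x z \<partial>\<mu>)" using integrable_snd[OF intp] by simp
  thus "integrable lborel (\<lambda>z. indicator {0..R} z * p' z * cdf \<mu> z)" unfolding in_mu .
  have pc: "continuous_on UNIV p" using d by (meson DERIV_isCont continuous_at_imp_continuous_on)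
  obtain C where C: "\<And>z. z \<in> {0..R} \<Longrightarrow> \<bar>p z\<bar> \<le> C"
    using continuous_bounded_Icc[OF pc] by blast
  have ip: "integrable \<mu> p"
    by (rule mass_on_integrable_bounded[OF m _ C]) (use pc in \<open>auto intro: borel_measurable_continuous_onI\<close>)
  have "(\<integral>z. indicator {0..R} z * p' z * cdf \<mu> z \<partial>lborel) = (\<integral>x. (\<integral>z. ?f x z \<partial>lborel) \<partial>\<mu>)"
    unfolding in_mu[symmetric] by (rule Fubini_integral[OF intp])
  also have "\<dots> = (\<integral>x. p R - p x \<partial>\<mu>)"
  proof (rule integral_cong_AE)
    show "AE x in \<mu>. (\<integral>z. ?f x z \<partial>lborel) = p R - p x"
      using mass_on_AE[OF m] by eventually_elim (rule in_z)
    show "(\<lambda>x. p R - p x) \<in> borel_measurable \<mu>" using ip by measurable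
  qed measurable
  also have "\<dots> = p R * t - (\<integral>x. p x \<partial>\<mu>)"
    using ip mass_on_measure[OF m] mass_on_space[OF m] by simp
  finally show "(\<integral>x. p x \<partial>\<mu>) = p R * t - (\<integral>z. indicator {0..R} z * p' z * cdf \<mu> z \<partial>lborel)"
    by simp
qed

text \<open>On \<open>{0..R}\<close> the test function is replaced by a polynomial at the cost of a
  small multiple of the mass, and for a polynomial integration by parts leaves its derivative
  against the difference of the distribution functions. Both families may vary, which admits
  comparison measures that depend on \<open>v\<close>.\<close>

lemma integral_diff_tendsto_of_cdf_L2:
  fixes N K :: "'i \<Rightarrow> real measure"
  assumes R: "0 < R" and t: "0 \<le> t"
    and m: "\<forall>\<^sub>F v in F. mass_on R t (N v)" and k: "\<forall>\<^sub>F v in F. mass_on R t (K v)"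
    and lim: "((\<lambda>v. \<integral>z. (cdf (N v) z - cdf (K v) z)\<^sup>2 \<partial>lborel) \<longlongrightarrow> 0) F"
    and f: "continuous_on UNIV (f :: real \<Rightarrow> real)"
  shows "((\<lambda>v. (\<integral>x. f x \<partial>N v) - (\<integral>x. f x \<partial>K v)) \<longlongrightarrow> 0) F"
proof (rule tendstoI)
  fix e :: real assume e: "0 < e"
  define \<eta> where "\<eta> = e / (4 * (t + 1))"
  have \<eta>: "0 < \<eta>" using e t by (simp add: \<eta>_def)
  obtain g where g: "real_polynomial_function g" "\<And>x. x \<in> {0..R} \<Longrightarrow> \<bar>f x - g x\<bar> < \<eta>"
    by (rule Stone_Weierstrass_real_polynomial_function[of "{0..R}" f \<eta>])
       (use f \<eta> in \<open>auto intro: continuous_on_subset\<close>)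
  obtain g' where g': "real_polynomial_function g'" "\<And>x. (g has_real_derivative g' x) (at x)"
    using has_real_derivative_polynomial_function[OF g(1)] by blast
  have cg: "continuous_on UNIV g" "continuous_on UNIV g'"
    using g(1) g'(1) by (auto intro: continuous_on_polymonial_function simp: real_polynomial_function_eq)
  obtain B where B0: "0 \<le> B" and B: "\<And>z. z \<in> {0..R} \<Longrightarrow> \<bar>g' z\<bar> \<le> B"
    using continuous_bounded_Icc[OF cg(2)] by blast
  define \<theta> where "\<theta> = e / (8 * (B + 1) * R)"
  have \<theta>: "0 < \<theta>" using e B0 R by (simp add: \<theta>_def)
  have bound: "\<bar>(\<integral>x. f x \<partial>M) - (\<integral>x. g x \<partial>M)\<bar> \<le> \<eta> * t" if M: "mass_on R t M" for M
  proof -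
    interpret finite_measure M by (rule mass_on_finite[OF M])
    have i: "integrable M h" if h: "continuous_on UNIV h" for h :: "real \<Rightarrow> real"
    proof -
      obtain C where "\<And>z. z \<in> {0..R} \<Longrightarrow> \<bar>h z\<bar> \<le> C" using continuous_bounded_Icc[OF h] by blast
      thus ?thesis using mass_on_integrable_bounded[OF M borel_measurable_continuous_onI[OF h]] by blast
    qed
    have "\<bar>(\<integral>x. f x \<partial>M) - (\<integral>x. g x \<partial>M)\<bar> = \<bar>\<integral>x. f x - g x \<partial>M\<bar>"
      using i[OF f] i[OF cg(1)] by simp
    also have "\<dots> \<le> (\<integral>x. \<bar>f x - g x\<bar> \<partial>M)" by (rule integral_abs_bound)
    also have "\<dots> \<le> (\<integral>x. \<eta> \<partial>M)"
    proof (rule integral_mono_AE)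
      show "AE x in M. \<bar>f x - g x\<bar> \<le> \<eta>"
        using mass_on_AE[OF M] by eventually_elim (use g(2) in force)
      show "integrable M (\<lambda>x. \<bar>f x - g x\<bar>)" using i[OF f] i[OF cg(1)] by auto
    qed simp
    also have "\<dots> = \<eta> * t" using mass_on_measure[OF M] mass_on_space[OF M] by simp
    finally show ?thesis .
  qed
  have "\<forall>\<^sub>F v in F. (\<integral>z. (cdf (N v) z - cdf (K v) z)\<^sup>2 \<partial>lborel) < \<theta> * (e / (8 * (B + 1)))"
    using order_tendstoD(2)[OF lim, of "\<theta> * (e / (8 * (B + 1)))"] \<theta> e B0 by simp
  thus "\<forall>\<^sub>F v in F. dist ((\<integral>x. f x \<partial>N v) - (\<integral>x. f x \<partial>K v)) 0 < e"
    using m k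
  proof eventually_elim
    case (elim v)
    let ?d = "\<lambda>z. cdf (N v) z - cdf (K v) z"
    note iN = integral_by_cdf[OF elim(2) R g'(2) cg(2)] and iK = integral_by_cdf[OF elim(3) R g'(2) cg(2)]
    have i2: "integrable lborel (\<lambda>z. (?d z)\<^sup>2)" by (rule cdist_cdf_L2[OF elim(2,3) R])
    have "\<bar>(\<integral>x. g x \<partial>N v) - (\<integral>x. g x \<partial>K v)\<bar>
      = \<bar>\<integral>z. indicator {0..R} z * g' z * cdf (N v) z - indicator {0..R} z * g' z * cdf (K v) z \<partial>lborel\<bar>"
      unfolding iN(2) iK(2) using iN(1) iK(1) by simp
    also have "\<dots> \<le> (\<integral>z. \<bar>indicator {0..R} z * g' z * cdf (N v) z - indicator {0..R} z * g' z * cdf (K v) z\<bar> \<partial>lborel)"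
      by (rule integral_abs_bound)
    also have "\<dots> \<le> (\<integral>z. B * (indicator {0..R} z * \<theta> + (1 / \<theta>) * (?d z)\<^sup>2) \<partial>lborel)"
    proof (rule integral_mono)
      show "integrable lborel (\<lambda>z. \<bar>indicator {0..R} z * g' z * cdf (N v) z - indicator {0..R} z * g' z * cdf (K v) z\<bar>)"
        using iN(1) iK(1) by simp
      show "integrable lborel (\<lambda>z. B * (indicator {0..R} z * \<theta> + (1 / \<theta>) * (?d z)\<^sup>2))"
        using i2 R by simp
      fix z :: real
      \<comment> \<open>Splitting at the threshold \<open>\<theta>\<close> takes the place of the
        Cauchy-Schwarz inequality on the bounded interval.\<close>
      have a: "\<bar>?d z\<bar> \<le> \<theta> + (1 / \<theta>) * (?d z)\<^sup>2"
      proof (cases "\<bar>?d z\<bar> \<le> \<theta>")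
        case False
        hence "\<theta> * \<bar>?d z\<bar> \<le> \<bar>?d z\<bar> * \<bar>?d z\<bar>" by (intro mult_right_mono) auto
        hence "\<bar>?d z\<bar> \<le> (1 / \<theta>) * (?d z)\<^sup>2" using \<theta> by (simp add: field_simps power2_eq_square)
        thus ?thesis using \<theta> by linarith
      qed (use \<theta> in \<open>auto intro: add_increasing2\<close>)
      show "\<bar>indicator {0..R} z * g' z * cdf (N v) z - indicator {0..R} z * g' z * cdf (K v) z\<bar>
        \<le> B * (indicator {0..R} z * \<theta> + (1 / \<theta>) * (?d z)\<^sup>2)"
      proof (cases "z \<in> {0..R}")
        case True
        have "\<bar>g' z * cdf (N v) z - g' z * cdf (K v) z\<bar> = \<bar>g' z\<bar> * \<bar>?d z\<bar>"
          by (simp add: abs_mult right_diff_distrib[symmetric])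
        also have "\<dots> \<le> B * (\<theta> + (1 / \<theta>) * (?d z)\<^sup>2)"
          using B[OF True] a B0 by (intro mult_mono) auto
        finally show ?thesis using True by simp
      qed (use B0 \<theta> in simp)
    qed
    also have "\<dots> = B * (R * \<theta> + (1 / \<theta>) * (\<integral>z. (?d z)\<^sup>2 \<partial>lborel))"
      using i2 R by simp
    also have "\<dots> \<le> B * (e / (8 * (B + 1)) + e / (8 * (B + 1)))"
    proof (intro mult_left_mono add_mono B0)
      show "R * \<theta> \<le> e / (8 * (B + 1))" using R by (simp add: \<theta>_def)
      show "(1 / \<theta>) * (\<integral>z. (?d z)\<^sup>2 \<partial>lborel) \<le> e / (8 * (B + 1))"
        using elim(1) \<theta> by (simp add: pos_divide_le_eq mult.commute)
    qed
    also have "\<dots> \<le> (B + 1) * (e / (8 * (B + 1)) + e / (8 * (B + 1)))"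
      using B0 e by (intro mult_right_mono) auto
    also have "\<dots> = e / 4"
      using B0 by (simp add: divide_simps)
    finally have "\<bar>(\<integral>x. g x \<partial>N v) - (\<integral>x. g x \<partial>K v)\<bar> \<le> e / 4" .
    moreover have "\<eta> * t \<le> e / 4" using e t by (simp add: \<eta>_def field_simps)
    ultimately show ?case
      using bound[OF elim(2)] bound[OF elim(3)] e unfolding dist_real_def by linarith
  qed
qed

section \<open>Supports and equilibrium constants\<close>

lemma ennreal_le_iff_ereal: "ennreal y \<le> p \<longleftrightarrow> ereal y \<le> enn2ereal p"
  by (cases p) (auto simp: ennreal_le_iff2)

text \<open>For a fixed length \<open>l\<close>, the pairs of \<open>y\<close> and left end whose
  window contains both \<open>y\<close> and \<open>s\<close> have area \<open>l * l\<close>, which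
  the weight cancels; the admissible lengths have total measure \<open>R\<close>.\<close>

lemma nn_integral_logk:
  assumes "0 < R"
  shows "(\<integral>\<^sup>+y. logk R y s \<partial>lborel) = ennreal R"
proof -
  have "(\<integral>\<^sup>+y. logk R y s \<partial>lborel)
    = (\<integral>\<^sup>+p. (\<integral>\<^sup>+y. ennreal (1 / (fst p)\<^sup>2) * (window R p y * window R p s) \<partial>lborel) \<partial>(lborel \<Otimes>\<^sub>M lborel))"
    unfolding logk_def by (rule nn_integral_swap[OF sigma_finite_ll sigma_finite_lborel]) measurable
  also have "\<dots> = (\<integral>\<^sup>+l. (\<integral>\<^sup>+z. (\<integral>\<^sup>+y. ennreal (1 / l\<^sup>2) * (window R (l, z) y * window R (l, z) s) \<partial>lborel) \<partial>lborel) \<partial>lborel)"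
    by (subst lborel.nn_integral_fst[symmetric]) (simp_all add: split_beta')
  also have "\<dots> = (\<integral>\<^sup>+l. indicator {0<..<R} l \<partial>lborel)"
  proof (intro nn_integral_cong)
    fix l :: real
    show "(\<integral>\<^sup>+z. (\<integral>\<^sup>+y. ennreal (1 / l\<^sup>2) * (window R (l, z) y * window R (l, z) s) \<partial>lborel) \<partial>lborel) = indicator {0<..<R} l"
    proof (cases "0 < l \<and> l < R")
      case True
      have "(\<integral>\<^sup>+z. (\<integral>\<^sup>+y. ennreal (1 / l\<^sup>2) * (window R (l, z) y * window R (l, z) s) \<partial>lborel) \<partial>lborel)
        = (\<integral>\<^sup>+z. (\<integral>\<^sup>+y. ennreal (1 / l\<^sup>2) * (indicator {z..z+l} y * indicator {s-l..s} z) \<partial>lborel) \<partial>lborel)"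
        using True by (intro nn_integral_cong) (auto simp: window_def indicator_def)
      also have "\<dots> = ennreal (1 / l\<^sup>2) * (ennreal l * ennreal l)"
        using True by (simp add: nn_integral_cmult nn_integral_multc mult.assoc)
      also have "\<dots> = 1" using True by (simp add: ennreal_mult[symmetric] power2_eq_square)
      finally show ?thesis using True by simp
    qed (auto simp: window_def)
  qed
  also have "\<dots> = ennreal R" using assms by simp
  finally show ?thesis .
qed

text \<open>With cutoff radius 1 only distances up to 1 matter: beyond them \<open>- ln\<close> is
  negative and is lost in \<open>e2ennreal\<close>, and below them it exceeds \<open>logk\<close> by
  at most 1. The summand \<open>t\<close> integrates this 1. The bound holds on the whole line,
  before any bound on the support is known.\<close>

lemma log_potential_le_pot:
  assumes s: "sets \<nu> = sets borel" and tot: "emeasure \<nu> UNIV = ennreal t" and t: "0 \<le> t"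
  shows "log_potential \<nu> y \<le> enn2ereal (pot 1 \<nu> y + ennreal t)"
proof -
  note s[measurable_cong]
  have sp: "space \<nu> = UNIV" using sets_eq_imp_space_eq[OF s] by simp
  have "log_potential \<nu> y \<le> enn2ereal (\<integral>\<^sup>+ s. e2ennreal (log_kernel y s) \<partial>\<nu>)"
    unfolding log_potential_def
    by (cases "enn2ereal (\<integral>\<^sup>+ s. e2ennreal (- log_kernel y s) \<partial>\<nu>)")
       (use enn2ereal_nonneg[of "\<integral>\<^sup>+ s. e2ennreal (- log_kernel y s) \<partial>\<nu>"] in \<open>auto intro: ereal_diff_le_self\<close>)
  also have "\<dots> \<le> enn2ereal (\<integral>\<^sup>+ s. logk 1 y s + 1 \<partial>\<nu>)"
    unfolding less_eq_ennreal.rep_eq[symmetric]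
  proof (rule nn_integral_mono)
    fix s
    show "e2ennreal (log_kernel y s) \<le> logk 1 y s + 1"
    proof (cases "s = y \<or> \<bar>y - s\<bar> > 1")
      case True
      thus ?thesis by (auto simp: log_kernel_def logk_diag ennreal_neg)
    next
      case False
      hence l: "logk 1 y s = ennreal (\<bar>y - s\<bar> - 1 - ln \<bar>y - s\<bar>)" using logk_off_diag[of y s 1] by simp
      have "0 \<le> \<bar>y - s\<bar> - 1 - ln \<bar>y - s\<bar>" using False ln_le_minus_one[of "\<bar>y - s\<bar>"] by simp
      hence "logk 1 y s + 1 = ennreal (\<bar>y - s\<bar> - 1 - ln \<bar>y - s\<bar> + 1)"
        unfolding l by (subst ennreal_plus) auto
      thus ?thesis using False by (auto simp: log_kernel_def intro!: ennreal_leI)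
    qed
  qed
  also have "(\<integral>\<^sup>+ s. logk 1 y s + 1 \<partial>\<nu>) = pot 1 \<nu> y + ennreal t"
    unfolding pot_def using tot sp by (subst nn_integral_add) auto
  finally show ?thesis .
qed

text \<open>Averaging the lower bound for the potential over \<^term>\<open>{1..2::real}\<close> bounds the equilibrium
  constant; the potential at the largest point of the support is at least \<open>- t ln x\<close>.\<close>
lemma equilibrium_support_bound:
  assumes e: "equilibrium_measure {0..} \<phi> t \<nu>" and t: "0 < t"
    and B: "\<And>x. x \<in> {1..2} \<Longrightarrow> \<phi> x \<le> B"
    and R: "1 \<le> R" "\<And>x. R < x \<Longrightarrow> B + 2 * t < \<phi> x - t * ln x"
  shows "measure_support \<nu> \<subseteq> {..R}"
proof -
  have s: "sets \<nu> = sets borel" and S: "measure_support \<nu> \<subseteq> {0..}" "compact (measure_support \<nu>)"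
    using e by (auto simp: equilibrium_measure_def)
  note s[measurable_cong]
  have tot: "emeasure \<nu> UNIV = ennreal t"
    using e emeasure_UNIV_of_support(1)[OF s S(1)] by (auto simp: equilibrium_measure_def)
  have sp: "space \<nu> = UNIV" using sets_eq_imp_space_eq[OF s] by simp
  interpret finite_measure \<nu> by (rule finite_measureI) (simp add: sp tot)
  obtain c where c: "\<And>x. x \<in> measure_support \<nu> \<Longrightarrow> log_potential \<nu> x = ereal (c - \<phi> x)"
    "\<And>x. x \<in> {0..} \<Longrightarrow> ereal (c - \<phi> x) \<le> log_potential \<nu> x"
    using equilibrium_potential[OF e] by blast
  \<comment> \<open>One \<open>t\<close> comes from passing to \<open>pot 1\<close>, the other from
    the integral of \<open>pot 1 \<nu>\<close> over the line, which is \<open>t\<close> by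
    \<open>nn_integral_logk\<close>; the interval of averaging has length 1.\<close>
  have cB: "c \<le> B + 2 * t"
  proof (rule ccontr)
    assume n: "\<not> ?thesis"
    have ge: "ennreal (c - B - t) \<le> pot 1 \<nu> y" if y: "y \<in> {1..2}" for y
    proof -
      have "ereal (c - B) \<le> ereal (c - \<phi> y)" using B[OF y] by simp
      also have "\<dots> \<le> log_potential \<nu> y" using y by (intro c(2)) auto
      also have "\<dots> \<le> enn2ereal (pot 1 \<nu> y + ennreal t)" using t by (intro log_potential_le_pot s tot) auto
      finally have "ennreal (c - B) \<le> pot 1 \<nu> y + ennreal t"
        by (simp add: ennreal_le_iff_ereal)
      thus ?thesis using t n
        by (cases "pot 1 \<nu> y") (auto simp: ennreal_plus[symmetric] simp del: ennreal_plus)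
    qed
    have "ennreal (c - B - t) = (\<integral>\<^sup>+y. ennreal (c - B - t) * indicator {1..2::real} y \<partial>lborel)"
      by (simp add: nn_integral_cmult)
    also have "\<dots> \<le> (\<integral>\<^sup>+y. pot 1 \<nu> y \<partial>lborel)"
      using ge by (intro nn_integral_mono) (auto simp: indicator_def)
    also have "\<dots> = (\<integral>\<^sup>+s. (\<integral>\<^sup>+y. logk 1 y s \<partial>lborel) \<partial>\<nu>)"
      unfolding pot_def
      by (rule nn_integral_swap) (unfold_locales, measurable)
    also have "\<dots> = ennreal t" by (simp add: nn_integral_logk sp tot)
    finally show False using n t by (simp add: ennreal_le_iff)
  qed
  show ?thesis
  proof (rule ccontr)
    assume n: "\<not> ?thesis"
    define x where "x = Sup (measure_support \<nu>)"
    have ne: "measure_support \<nu> \<noteq> {}" using n by auto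
    have bdd: "bdd_above (measure_support \<nu>)" using S(2) by (simp add: compact_imp_bounded bounded_imp_bdd_above)
    have x: "x \<in> measure_support \<nu>"
      unfolding x_def by (rule closed_contains_Sup[OF ne bdd closed_measure_support])
    have le: "measure_support \<nu> \<subseteq> {..x}" using bdd by (auto simp: x_def intro: cSup_upper)
    have xR: "R < x" using n le by (force simp: not_le)
    have "ereal (- t * ln x) \<le> log_potential \<nu> x"
      using xR R t by (intro log_potential_lower_bound equilibrium_mass_on[OF e _ le]) auto
    also have "\<dots> = ereal (c - \<phi> x)" by (rule c(1)[OF x])
    finally have "\<phi> x - t * ln x \<le> c" by simp
    thus False using R(2)[OF xR] cB by simp
  qed
qed

section \<open>Linear combinations of two measures\<close>

abbreviation combo :: "real \<Rightarrow> real measure \<Rightarrow> real \<Rightarrow> real measure \<Rightarrow> real measure" where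
  "combo a \<omega> b \<rho> \<equiv> measure_plus (scale_measure (ennreal a) \<omega>) (scale_measure (ennreal b) \<rho>)"

lemma measure_plus_simps:
  assumes "sets \<mu> = sets \<nu>"
  shows "sets (measure_plus \<mu> \<nu>) = sets \<mu>" "space (measure_plus \<mu> \<nu>) = space \<mu>"
    "A \<in> sets \<mu> \<Longrightarrow> emeasure (measure_plus \<mu> \<nu>) A = emeasure \<mu> A + emeasure \<nu> A"
proof -
  show 1: "sets (measure_plus \<mu> \<nu>) = sets \<mu>" and 2: "space (measure_plus \<mu> \<nu>) = space \<mu>"
    unfolding measure_plus_def by (simp_all add: sets.space_closed)
  assume A: "A \<in> sets \<mu>"
  show "emeasure (measure_plus \<mu> \<nu>) A = emeasure \<mu> A + emeasure \<nu> A"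
  proof (rule emeasure_measure_of[OF measure_plus_def])
    show "countably_additive (sets (measure_plus \<mu> \<nu>)) (\<lambda>A. emeasure \<mu> A + emeasure \<nu> A)"
      unfolding countably_additive_def 1
    proof safe
      fix F :: "nat \<Rightarrow> real set" assume F: "range F \<subseteq> sets \<mu>" "disjoint_family F" "\<Union> (range F) \<in> sets \<mu>"
      have "(\<Sum>i. emeasure \<mu> (F i) + emeasure \<nu> (F i)) = (\<Sum>i. emeasure \<mu> (F i)) + (\<Sum>i. emeasure \<nu> (F i))"
        by (rule suminf_add[symmetric]) auto
      thus "(\<Sum>i. emeasure \<mu> (F i) + emeasure \<nu> (F i)) = emeasure \<mu> (\<Union> (range F)) + emeasure \<nu> (\<Union> (range F))"
        using F assms by (simp add: suminf_emeasure)
    qed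
  qed (use A 1 in \<open>auto simp: positive_def sets.space_closed dest: sets.sets_into_space\<close>)
qed

lemma nn_integral_measure_plus:
  assumes s: "sets \<mu> = sets \<nu>" and f: "f \<in> borel_measurable \<mu>"
  shows "(\<integral>\<^sup>+x. f x \<partial>(measure_plus \<mu> \<nu>)) = (\<integral>\<^sup>+x. f x \<partial>\<mu>) + (\<integral>\<^sup>+x. f x \<partial>\<nu>)"
proof -
  have mm: "g \<in> borel_measurable (measure_plus \<mu> \<nu>)" "g \<in> borel_measurable \<nu>"
    if "g \<in> borel_measurable \<mu>" for g :: "real \<Rightarrow> ennreal"
    using that measurable_cong_sets[OF measure_plus_simps(1)[OF s] refl] measurable_cong_sets[OF s refl] by auto
  show ?thesis
  using f
proof (induct rule: borel_measurable_induct)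
  case (cong f g)
  have "space \<mu> = space \<nu>" by (rule sets_eq_imp_space_eq[OF s])
  thus ?case using cong nn_integral_cong[of _ f g] measure_plus_simps(2)[OF s] by metis
next
  case (set A)
  thus ?case using measure_plus_simps[OF s] s by simp
next
  case (mult u c)
  show ?case using mult mm[OF mult(2)] by (simp add: nn_integral_cmult distrib_left)
next
  case (add u v)
  show ?case using add mm[OF add(1)] mm[OF add(4)] by (simp add: nn_integral_add add_ac)
next
  case (seq U)
  have m: "U i \<in> borel_measurable (measure_plus \<mu> \<nu>)" "U i \<in> borel_measurable \<nu>" for i
    using mm[OF seq(1)] by auto
  have inc: "incseq (\<lambda>i. integral\<^sup>N \<mu> (U i))" "incseq (\<lambda>i. integral\<^sup>N \<nu> (U i))"
    using seq(4) by (auto simp: incseq_def le_fun_def intro!: nn_integral_mono)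
  have "(\<integral>\<^sup>+x. (SUP i. U i x) \<partial>measure_plus \<mu> \<nu>) = (SUP i. integral\<^sup>N \<mu> (U i) + integral\<^sup>N \<nu> (U i))"
    using seq m by (subst nn_integral_monotone_convergence_SUP) auto
  also have "\<dots> = (SUP i. integral\<^sup>N \<mu> (U i)) + (SUP i. integral\<^sup>N \<nu> (U i))"
    by (rule ennreal_SUP_add[OF inc])
  also have "\<dots> = (\<integral>\<^sup>+x. (SUP i. U i x) \<partial>\<mu>) + (\<integral>\<^sup>+x. (SUP i. U i x) \<partial>\<nu>)"
    using seq m by (simp add: nn_integral_monotone_convergence_SUP)
  finally show ?case by (simp add: image_comp SUP_apply)
qed
qed

lemma nn_integral_combo:
  assumes "sets \<omega> = sets borel" "sets \<rho> = sets borel" "f \<in> borel_measurable borel"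
  shows "(\<integral>\<^sup>+x. f x \<partial>combo a \<omega> b \<rho>) = ennreal a * (\<integral>\<^sup>+x. f x \<partial>\<omega>) + ennreal b * (\<integral>\<^sup>+x. f x \<partial>\<rho>)"
  using borel_measurable_sets_borel[OF assms(3,1)] borel_measurable_sets_borel[OF assms(3,2)] assms(1,2)
  by (subst nn_integral_measure_plus) (auto simp: nn_integral_scale_measure)

lemma integral_combo:
  assumes s: "sets \<omega> = sets borel" "sets \<rho> = sets borel" and m: "f \<in> borel_measurable borel"
    and f: "integrable \<omega> f" "integrable \<rho> f" and ab: "0 \<le> a" "0 \<le> b"
  shows "integrable (combo a \<omega> b \<rho>) f"
    "(\<integral>x. f x \<partial>combo a \<omega> b \<rho>) = a * (\<integral>x. f x \<partial>\<omega>) + b * (\<integral>x. f x \<partial>\<rho>)"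
proof -
  have [measurable]: "f \<in> borel_measurable borel" by fact
  have fin: "(\<integral>\<^sup>+x. ennreal (f x) \<partial>\<omega>) < top" "(\<integral>\<^sup>+x. ennreal (- f x) \<partial>\<omega>) < top"
    "(\<integral>\<^sup>+x. ennreal (f x) \<partial>\<rho>) < top" "(\<integral>\<^sup>+x. ennreal (- f x) \<partial>\<rho>) < top"
    using f by (auto simp: real_integrable_def less_top)
  have c: "(\<integral>\<^sup>+x. ennreal (f x) \<partial>combo a \<omega> b \<rho>) = ennreal a * (\<integral>\<^sup>+x. ennreal (f x) \<partial>\<omega>) + ennreal b * (\<integral>\<^sup>+x. ennreal (f x) \<partial>\<rho>)"
    "(\<integral>\<^sup>+x. ennreal (- f x) \<partial>combo a \<omega> b \<rho>) = ennreal a * (\<integral>\<^sup>+x. ennreal (- f x) \<partial>\<omega>) + ennreal b * (\<integral>\<^sup>+x. ennreal (- f x) \<partial>\<rho>)"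
    by (intro nn_integral_combo s; measurable)+
  have mm: "f \<in> borel_measurable (combo a \<omega> b \<rho>)"
    by (rule borel_measurable_sets_borel[OF m]) (simp add: measure_plus_simps s)
  show i: "integrable (combo a \<omega> b \<rho>) f"
    unfolding real_integrable_def using mm fin c by (simp add: ennreal_mult_eq_top_iff less_top)
  have e: "enn2real (ennreal a * x + ennreal b * y) = a * enn2real x + b * enn2real y"
    if "x < top" "y < top" for x y
    using that ab by (cases x; cases y) (auto simp: ennreal_mult[symmetric] ennreal_plus[symmetric] simp del: ennreal_plus)
  show "(\<integral>x. f x \<partial>combo a \<omega> b \<rho>) = a * (\<integral>x. f x \<partial>\<omega>) + b * (\<integral>x. f x \<partial>\<rho>)"
    unfolding real_lebesgue_integral_def[OF i] real_lebesgue_integral_def[OF f(1)] real_lebesgue_integral_def[OF f(2)] c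
    using fin by (simp add: e algebra_simps)
qed

lemma mass_on_combo:
  assumes m: "mass_on R p \<omega>" "mass_on R q \<rho>" and ab: "0 \<le> a" "0 \<le> b"
  shows "mass_on R (a * p + b * q) (combo a \<omega> b \<rho>)"
proof -
  have e: "emeasure (combo a \<omega> b \<rho>) A = ennreal a * emeasure \<omega> A + ennreal b * emeasure \<rho> A" if "A \<in> sets borel" for A
    using m that by (subst measure_plus_simps) (auto simp: mass_on_def)
  show ?thesis
    unfolding mass_on_def using m ab
    by (auto simp: e measure_plus_simps mass_on_def ennreal_mult ennreal_plus)
qed

lemma log_potential_combo_ge:
  assumes m: "mass_on R p \<omega>" "mass_on R q \<rho>" and ab: "0 \<le> a" "0 \<le> b" and R: "0 < R" and x: "x \<in> {0..R}"
    and y: "ereal y \<le> log_potential \<omega> x" "ereal z \<le> log_potential \<rho> x"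
  shows "ereal (a * y + b * z) \<le> log_potential (combo a \<omega> b \<rho>) x"
proof -
  note k = mass_on_combo[OF m ab]
  let ?m = "\<lambda>\<mu>. (\<integral>s. \<bar>x - s\<bar> \<partial>\<mu>)"
  have i: "?m (combo a \<omega> b \<rho>) = a * ?m \<omega> + b * ?m \<rho>"
    using abs_moment_bound(2)[OF m(1) x] abs_moment_bound(2)[OF m(2) x]
    by (intro integral_combo ab mass_on_sets[OF m(1)] mass_on_sets[OF m(2)]) auto
  have p: "pot R (combo a \<omega> b \<rho>) x = ennreal a * pot R \<omega> x + ennreal b * pot R \<rho> x"
    unfolding pot_def by (intro nn_integral_combo mass_on_sets[OF m(1)] mass_on_sets[OF m(2)]) auto
  have g: "ennreal (u + (?m \<mu> / R - r * (1 - ln R))) \<le> pot R \<mu> x"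
    if "mass_on R r \<mu>" "ereal u \<le> log_potential \<mu> x" for \<mu> r u
  proof -
    have "ereal (u + (?m \<mu> / R - r * (1 - ln R))) \<le> enn2ereal (pot R \<mu> x)"
      unfolding pot_eq_log_potential[OF that(1) R x] plus_ereal.simps(1)[symmetric]
      by (rule add_right_mono[OF that(2)])
    thus ?thesis by (simp only: ennreal_le_iff_ereal)
  qed
  let ?y = "y + (?m \<omega> / R - p * (1 - ln R))" and ?z = "z + (?m \<rho> / R - q * (1 - ln R))"
  have "ennreal (a * ?y + b * ?z) \<le> ennreal (a * max 0 ?y + b * max 0 ?z)"
    using ab by (intro ennreal_leI add_mono mult_left_mono) auto
  also have "\<dots> = ennreal a * ennreal ?y + ennreal b * ennreal ?z"
    using ab by (simp add: ennreal_plus ennreal_mult)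
  also have "\<dots> \<le> pot R (combo a \<omega> b \<rho>) x"
    unfolding p using g[OF m(1) y(1)] g[OF m(2) y(2)] by (intro add_mono mult_left_mono) auto
  finally have "ereal (a * ?y + b * ?z) \<le> enn2ereal (pot R (combo a \<omega> b \<rho>) x)"
    by (simp only: ennreal_le_iff_ereal)
  also have "\<dots> = log_potential (combo a \<omega> b \<rho>) x + ereal (?m (combo a \<omega> b \<rho>) / R - (a * p + b * q) * (1 - ln R))"
    by (rule pot_eq_log_potential[OF k R x])
  finally show ?thesis
    unfolding i by (cases "log_potential (combo a \<omega> b \<rho>) x") (auto simp: algebra_simps add_divide_distrib)
qed

lemma energy_combo:
  assumes m: "mass_on R p \<omega>" "mass_on R q \<rho>" and mu: "mass_on R r \<mu>"
  shows "energy R \<mu> (combo a \<omega> b \<rho>) = ennreal a * energy R \<mu> \<omega> + ennreal b * energy R \<mu> \<rho>"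
  unfolding energy_def
  by (intro nn_integral_combo mass_on_sets[OF m(1)] mass_on_sets[OF m(2)] measurable_pot mass_on_finite[OF mu] mass_on_sets[OF mu])

text \<open>Linearity is inherited from \<open>energy_combo\<close>; the finiteness assumptions let
  \<open>enn2real\<close> commute with the sum.\<close>

lemma menergy_combo:
  assumes m: "mass_on R p \<omega>" "mass_on R q \<rho>" and mu: "mass_on R r \<mu>" and ab: "0 \<le> a" "0 \<le> b"
    and fin: "energy R \<mu> \<omega> < \<infinity>" "energy R \<mu> \<rho> < \<infinity>"
  shows "menergy R \<mu> (combo a \<omega> b \<rho>) = a * menergy R \<mu> \<omega> + b * menergy R \<mu> \<rho>"
proof -
  have e: "enn2real (ennreal a * x + ennreal b * y) = a * enn2real x + b * enn2real y"
    if "x < \<infinity>" "y < \<infinity>" for x y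
    using that ab by (cases x; cases y) (auto simp: ennreal_mult[symmetric] ennreal_plus[symmetric] simp del: ennreal_plus)
  have c: "cdist \<mu> (combo a \<omega> b \<rho>) = a * cdist \<mu> \<omega> + b * cdist \<mu> \<rho>"
    unfolding cdist_def
    by (intro integral_combo ab mass_on_sets[OF m(1)] mass_on_sets[OF m(2)] abs_moment_integrable[OF mu m(1)]
        abs_moment_integrable[OF mu m(2)] measurable_abs_moment[OF mu])
  show ?thesis
    unfolding menergy_def energy_combo[OF m mu] c e[OF fin] mass_on_measure[OF m(1)] mass_on_measure[OF m(2)]
      mass_on_measure[OF mass_on_combo[OF m ab]]
    by (simp add: algebra_simps add_divide_distrib)
qed

section \<open>Potentials of measures on an arc\<close>

text \<open>Fourier form of a density on the circle: a constant, two harmonics matched to a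
  quadratic field, and \<open>G\<close> times the Poisson kernel at \<open>q\<close>, which produces
  the potential of a point charge off the arc.\<close>

definition arc_density :: "real \<Rightarrow> real \<Rightarrow> real \<Rightarrow> real \<Rightarrow> real \<Rightarrow> real \<Rightarrow> real" where
  "arc_density A C1 C2 G q \<theta> =
     A + 2 * C1 * cos \<theta> + 2 * C2 * cos (2 * \<theta>) + G * (1 - q\<^sup>2) / (1 - 2 * q * cos \<theta> + q\<^sup>2)"

lemma poisson_denom_pos: "\<bar>q\<bar> < 1 \<Longrightarrow> 0 < 1 - 2 * q * cos \<theta> + (q\<^sup>2 :: real)"
proof -
  assume q: "\<bar>q\<bar> < 1"
  have "\<bar>q * cos \<theta>\<bar> \<le> \<bar>q\<bar> * 1" unfolding abs_mult by (intro mult_left_mono) auto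
  hence "(1 - \<bar>q\<bar>)\<^sup>2 \<le> 1 - 2 * q * cos \<theta> + q\<^sup>2" by (simp add: power2_eq_square algebra_simps)
  moreover have "0 < (1 - \<bar>q\<bar>)\<^sup>2" using q by simp
  ultimately show ?thesis by linarith
qed

lemma continuous_arc_density [continuous_intros]:
  "\<bar>q\<bar> < 1 \<Longrightarrow> continuous_on S (arc_density A C1 C2 G q)"
  unfolding arc_density_def[abs_def] using poisson_denom_pos[of q]
  by (intro continuous_intros) (auto simp: less_le)

text \<open>On the unit circle the Poisson kernel splits into a Cauchy kernel with pole at
  \<open>q\<close> and a term without poles in the closed disc, so that every summand can be
  integrated by Cauchy's formula.\<close>

lemma arc_density_contour:
  assumes q: "\<bar>q\<bar> < 1"
  shows "complex_of_real (arc_density A C1 C2 G q \<theta>) =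
    (let z = cis \<theta> in A + C1 * (z + 1 / z) + C2 * (z ^ 2 + 1 / z ^ 2) + G * (z / (z - q) + q * z / (1 - q * z)))"
proof -
  let ?z = "cis \<theta>"
  have inv: "1 / ?z = cis (- \<theta>)" by (simp add: divide_inverse)
  have inv2: "1 / ?z ^ 2 = cis (- (2 * \<theta>))" by (simp add: divide_inverse Complex.DeMoivre)
  have c1: "?z + 1 / ?z = of_real (2 * cos \<theta>)"
    unfolding inv by (simp add: complex_eq_iff)
  have c2: "?z ^ 2 + 1 / ?z ^ 2 = of_real (2 * cos (2 * \<theta>))"
    using inv2 by (simp add: Complex.DeMoivre complex_eq_iff)
  have n: "cmod (q * ?z) < 1" using q by (simp add: norm_mult)
  have d2: "1 - q * ?z \<noteq> 0" using n by (metis norm_one order_less_irrefl right_minus_eq)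
  have d1: "?z - q \<noteq> 0"
  proof
    assume "?z - q = 0"
    hence "cmod ?z = \<bar>q\<bar>" by (simp add: norm_of_real[symmetric, where 'a=complex] del: norm_of_real)
    thus False using q by simp
  qed
  have z: "?z \<noteq> 0" by simp
  have den: "(?z - q) * (1 - q * ?z) = ?z * of_real (1 - 2 * q * cos \<theta> + q\<^sup>2)"
  proof -
    have "(?z - q) * (1 - q * ?z) = ?z * (1 - q * (?z + 1 / ?z) + q\<^sup>2)"
      using z by (simp add: field_simps power2_eq_square)
    thus ?thesis unfolding c1 by simp
  qed
  have "?z / (?z - q) + q * ?z / (1 - q * ?z) = ?z * of_real (1 - q\<^sup>2) / ((?z - q) * (1 - q * ?z))"
    using d1 d2 by (simp add: field_simps power2_eq_square)
  also have "\<dots> = of_real ((1 - q\<^sup>2) / (1 - 2 * q * cos \<theta> + q\<^sup>2))"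
    unfolding den using z by simp
  finally have c3: "?z / (?z - q) + q * ?z / (1 - q * ?z) = of_real ((1 - q\<^sup>2) / (1 - 2 * q * cos \<theta> + q\<^sup>2))" .
  show ?thesis
    unfolding Let_def c1 c2 c3 arc_density_def by simp
qed

text \<open>Each term of the density picks out one datum of \<open>f\<close>: its value at 0 or
  \<open>q\<close>, or a Taylor coefficient at 0. The terms without poles integrate to 0.\<close>

lemma arc_mean_value:
  fixes f :: "complex \<Rightarrow> complex"
  assumes f: "f holomorphic_on S" and S: "open S" "cball 0 1 \<subseteq> S" and q: "\<bar>q\<bar> < 1"
  shows "((\<lambda>\<theta>. f (cis \<theta>) * of_real (arc_density A C1 C2 G q \<theta>)) has_integral
     2 * pi * (A * f 0 + C1 * deriv f 0 + C2 * (deriv ^^ 2) f 0 / 2 + G * f (of_real q))) {0..2*pi}"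
proof -
  have fc: "f holomorphic_on cball 0 1" by (rule holomorphic_on_subset[OF f S(2)])
  have fh: "f holomorphic_on ball 0 1" "continuous_on (cball 0 1) f"
    by (rule holomorphic_on_subset[OF fc ball_subset_cball], rule holomorphic_on_imp_continuous_on[OF fc])
  have qb: "complex_of_real q \<in> ball 0 1" using q by simp
  note C = Cauchy_has_contour_integral_higher_derivative_circlepath[OF fh(2,1)]
  have h0: "((\<lambda>u. f u / (u - 0) ^ Suc 0) has_contour_integral (2 * pi * \<i>) / fact 0 * (deriv ^^ 0) f 0) (circlepath 0 1)"
    by (rule C) simp
  have h1: "((\<lambda>u. f u / (u - 0) ^ Suc 1) has_contour_integral (2 * pi * \<i>) / fact 1 * (deriv ^^ 1) f 0) (circlepath 0 1)"
    by (rule C) simp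
  have h2: "((\<lambda>u. f u / (u - 0) ^ Suc 2) has_contour_integral (2 * pi * \<i>) / fact 2 * (deriv ^^ 2) f 0) (circlepath 0 1)"
    by (rule C) simp
  have hq: "((\<lambda>u. f u / (u - of_real q) ^ Suc 0) has_contour_integral (2 * pi * \<i>) / fact 0 * (deriv ^^ 0) f (of_real q)) (circlepath 0 1)"
    by (rule C[OF qb])
  have z: "(g has_contour_integral 0) (circlepath 0 1)" if "g holomorphic_on cball 0 1" for g
    by (rule Cauchy_theorem_convex_simple[OF that]) (auto simp: path_image_circlepath)
  have d2: "1 - of_real q * u \<noteq> 0" if "u \<in> cball 0 1" for u :: complex
  proof
    assume "1 - of_real q * u = 0"
    hence "of_real q * u = 1" by simp
    hence "\<bar>q\<bar> * cmod u = 1" by (metis norm_mult norm_of_real norm_one)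
    moreover have "\<bar>q\<bar> * cmod u \<le> \<bar>q\<bar> * 1" using that by (intro mult_left_mono) auto
    ultimately show False using q by simp
  qed
  have z1: "(f has_contour_integral 0) (circlepath 0 1)" by (rule z[OF fc])
  have z2: "((\<lambda>u. f u * u) has_contour_integral 0) (circlepath 0 1)"
    by (intro z holomorphic_intros fc)
  have z3: "((\<lambda>u. f u * (of_real q / (1 - of_real q * u))) has_contour_integral 0) (circlepath 0 1)"
    by (intro z holomorphic_intros fc) (use d2 in auto)
  \<comment> \<open>\<open>?F u\<close> is \<open>f u\<close> times the density divided by
    \<open>u\<close>, since the contour element is \<open>\<i> * u\<close> times the element of the
    angle.\<close>
  let ?F = "\<lambda>u. of_real A * (f u / (u - 0) ^ Suc 0) + of_real C1 * (f u + f u / (u - 0) ^ Suc 1)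
      + of_real C2 * (f u * u + f u / (u - 0) ^ Suc 2)
      + of_real G * (f u / (u - of_real q) ^ Suc 0 + f u * (of_real q / (1 - of_real q * u)))"
  let ?I = "of_real A * ((2 * pi * \<i>) / fact 0 * (deriv ^^ 0) f 0) + of_real C1 * (0 + (2 * pi * \<i>) / fact 1 * (deriv ^^ 1) f 0)
      + of_real C2 * (0 + (2 * pi * \<i>) / fact 2 * (deriv ^^ 2) f 0)
      + of_real G * ((2 * pi * \<i>) / fact 0 * (deriv ^^ 0) f (of_real q) + 0)"
  have "(?F has_contour_integral ?I) (circlepath 0 1)"
    by (intro has_contour_integral_add has_contour_integral_lmul h0 h1 h2 hq z1 z2 z3)
  hence "((\<lambda>t. ?F (0 + of_real 1 * cis t) * of_real 1 * \<i> * cis t) has_integral ?I) {0..2*pi}"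
    unfolding circlepath_def by (subst (asm) has_contour_integral_part_circlepath_iff) auto
  hence "((\<lambda>t. ?F (cis t) * \<i> * cis t) has_integral ?I) {0..2*pi}" by simp
  hence "((\<lambda>t. (- \<i>) * (?F (cis t) * \<i> * cis t)) has_integral (- \<i>) * ?I) {0..2*pi}"
    by (rule has_integral_mult_right)
  moreover have "(- \<i>) * ?I = 2 * pi * (A * f 0 + C1 * deriv f 0 + C2 * (deriv ^^ 2) f 0 / 2 + G * f (of_real q))"
    by (simp add: algebra_simps fact_2)
  moreover have "(- \<i>) * (?F (cis t) * \<i> * cis t) = f (cis t) * of_real (arc_density A C1 C2 G q t)" for t
    unfolding arc_density_contour[OF q] Let_def
    by (simp add: algebra_simps divide_simps power2_eq_square power3_eq_cube numeral_3_eq_3)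
  ultimately show ?thesis by simp
qed

lemma arc_density_integral:
  assumes q: "\<bar>q\<bar> < 1"
  shows "((arc_density A C1 C2 G q) has_integral 2 * pi * (A + G)) {0..2*pi}"
proof -
  from has_integral_Re[OF arc_mean_value[OF holomorphic_on_const[of 1] open_UNIV subset_UNIV q, of A C1 C2 G]]
  show ?thesis by (simp add: numeral_2_eq_2)
qed

lemma one_minus_mult_in_slit_plane:
  assumes "cmod (w * z) < 1" shows "1 - w * z \<notin> \<real>\<^sub>\<le>\<^sub>0"
proof -
  have "\<bar>Re (w * z)\<bar> < 1" using abs_Re_le_cmod[of "w * z"] assms by linarith
  hence "0 < Re (1 - w * z)" by simp
  thus ?thesis by (auto simp: complex_nonpos_Reals_iff)
qed

text \<open>\<open>Ln (1 - w * z)\<close> is holomorphic beyond the closed disc, vanishes at 0 and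
  has there the first derivative \<open>- w\<close> and the second derivative
  \<open>- (w ^ 2)\<close>; the claim is the real part of the mean value formula.\<close>

lemma log_arc_mean_inside:
  assumes w: "cmod w < 1" and q: "\<bar>q\<bar> < 1"
  shows "((\<lambda>\<theta>. ln (cmod (1 - w * cis \<theta>)) * arc_density A C1 C2 G q \<theta>) has_integral
    2 * pi * (- C1 * Re w - C2 * Re (w ^ 2) / 2 + G * ln (cmod (1 - w * q)))) {0..2*pi}"
proof -
  define S where "S = {z. cmod (w * z) < 1}"
  have S: "open S" unfolding S_def by (intro open_Collect_less continuous_intros)
  have sub: "cball 0 1 \<subseteq> S"
  proof
    fix z :: complex assume "z \<in> cball 0 1"
    hence "cmod w * cmod z \<le> cmod w * 1" by (intro mult_left_mono) auto
    thus "z \<in> S" using w by (simp add: S_def norm_mult)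
  qed
  let ?f = "\<lambda>z. Ln (1 - w * z)"
  have nz: "1 - w * z \<noteq> 0" if "z \<in> S" for z
    using one_minus_mult_in_slit_plane[of w z] that by (auto simp: S_def)
  have d: "(?f has_field_derivative (- w / (1 - w * z))) (at z)" if "z \<in> S" for z
    using one_minus_mult_in_slit_plane[of w z] that nz[OF that]
    by (auto intro!: derivative_eq_intros simp: S_def divide_inverse mult.commute)
  have hol: "?f holomorphic_on S" using d S by (auto simp: holomorphic_on_open)
  have 0: "0 \<in> S" using sub by auto
  have d1: "deriv ?f z = - w / (1 - w * z)" if "z \<in> S" for z by (rule DERIV_imp_deriv[OF d[OF that]])
  have "\<forall>\<^sub>F z in nhds 0. z \<in> S" using S 0 by (simp add: eventually_nhds_in_open)
  hence "\<forall>\<^sub>F z in nhds 0. deriv ?f z = - w / (1 - w * z)" by eventually_elim (rule d1)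
  hence "deriv (deriv ?f) 0 = deriv (\<lambda>z. - w / (1 - w * z)) 0" by (intro deriv_cong_ev) auto
  also have "\<dots> = - (w ^ 2)"
    by (rule DERIV_imp_deriv) (auto intro!: derivative_eq_intros simp: power2_eq_square)
  finally have d2: "(deriv ^^ 2) ?f 0 = - (w ^ 2)" by (simp add: numeral_2_eq_2)
  have qS: "of_real q \<in> S" using sub q by auto
  have "((\<lambda>\<theta>. Re (?f (cis \<theta>) * of_real (arc_density A C1 C2 G q \<theta>))) has_integral
     Re (2 * pi * (A * ?f 0 + C1 * deriv ?f 0 + C2 * (deriv ^^ 2) ?f 0 / 2 + G * ?f (of_real q)))) {0..2*pi}"
    by (intro has_integral_Re arc_mean_value[OF hol S sub q])
  moreover have "Re (2 * pi * (A * ?f 0 + C1 * deriv ?f 0 + C2 * (deriv ^^ 2) ?f 0 / 2 + G * ?f (of_real q)))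
    = 2 * pi * (- C1 * Re w - C2 * Re (w ^ 2) / 2 + G * ln (cmod (1 - w * q)))"
    unfolding d1[OF 0] d2 using nz[OF qS] by (simp add: Re_divide_numeral)
  moreover have "Re (?f (cis \<theta>) * of_real (arc_density A C1 C2 G q \<theta>)) = ln (cmod (1 - w * cis \<theta>)) * arc_density A C1 C2 G q \<theta>" for \<theta>
    using nz[OF subsetD[OF sub], of "cis \<theta>"] by simp
  ultimately show ?thesis by (simp only:)
qed

lemma countable_cis_eq: "countable {\<theta>. cis \<theta> = u}"
proof (cases "\<exists>a. cis a = u")
  case True
  then obtain a where a: "cis a = u" by blast
  have "{\<theta>. cis \<theta> = u} \<subseteq> range (\<lambda>n::int. a + n * 2 * pi)"
  proof
    fix \<theta> assume "\<theta> \<in> {\<theta>. cis \<theta> = u}"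
    hence "cis (\<theta> - a) = 1" using a cis_neq_zero[of a] by (simp add: cis_divide[symmetric])
    hence "cos (\<theta> - a) = 1" by (simp add: complex_eq_iff)
    then obtain n :: int where "\<theta> - a = real_of_int n * 2 * pi" unfolding cos_one_2pi_int by blast
    thus "\<theta> \<in> range (\<lambda>n::int. a + n * 2 * pi)" by (auto intro!: image_eqI[of _ _ n])
  qed
  thus ?thesis by (rule countable_subset) auto
qed auto

lemma AE_cis_neq: "AE \<theta> in lborel. w * cis \<theta> \<noteq> 1"
proof -
  have "{\<theta>. w * cis \<theta> = 1} \<subseteq> {\<theta>. cis \<theta> = 1 / w}" by (auto simp: eq_divide_eq mult.commute)
  hence "countable {\<theta>. w * cis \<theta> = 1}" by (rule countable_subset[OF _ countable_cis_eq])
  hence "{\<theta>. w * cis \<theta> = 1} \<in> null_sets lborel" by (rule countable_imp_null_set_lborel)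
  thus ?thesis by (rule AE_I'[of _ _ "\<lambda>\<theta>. w * cis \<theta> \<noteq> 1"]) auto
qed

lemma has_integral_imp_lborel:
  fixes f :: "real \<Rightarrow> real"
  assumes "continuous_on {a..b} f" "(f has_integral I) {a..b}"
  shows "integrable lborel (\<lambda>x. indicator {a..b} x * f x)" "(\<integral>x. indicator {a..b} x * f x \<partial>lborel) = I"
proof -
  have i: "set_integrable lborel {a..b} f" by (rule borel_integrable_atLeastAtMost'[OF assms(1)])
  thus "integrable lborel (\<lambda>x. indicator {a..b} x * f x)" by (simp add: set_integrable_def)
  show "(\<integral>x. indicator {a..b} x * f x \<partial>lborel) = I"
    using set_borel_integral_eq_integral(2)[OF i] assms(2)
    by (simp add: set_lebesgue_integral_def integral_unique)
qed

text \<open>Along a radius the distance to 1 cannot fall below half its final value, because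
  \<open>1 - r\<close> bounds it from below as well. Hence the logarithms have a lower bound uniform
  in the radius.\<close>

lemma radial_bound:
  fixes r :: real and z :: complex
  assumes "cmod z \<le> 1" "0 \<le> r" "r \<le> 1"
  shows "cmod (1 - z) \<le> 2 * cmod (1 - r * z)" "cmod (1 - r * z) \<le> 2"
proof -
  have rz: "cmod (r * z) \<le> 1" using assms by (simp add: norm_mult mult_le_one)
  show "cmod (1 - r * z) \<le> 2" using norm_triangle_ineq4[of 1 "r * z"] rz by simp
  have "cmod (r * z) \<le> r" using assms by (simp add: norm_mult mult_left_le)
  hence 1: "1 - r \<le> cmod (1 - r * z)" using norm_triangle_ineq2[of 1 "r * z"] by simp
  have "cmod (1 - z) = cmod ((1 - r * z) - (1 - r) * z)" by (simp add: algebra_simps)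
  also have "\<dots> \<le> cmod (1 - r * z) + cmod ((1 - r) * z)" by (rule norm_triangle_ineq4)
  also have "cmod ((1 - r) * z) = (1 - r) * cmod z"
    using assms(3) by (metis abs_of_nonneg diff_ge_0_iff_ge norm_mult norm_of_real of_real_1 of_real_diff)
  also have "\<dots> \<le> (1 - r) * 1" using assms by (intro mult_left_mono) auto
  finally show "cmod (1 - z) \<le> 2 * cmod (1 - r * z)" using 1 by simp
qed

text \<open>The case \<open>cmod w = 1\<close>, in which the logarithm is unbounded on the circle,
  is reached by the radii \<open>\<rho> n\<close> and dominated convergence. The dominating function
  involves the limit logarithm itself, whose integrability follows from Fatou's lemma because the
  logarithms inside the disc have mean 0 against the constant density.\<close>

lemma log_arc_mean:
  assumes w: "cmod w \<le> 1" and q: "\<bar>q\<bar> < 1"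
  shows "integrable lborel (\<lambda>\<theta>. indicator {0..2*pi} \<theta> * (ln (cmod (1 - w * cis \<theta>)) * arc_density A C1 C2 G q \<theta>))" (is ?int)
    and "(\<integral>\<theta>. indicator {0..2*pi} \<theta> * (ln (cmod (1 - w * cis \<theta>)) * arc_density A C1 C2 G q \<theta>) \<partial>lborel)
      = 2 * pi * (- C1 * Re w - C2 * Re (w ^ 2) / 2 + G * ln (cmod (1 - w * q)))" (is ?eq)
proof -
  let ?I = "indicator {0..2*pi} :: real \<Rightarrow> real"
  define \<rho> where "\<rho> n = 1 - 1 / real (n + 2)" for n
  have \<rho>: "0 \<le> \<rho> n" "\<rho> n < 1" for n by (auto simp: \<rho>_def)
  have \<rho>_lim: "\<rho> \<longlonglongrightarrow> 1"
    using tendsto_diff[OF tendsto_const[of 1] LIMSEQ_ignore_initial_segment[OF lim_1_over_n[where 'a=real], of 2]]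
    by (simp add: \<rho>_def[abs_def])
  have wn: "cmod (\<rho> n * w) < 1" for n
  proof -
    have "cmod (\<rho> n * w) = \<rho> n * cmod w" using \<rho>(1)[of n] by (simp add: norm_mult)
    also have "\<dots> \<le> \<rho> n * 1" using w \<rho>(1)[of n] by (intro mult_left_mono) auto
    finally show ?thesis using \<rho>(2)[of n] by simp
  qed
  have wc: "cmod (w * cis \<theta>) \<le> 1" for \<theta> using w by (simp add: norm_mult)
  define L where "L n \<theta> = ln (cmod (1 - \<rho> n * w * cis \<theta>))" for n \<theta>
  define L0 where "L0 \<theta> = ln (cmod (1 - w * cis \<theta>))" for \<theta>
  have Lb: "L n \<theta> \<le> ln 2" "w * cis \<theta> \<noteq> 1 \<Longrightarrow> L0 \<theta> - ln 2 \<le> L n \<theta>" for n \<theta>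
  proof -
    have p: "0 < cmod (1 - \<rho> n * w * cis \<theta>)"
      using one_minus_mult_in_slit_plane[of "\<rho> n * w" "cis \<theta>"] wn[of n] by (auto simp: norm_mult)
    note b = radial_bound[OF wc[of \<theta>] \<rho>(1)[of n] less_imp_le[OF \<rho>(2)[of n]], folded mult.assoc]
    show "L n \<theta> \<le> ln 2" unfolding L_def using p b(2) by (subst ln_le_cancel_iff) auto
    assume "w * cis \<theta> \<noteq> 1"
    hence "0 < cmod (1 - w * cis \<theta>)" by auto
    hence "L0 \<theta> \<le> ln (2 * cmod (1 - \<rho> n * w * cis \<theta>))" unfolding L0_def using p b(1) by (subst ln_le_cancel_iff) auto
    also have "\<dots> = ln 2 + L n \<theta>" unfolding L_def using p by (subst ln_mult) auto
    finally show "L0 \<theta> - ln 2 \<le> L n \<theta>" by simp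
  qed
  have L0b: "L0 \<theta> \<le> ln 2" for \<theta>
  proof (cases "w * cis \<theta> = 1")
    case False
    thus ?thesis unfolding L0_def using radial_bound(2)[OF wc[of \<theta>], of 1] by (subst ln_le_cancel_iff) auto
  qed (simp add: L0_def)
  have lim: "(\<lambda>n. L n \<theta>) \<longlonglongrightarrow> L0 \<theta>" if "w * cis \<theta> \<noteq> 1" for \<theta>
  proof -
    have "(\<lambda>n. of_real (\<rho> n) * w * cis \<theta>) \<longlonglongrightarrow> of_real 1 * w * cis \<theta>"
      by (intro tendsto_intros \<rho>_lim)
    thus ?thesis unfolding L_def L0_def using that by (intro tendsto_intros) auto
  qed
  have Lc: "continuous_on S (L n)" for S n
  proof -
    have "1 - \<rho> n * w * cis \<theta> \<noteq> 0" for \<theta>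
      using one_minus_mult_in_slit_plane[of "\<rho> n * w" "cis \<theta>"] wn[of n] by (auto simp: norm_mult)
    thus ?thesis unfolding L_def[abs_def] by (intro continuous_intros) auto
  qed
  have cis_m [measurable]: "cis \<in> borel_measurable borel"
    by (intro borel_measurable_continuous_onI continuous_intros)
  have [measurable]: "L n \<in> borel_measurable borel" for n
    by (intro borel_measurable_continuous_onI Lc)
  have [measurable]: "L0 \<in> borel_measurable borel" unfolding L0_def[abs_def] by measurable
  have Lint: "integrable lborel (\<lambda>\<theta>. ?I \<theta> * (L n \<theta> * arc_density A C1 C2 G q \<theta>))"
    "(\<integral>\<theta>. ?I \<theta> * (L n \<theta> * arc_density A C1 C2 G q \<theta>) \<partial>lborel)
      = 2 * pi * (- C1 * Re (\<rho> n * w) - C2 * Re ((\<rho> n * w) ^ 2) / 2 + G * ln (cmod (1 - \<rho> n * w * q)))" for n A C1 C2 G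
  proof -
    have c: "continuous_on {0..2*pi} (\<lambda>\<theta>. L n \<theta> * arc_density A C1 C2 G q \<theta>)"
      by (intro continuous_on_mult Lc continuous_arc_density q)
    note h = has_integral_imp_lborel[OF c[unfolded L_def] log_arc_mean_inside[OF wn[of n] q, of A C1 C2 G]]
    show "integrable lborel (\<lambda>\<theta>. ?I \<theta> * (L n \<theta> * arc_density A C1 C2 G q \<theta>))"
      "(\<integral>\<theta>. ?I \<theta> * (L n \<theta> * arc_density A C1 C2 G q \<theta>) \<partial>lborel)
        = 2 * pi * (- C1 * Re (\<rho> n * w) - C2 * Re ((\<rho> n * w) ^ 2) / 2 + G * ln (cmod (1 - \<rho> n * w * q)))"
      unfolding L_def by (rule h)+
  qed
  have base: "integrable lborel (\<lambda>\<theta>. ?I \<theta> * (ln 2 - L0 \<theta>))"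
  proof (rule integrableI_nonneg)
    show "AE \<theta> in lborel. 0 \<le> ?I \<theta> * (ln 2 - L0 \<theta>)" using L0b by (intro AE_I2 mult_nonneg_nonneg) auto
    have "(\<integral>\<^sup>+\<theta>. ennreal (?I \<theta> * (ln 2 - L0 \<theta>)) \<partial>lborel) = (\<integral>\<^sup>+\<theta>. liminf (\<lambda>n. ennreal (?I \<theta> * (ln 2 - L n \<theta>))) \<partial>lborel)"
    proof (rule nn_integral_cong_AE)
      show "AE \<theta> in lborel. ennreal (?I \<theta> * (ln 2 - L0 \<theta>)) = liminf (\<lambda>n. ennreal (?I \<theta> * (ln 2 - L n \<theta>)))"
        using AE_cis_neq[of w]
      proof eventually_elim
        case (elim \<theta>)
        have "(\<lambda>n. ennreal (?I \<theta> * (ln 2 - L n \<theta>))) \<longlonglongrightarrow> ennreal (?I \<theta> * (ln 2 - L0 \<theta>))"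
          by (intro tendsto_ennrealI tendsto_intros lim elim)
        thus ?case by (intro lim_imp_Liminf[symmetric]) auto
      qed
    qed
    also have "\<dots> \<le> liminf (\<lambda>n. \<integral>\<^sup>+\<theta>. ennreal (?I \<theta> * (ln 2 - L n \<theta>)) \<partial>lborel)"
      by (rule nn_integral_liminf) measurable
    also have "(\<lambda>n. \<integral>\<^sup>+\<theta>. ennreal (?I \<theta> * (ln 2 - L n \<theta>)) \<partial>lborel) = (\<lambda>n. ennreal (2 * pi * ln 2))"
    proof
      fix n
      have one: "arc_density 1 0 0 0 q \<theta> = 1" for \<theta> by (simp add: arc_density_def)
      have i: "integrable lborel (\<lambda>\<theta>. ?I \<theta> * L n \<theta>)" "(\<integral>\<theta>. ?I \<theta> * L n \<theta> \<partial>lborel) = 0"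
        using Lint[of n 1 0 0 0] by (simp_all add: one)
      have i2: "integrable lborel (\<lambda>\<theta>. ?I \<theta> * ln 2)" "(\<integral>\<theta>. ?I \<theta> * ln 2 \<partial>lborel) = 2 * pi * ln 2" by simp_all
      have eq: "(\<lambda>\<theta>. ?I \<theta> * (ln 2 - L n \<theta>)) = (\<lambda>\<theta>. ?I \<theta> * ln 2 - ?I \<theta> * L n \<theta>)" by (simp add: right_diff_distrib)
      have "(\<integral>\<^sup>+\<theta>. ennreal (?I \<theta> * (ln 2 - L n \<theta>)) \<partial>lborel) = ennreal (\<integral>\<theta>. ?I \<theta> * (ln 2 - L n \<theta>) \<partial>lborel)"
      proof (rule nn_integral_eq_integral)
        show "integrable lborel (\<lambda>\<theta>. ?I \<theta> * (ln 2 - L n \<theta>))" unfolding eq by (intro Bochner_Integration.integrable_diff i i2)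
      qed (use Lb(1) in \<open>intro AE_I2 mult_nonneg_nonneg; simp\<close>)
      also have "(\<integral>\<theta>. ?I \<theta> * (ln 2 - L n \<theta>) \<partial>lborel) = 2 * pi * ln 2"
        unfolding eq Bochner_Integration.integral_diff[OF i2(1) i(1)] i(2) i2(2) by simp
      finally show "(\<integral>\<^sup>+\<theta>. ennreal (?I \<theta> * (ln 2 - L n \<theta>)) \<partial>lborel) = ennreal (2 * pi * ln 2)" .
    qed
    finally show "(\<integral>\<^sup>+\<theta>. ennreal (?I \<theta> * (ln 2 - L0 \<theta>)) \<partial>lborel) < \<infinity>"
      by (simp add: Liminf_const le_less_trans)
  qed measurable
  have hc: "continuous_on UNIV (arc_density A C1 C2 G q)" using q by (intro continuous_intros)
  hence [measurable]: "arc_density A C1 C2 G q \<in> borel_measurable borel" by (rule borel_measurable_continuous_onI)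
  obtain B where B: "0 \<le> B" "\<And>\<theta>. \<theta> \<in> {0..2*pi} \<Longrightarrow> \<bar>arc_density A C1 C2 G q \<theta>\<bar> \<le> B"
    using continuous_bounded_Icc[OF hc] by blast
  let ?W = "\<lambda>\<theta>. B * (?I \<theta> * (ln 2 - L0 \<theta>) + ?I \<theta> * (2 * ln 2))"
  have W: "integrable lborel ?W" using base by (intro integrable_mult_right Bochner_Integration.integrable_add) auto
  have dom: "AE \<theta> in lborel. norm (?I \<theta> * (L n \<theta> * arc_density A C1 C2 G q \<theta>)) \<le> ?W \<theta>" for n
    using AE_cis_neq[of w]
  proof eventually_elim
    case (elim \<theta>)
    show ?case
    proof (cases "\<theta> \<in> {0..2*pi}")
      case True
      have "\<bar>L n \<theta>\<bar> \<le> (ln 2 - L0 \<theta>) + 2 * ln 2" using Lb(1)[of n \<theta>] Lb(2)[OF elim, of n] L0b[of \<theta>] ln_ge_zero[of "2::real"]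
        unfolding abs_le_iff by linarith
      hence "\<bar>L n \<theta>\<bar> * \<bar>arc_density A C1 C2 G q \<theta>\<bar> \<le> ((ln 2 - L0 \<theta>) + 2 * ln 2) * B"
        using B True by (intro mult_mono) auto
      thus ?thesis using True by (simp add: abs_mult mult.commute)
    qed simp
  qed
  have lim': "AE \<theta> in lborel. (\<lambda>n. ?I \<theta> * (L n \<theta> * arc_density A C1 C2 G q \<theta>)) \<longlonglongrightarrow> ?I \<theta> * (L0 \<theta> * arc_density A C1 C2 G q \<theta>)"
    using AE_cis_neq[of w] by eventually_elim (intro tendsto_intros lim)
  have m1: "(\<lambda>\<theta>. ?I \<theta> * (L0 \<theta> * arc_density A C1 C2 G q \<theta>)) \<in> borel_measurable lborel"
    "\<And>n. (\<lambda>\<theta>. ?I \<theta> * (L n \<theta> * arc_density A C1 C2 G q \<theta>)) \<in> borel_measurable lborel" by measurable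
  note D = integrable_dominated_convergence[OF m1 W lim' dom] integral_dominated_convergence[OF m1 W lim' dom]
  show ?int using D(1) by (simp add: L0_def)
  have nq: "1 - w * q \<noteq> 0"
  proof -
    have "cmod (w * q) \<le> 1 * \<bar>q\<bar>" unfolding norm_mult norm_of_real using w by (intro mult_right_mono) auto
    thus ?thesis using q one_minus_mult_in_slit_plane[of w q] by auto
  qed
  have "(\<lambda>n. 2 * pi * (- C1 * Re (\<rho> n * w) - C2 * Re ((\<rho> n * w) ^ 2) / 2 + G * ln (cmod (1 - \<rho> n * w * q))))
    \<longlonglongrightarrow> 2 * pi * (- C1 * Re (of_real 1 * w) - C2 * Re ((of_real 1 * w) ^ 2) / 2 + G * ln (cmod (1 - of_real 1 * w * q)))"
    using nq by (intro tendsto_intros \<rho>_lim) auto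
  hence "(\<lambda>n. \<integral>\<theta>. ?I \<theta> * (L n \<theta> * arc_density A C1 C2 G q \<theta>) \<partial>lborel)
    \<longlonglongrightarrow> 2 * pi * (- C1 * Re w - C2 * Re (w ^ 2) / 2 + G * ln (cmod (1 - w * q)))"
    unfolding Lint(2) by simp
  from LIMSEQ_unique[OF D(2) this] show ?eq by (simp add: L0_def)
qed

section \<open>Push-forwards of circle densities to an interval\<close>

text \<open>The angle runs through the full circle, so the interval is covered twice. In the angle
  the square-root behaviour at the endpoints becomes smooth, and \<open>h\<close> can stay
  continuous.\<close>

definition arc_measure :: "real \<Rightarrow> real \<Rightarrow> (real \<Rightarrow> real) \<Rightarrow> real measure" where
  "arc_measure m r h =
     distr (density lborel (\<lambda>\<theta>. ennreal (indicator {0..2*pi} \<theta> * (h \<theta> / (2*pi))))) borel (\<lambda>\<theta>. m + r * cos \<theta>)"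

locale arc =
  fixes m r :: real and h :: "real \<Rightarrow> real"
  assumes h_cont: "continuous_on UNIV h" and h_nonneg: "\<And>\<theta>. \<theta> \<in> {0..2*pi} \<Longrightarrow> 0 \<le> h \<theta>"
begin

lemma h_measurable [measurable]: "h \<in> borel_measurable borel"
  by (rule borel_measurable_continuous_onI[OF h_cont])

lemma arc_map_measurable [measurable]: "(\<lambda>\<theta>. m + r * cos \<theta>) \<in> borel_measurable borel"
  by (intro borel_measurable_continuous_onI continuous_intros)

lemma sets_arc: "sets (arc_measure m r h) = sets borel" and space_arc: "space (arc_measure m r h) = UNIV"
  by (simp_all add: arc_measure_def)

lemma arc_weight_nonneg: "0 \<le> indicator {0..2*pi} \<theta> * (h \<theta> / (2*pi))"
  using h_nonneg[of \<theta>] by (auto simp: indicator_def)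

lemma arc_integrable_iff:
  fixes f :: "real \<Rightarrow> real"
  assumes [measurable]: "f \<in> borel_measurable borel"
  shows "integrable (arc_measure m r h) f \<longleftrightarrow>
    integrable lborel (\<lambda>\<theta>. indicator {0..2*pi} \<theta> * (h \<theta> / (2*pi)) * f (m + r * cos \<theta>))"
  unfolding arc_measure_def using arc_weight_nonneg
  by (subst integrable_distr_eq; (subst integrable_real_density)?) auto

lemma arc_integral:
  fixes f :: "real \<Rightarrow> real"
  assumes [measurable]: "f \<in> borel_measurable borel"
  shows "(\<integral>x. f x \<partial>arc_measure m r h) =
    (\<integral>\<theta>. indicator {0..2*pi} \<theta> * (h \<theta> / (2*pi)) * f (m + r * cos \<theta>) \<partial>lborel)"
  unfolding arc_measure_def using arc_weight_nonneg
  by (subst integral_distr; (subst integral_real_density)?) auto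

lemma arc_emeasure:
  assumes [measurable]: "B \<in> sets borel"
  shows "emeasure (arc_measure m r h) B =
    (\<integral>\<^sup>+\<theta>. ennreal (indicator {0..2*pi} \<theta> * (h \<theta> / (2*pi))) * indicator B (m + r * cos \<theta>) \<partial>lborel)"
proof -
  have "emeasure (arc_measure m r h) B = (\<integral>\<^sup>+x. indicator B x \<partial>arc_measure m r h)"
    by (simp add: sets_arc)
  also have "\<dots> = (\<integral>\<^sup>+\<theta>. ennreal (indicator {0..2*pi} \<theta> * (h \<theta> / (2*pi))) * indicator B (m + r * cos \<theta>) \<partial>lborel)"
    unfolding arc_measure_def by (subst nn_integral_distr; (subst nn_integral_density)?) auto
  finally show ?thesis .
qed

lemma arc_AE:
  assumes ae: "AE \<theta> in lborel. \<theta> \<in> {0..2*pi} \<longrightarrow> P (m + r * cos \<theta>)" and [measurable]: "Measurable.pred borel P"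
  shows "AE s in arc_measure m r h. P s"
proof -
  have "AE \<theta> in lborel. 0 < ennreal (indicator {0..2*pi} \<theta> * (h \<theta> / (2*pi))) \<longrightarrow> P (m + r * cos \<theta>)"
    using ae by eventually_elim (auto simp: indicator_def)
  thus ?thesis unfolding arc_measure_def by (subst AE_distr_iff; (subst AE_density)?) auto
qed

end

locale poisson_arc =
  fixes m r A C1 C2 G q :: real
  assumes q: "\<bar>q\<bar> < 1" and r: "0 < r"
    and nonneg: "\<And>\<theta>. \<theta> \<in> {0..2*pi} \<Longrightarrow> 0 \<le> arc_density A C1 C2 G q \<theta>"
begin

sublocale arc m r "arc_density A C1 C2 G q"
  by unfold_locales (use q nonneg in \<open>auto intro: continuous_arc_density\<close>)

abbreviation "\<mu> \<equiv> arc_measure m r (arc_density A C1 C2 G q)"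

lemma density_integral:
  "integrable lborel (\<lambda>\<theta>. indicator {0..2*pi} \<theta> * arc_density A C1 C2 G q \<theta>)"
  "(\<integral>\<theta>. indicator {0..2*pi} \<theta> * arc_density A C1 C2 G q \<theta> \<partial>lborel) = 2 * pi * (A + G)"
  by (rule has_integral_imp_lborel[OF continuous_arc_density[OF q] arc_density_integral[OF q]])+

lemma mass: "emeasure \<mu> UNIV = ennreal (A + G)" "0 \<le> A + G"
proof -
  have eq: "(\<lambda>\<theta>. indicator {0..2*pi} \<theta> * (arc_density A C1 C2 G q \<theta> / (2*pi)))
    = (\<lambda>\<theta>. (indicator {0..2*pi} \<theta> * arc_density A C1 C2 G q \<theta>) / (2*pi))" by auto
  have i: "integrable lborel (\<lambda>\<theta>. indicator {0..2*pi} \<theta> * (arc_density A C1 C2 G q \<theta> / (2*pi)))"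
    "(\<integral>\<theta>. indicator {0..2*pi} \<theta> * (arc_density A C1 C2 G q \<theta> / (2*pi)) \<partial>lborel) = A + G"
    unfolding eq using density_integral by simp_all
  have "emeasure \<mu> UNIV = (\<integral>\<^sup>+\<theta>. ennreal (indicator {0..2*pi} \<theta> * (arc_density A C1 C2 G q \<theta> / (2*pi))) \<partial>lborel)"
    by (subst arc_emeasure) auto
  also have "\<dots> = ennreal (A + G)"
    unfolding i(2)[symmetric] by (rule nn_integral_eq_integral[OF i(1)]) (use arc_weight_nonneg in auto)
  finally show "emeasure \<mu> UNIV = ennreal (A + G)" .
  show "0 \<le> A + G" unfolding i(2)[symmetric] using arc_weight_nonneg by (intro Bochner_Integration.integral_nonneg) auto
qed

lemma arc_bounds: "m + r * cos \<theta> \<in> {m - r..m + r}"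
proof -
  have "r * cos \<theta> \<le> r * 1" "r * (-1) \<le> r * cos \<theta>" using r by (intro mult_left_mono; simp)+
  thus ?thesis by simp
qed

lemma mass_on:
  assumes "0 \<le> m - r" "m + r \<le> R"
  shows "mass_on R (A + G) \<mu>"
proof -
  have "AE x in \<mu>. x \<in> {0..R}"
  proof (rule arc_AE)
    have "m + r * cos \<theta> \<in> {0..R}" for \<theta> using arc_bounds[of \<theta>] assms by auto
    thus "AE \<theta> in lborel. \<theta> \<in> {0..2*pi} \<longrightarrow> m + r * cos \<theta> \<in> {0..R}" by (intro AE_I2) blast
  qed measurable
  hence "emeasure \<mu> (- {0..R}) = 0"
    using sets_arc space_arc by (subst (asm) AE_iff_measurable[of "- {0..R}"]) auto
  thus ?thesis using mass sets_arc by (simp add: mass_on_def)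
qed

text \<open>With \<open>2 * cos \<theta> = z + 1 / z\<close>, \<open>z = cis \<theta>\<close>, the
  distance factors into \<open>r / (2 * cmod w)\<close> times two distances to 1, so its logarithm
  is a constant plus two terms whose means \<open>log_arc_mean\<close> evaluates, for
  \<open>w\<close> and its conjugate. Points of the interval have \<open>cmod w = 1\<close>, real
  points outside it have real \<open>w\<close>.\<close>

lemma potential:
  fixes w :: complex
  assumes w: "w \<noteq> 0" "cmod w \<le> 1" and x: "complex_of_real x = m + r / 2 * (w + 1 / w)"
  shows "log_potential \<mu> x = ereal (- (A + G) * (ln (r / 2) - ln (cmod w)) + 2 * C1 * Re w + C2 * Re (w ^ 2)
    - 2 * G * ln (cmod (1 - w * q)))"
proof -
  let ?I = "indicator {0..2*pi} :: real \<Rightarrow> real" and ?h = "arc_density A C1 C2 G q"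
  let ?L = "\<lambda>w \<theta>. ln (cmod (1 - w * cis \<theta>))"
  let ?c = "ln (r / 2) - ln (cmod w)"
  have cw: "cmod (cnj w) \<le> 1" using w by simp
  have fact: "\<bar>x - (m + r * cos \<theta>)\<bar> = r / 2 / cmod w * cmod (1 - w * cis \<theta>) * cmod (1 - cnj w * cis \<theta>)" for \<theta>
  proof -
    have inv: "cis (- \<theta>) = 1 / cis \<theta>" by (simp add: divide_inverse)
    have c: "2 * complex_of_real (cos \<theta>) = cis \<theta> + 1 / cis \<theta>" unfolding inv[symmetric] by (simp add: complex_eq_iff)
    have "complex_of_real (x - (m + r * cos \<theta>)) = r / 2 * ((w + 1 / w) - 2 * complex_of_real (cos \<theta>))"
      using x by (simp add: algebra_simps)
    also have "\<dots> = r / 2 * (1 / w) * (1 - w * cis \<theta>) * (1 - w / cis \<theta>)"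
      unfolding c using w by (simp add: field_simps)
    finally have "cmod (complex_of_real (x - (m + r * cos \<theta>))) = r / 2 / cmod w * cmod (1 - w * cis \<theta>) * cmod (1 - w / cis \<theta>)"
      using r by (simp add: norm_mult norm_divide)
    moreover have "cmod (1 - w / cis \<theta>) = cmod (1 - cnj w * cis \<theta>)"
    proof -
      have "1 - w / cis \<theta> = cnj (1 - cnj w * cis \<theta>)" by (simp add: cis_cnj[symmetric] divide_inverse del: cis_cnj)
      thus ?thesis by (metis complex_mod_cnj)
    qed
    ultimately show ?thesis by (simp del: of_real_diff of_real_add)
  qed
  have ae: "AE \<theta> in lborel. w * cis \<theta> \<noteq> 1 \<and> cnj w * cis \<theta> \<noteq> 1"
    using AE_cis_neq[of w] AE_cis_neq[of "cnj w"] by eventually_elim auto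
  have ln_eq: "ln \<bar>x - (m + r * cos \<theta>)\<bar> = ?c + ?L w \<theta> + ?L (cnj w) \<theta>"
    if "w * cis \<theta> \<noteq> 1 \<and> cnj w * cis \<theta> \<noteq> 1" for \<theta>
    unfolding fact using that r w by (simp add: ln_mult ln_div)
  have ne: "AE s in \<mu>. s \<noteq> x"
  proof (rule arc_AE)
    show "AE \<theta> in lborel. \<theta> \<in> {0..2*pi} \<longrightarrow> m + r * cos \<theta> \<noteq> x"
      using ae
    proof eventually_elim
      case (elim \<theta>)
      hence "0 < \<bar>x - (m + r * cos \<theta>)\<bar>" unfolding fact using r w by (intro mult_pos_pos divide_pos_pos) auto
      thus ?case by auto
    qed
  qed measurable
  have m1: "(\<lambda>s. ln \<bar>x - s\<bar>) \<in> borel_measurable borel" by measurable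
  note J = log_arc_mean[OF w(2) q, of A C1 C2 G] and J' = log_arc_mean[OF cw q, of A C1 C2 G]
  let ?F = "\<lambda>\<theta>. (1 / (2*pi)) * (?c * (?I \<theta> * ?h \<theta>) + ?I \<theta> * (?L w \<theta> * ?h \<theta>) + ?I \<theta> * (?L (cnj w) \<theta> * ?h \<theta>))"
  have F: "AE \<theta> in lborel. ?I \<theta> * (?h \<theta> / (2*pi)) * ln \<bar>x - (m + r * cos \<theta>)\<bar> = ?F \<theta>"
    using ae by eventually_elim (simp add: ln_eq algebra_simps add_divide_distrib diff_divide_distrib)
  have Fi: "integrable lborel ?F"
    by (intro integrable_mult_right Bochner_Integration.integrable_add J(1) J'(1) density_integral(1))
  have mF: "(\<lambda>\<theta>. ?I \<theta> * (?h \<theta> / (2*pi)) * ln \<bar>x - (m + r * cos \<theta>)\<bar>) \<in> borel_measurable lborel"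
    by measurable
  have int: "integrable \<mu> (\<lambda>s. ln \<bar>x - s\<bar>)"
    unfolding arc_integrable_iff[OF m1] using integrable_cong_AE[OF mF borel_measurable_integrable[OF Fi] F] Fi by simp
  have "(\<integral>s. ln \<bar>x - s\<bar> \<partial>\<mu>) = (\<integral>\<theta>. ?F \<theta> \<partial>lborel)"
    unfolding arc_integral[OF m1] by (rule integral_cong_AE[OF mF borel_measurable_integrable[OF Fi] F])
  also have "\<dots> = (1 / (2*pi)) * (?c * (2 * pi * (A + G))
     + 2 * pi * (- C1 * Re w - C2 * Re (w ^ 2) / 2 + G * ln (cmod (1 - w * q)))
     + 2 * pi * (- C1 * Re (cnj w) - C2 * Re (cnj w ^ 2) / 2 + G * ln (cmod (1 - cnj w * q))))"
    unfolding density_integral(2)[symmetric] J(2)[symmetric] J'(2)[symmetric]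
    using J(1) J'(1) density_integral(1)
    by (simp only: integral_mult_right_zero Bochner_Integration.integral_add Bochner_Integration.integrable_add integrable_mult_right)
  also have "\<dots> = ?c * (A + G) - 2 * C1 * Re w - C2 * Re (w ^ 2) + 2 * G * ln (cmod (1 - w * q))"
  proof -
    have "cmod (1 - cnj w * q) = cmod (cnj (1 - w * q))" by simp
    hence 1: "cmod (1 - cnj w * q) = cmod (1 - w * q)" by (simp only: complex_mod_cnj)
    have 2: "Re (cnj w ^ 2) = Re (w ^ 2)" by (metis complex_cnj_power cnj.simps(1))
    show ?thesis unfolding 1 2 by (simp add: field_simps)
  qed
  finally show ?thesis
    unfolding log_potential_eq_integral[OF sets_arc int ne] by (simp add: algebra_simps)
qed

lemma potential_on_arc:
  assumes x: "x \<in> {m - r..m + r}"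
  obtains \<phi> where "x = m + r * cos \<phi>"
    "log_potential \<mu> x = ereal (- (A + G) * ln (r / 2) + 2 * C1 * cos \<phi> + C2 * cos (2 * \<phi>)
      - G * ln (1 - 2 * q * cos \<phi> + q\<^sup>2))"
proof -
  define \<phi> where "\<phi> = arccos ((x - m) / r)"
  have "-1 \<le> (x - m) / r" "(x - m) / r \<le> 1" using x r by (auto simp: field_simps)
  hence "cos \<phi> = (x - m) / r" by (simp add: \<phi>_def cos_arccos)
  hence xe: "x = m + r * cos \<phi>" using r by simp
  have inv: "1 / cis \<phi> = cis (- \<phi>)" by (simp add: divide_inverse)
  have "complex_of_real x = m + r / 2 * (cis \<phi> + 1 / cis \<phi>)"
    unfolding inv xe by (simp add: complex_eq_iff)
  hence p: "log_potential \<mu> x = ereal (- (A + G) * (ln (r / 2) - ln (cmod (cis \<phi>))) + 2 * C1 * Re (cis \<phi>) + C2 * Re (cis \<phi> ^ 2)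
    - 2 * G * ln (cmod (1 - cis \<phi> * q)))" by (intro potential) auto
  have "(cmod (1 - cis \<phi> * q))\<^sup>2 = 1 - 2 * q * cos \<phi> + q\<^sup>2"
  proof -
    have "(1 - c * q)\<^sup>2 + (s * q)\<^sup>2 = 1 - 2 * q * c + q\<^sup>2" if "s\<^sup>2 + c\<^sup>2 = 1" for c s :: real
      using that by algebra
    from this[OF sin_cos_squared_add] show ?thesis unfolding cmod_power2 by simp
  qed
  hence "ln (1 - 2 * q * cos \<phi> + q\<^sup>2) = 2 * ln (cmod (1 - cis \<phi> * q))"
    using poisson_denom_pos[OF q, of \<phi>] by (metis ln_realpow of_nat_numeral zero_less_power2 norm_ge_zero less_eq_real_def power_zero_numeral)
  thus thesis using that[OF xe] p by (simp add: Complex.DeMoivre)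
qed

end

section \<open>Balayage of a point mass and the attractive case\<close>

text \<open>The smaller root of \<open>p\<^sup>2 - 2 * (1 + v / r) * p + 1 = 0\<close>.
  Equivalently, \<open>w = - p\<close> is the coordinate of the point \<open>- v\<close> with
  respect to the interval \<open>{0..2 * r}\<close>.\<close>

definition sweep_par :: "real \<Rightarrow> real \<Rightarrow> real" where
  "sweep_par r v = 1 + v / r - sqrt ((1 + v / r)\<^sup>2 - 1)"

lemma sweep_par:
  assumes "0 < r" "0 < v"
  shows "0 < sweep_par r v" "sweep_par r v < 1" "v = r / (2 * sweep_par r v) * (1 - sweep_par r v)\<^sup>2"
proof -
  define a where "a = 1 + v / r"
  have a: "1 < a" using assms by (simp add: a_def)
  have a2: "1 < a\<^sup>2" using a by (simp add: one_less_power)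
  define s where "s = sqrt (a\<^sup>2 - 1)"
  have s2: "s\<^sup>2 = a\<^sup>2 - 1" using a2 by (simp add: s_def)
  have s0: "0 < s" using a2 by (simp add: s_def)
  have "s\<^sup>2 < a\<^sup>2" by (simp add: s2)
  hence sa: "s < a" using a power_less_imp_less_base[of s 2 a] by simp
  have "(a - 1)\<^sup>2 < s\<^sup>2" using a unfolding s2 by (simp add: power2_eq_square algebra_simps)
  hence s1: "a - 1 < s" using s0 power_less_imp_less_base[of "a - 1" 2 s] by simp
  have p: "sweep_par r v = a - s" by (simp add: sweep_par_def a_def s_def)
  show p0: "0 < sweep_par r v" and "sweep_par r v < 1" using sa s1 by (auto simp: p)
  have "(1 - (a - s))\<^sup>2 = 2 * (a - s) * (a - 1)"
    using s2 by (simp add: power2_eq_square algebra_simps)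
  hence "r * (1 - sweep_par r v)\<^sup>2 = 2 * sweep_par r v * (r * (a - 1))" by (simp add: p)
  also have "r * (a - 1) = v" using assms by (simp add: a_def)
  finally show "v = r / (2 * sweep_par r v) * (1 - sweep_par r v)\<^sup>2"
    using p0 by (simp add: field_simps)
qed

lemma sweep_par_tendsto: "0 < r \<Longrightarrow> (sweep_par r \<longlongrightarrow> 1) (at_right 0)"
  unfolding sweep_par_def[abs_def] by (auto intro!: tendsto_eq_intros)

text \<open>The balayage of the unit point mass at \<open>-v\<close> onto \<open>[0, 2r]\<close>.\<close>
definition swept :: "real \<Rightarrow> real \<Rightarrow> real measure" where
  "swept r v = arc_measure r r (arc_density 0 0 0 1 (- sweep_par r v))"

locale sweeping =
  fixes r v :: real
  assumes r: "0 < r" and v: "0 < v"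
begin

abbreviation "p \<equiv> sweep_par r v"
abbreviation "\<omega> \<equiv> swept r v"

lemmas p = sweep_par[OF r v]

sublocale poisson_arc r r 0 0 0 1 "- p"
proof
  show "0 \<le> arc_density 0 0 0 1 (- p) \<theta>" for \<theta>
    using p poisson_denom_pos[of "- p" \<theta>] by (auto simp: arc_density_def power_le_one_iff intro!: divide_nonneg_pos)
qed (use p r in auto)

lemma swept_mass_on: "mass_on (2 * r) 1 \<omega>"
  using mass_on[of "2 * r"] by (simp add: swept_def)

text \<open>The Poisson denominator is \<open>x + v\<close> up to a factor, because the pole sits at
  the coordinate of \<open>- v\<close>. The excess \<open>- ln p\<close> over the potential of the
  point mass is positive and tends to 0 with \<open>v\<close>.\<close>

lemma swept_potential:
  assumes "x \<in> {0..2 * r}"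
  shows "log_potential \<omega> x = ereal (- ln (x + v) - ln p)"
proof -
  have "x \<in> {r - r..r + r}" using assms by simp
  then obtain \<phi> where \<phi>: "x = r + r * cos \<phi>"
    "log_potential \<omega> x = ereal (- ln (r / 2) - ln (1 + 2 * p * cos \<phi> + p\<^sup>2))"
    by (rule potential_on_arc) (auto simp: swept_def)
  have pos: "0 < 1 + 2 * p * cos \<phi> + p\<^sup>2" using poisson_denom_pos[of "- p" \<phi>] p by simp
  have "x + v = r + r * cos \<phi> + r / (2 * p) * (1 - p)\<^sup>2" using \<phi>(1) p(3) by simp
  also have "\<dots> = r / 2 / p * (1 + 2 * p * cos \<phi> + p\<^sup>2)"
    using p(1) by (simp add: field_simps power2_eq_square)
  finally have "ln (x + v) = ln (r / 2) - ln p + ln (1 + 2 * p * cos \<phi> + p\<^sup>2)"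
    using p(1) r pos by (simp add: ln_mult ln_div)
  thus ?thesis using \<phi>(2) by simp
qed

lemma ln_shift_measurable: "(\<lambda>x. ln (x + v)) \<in> borel_measurable borel"
  by measurable

lemma ln_shift_bound:
  assumes "x \<in> {0..R}" shows "\<bar>ln (x + v)\<bar> \<le> \<bar>ln v\<bar> + \<bar>ln (R + v)\<bar>"
proof -
  have "ln v \<le> ln (x + v)" "ln (x + v) \<le> ln (R + v)" using assms v by auto
  thus ?thesis by linarith
qed

lemma ln_shift_integrable: "mass_on R t M \<Longrightarrow> integrable M (\<lambda>x. ln (x + v))"
  by (rule mass_on_integrable_bounded[OF _ ln_shift_measurable ln_shift_bound])

text \<open>The potential formula is evaluated at \<open>- v\<close> itself, where
  \<open>w = - p\<close>. With \<open>swept_potential\<close> this determines the self-energy of the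
  balayage, which grows like \<open>- ln v\<close>.\<close>

lemma swept_ln_integral: "(\<integral>x. ln (x + v) \<partial>\<omega>) = ln v + 2 * ln (1 + p)"
proof -
  have x: "complex_of_real (- v) = complex_of_real r + complex_of_real (r / 2) * (complex_of_real (- p) + 1 / complex_of_real (- p))"
  proof -
    have "- v = r + r / 2 * ((- p) + 1 / (- p))"
      using p(1) by (subst p(3)) (simp add: field_simps power2_eq_square)
    hence "complex_of_real (- v) = complex_of_real (r + r / 2 * ((- p) + 1 / (- p)))" by (rule arg_cong)
    thus ?thesis by simp
  qed
  have e: "1 - complex_of_real (- p) * complex_of_real (- p) = complex_of_real (1 - p * p)" by simp
  have "p * p < 1 * 1" using p by (intro mult_strict_mono) auto
  hence n: "cmod (1 - complex_of_real (- p) * complex_of_real (- p)) = 1 - p * p"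
    unfolding e norm_of_real by simp
  have pot: "log_potential \<omega> (- v) = ereal (- (ln (r / 2) - ln p) - 2 * ln (1 - p * p))"
    unfolding swept_def using p n by (subst potential[OF _ _ x]) auto
  have ae: "AE x in \<omega>. x \<in> {0..2 * r}" by (rule mass_on_AE[OF swept_mass_on])
  have i: "integrable \<omega> (\<lambda>x. ln (x + v))" by (rule ln_shift_integrable[OF swept_mass_on])
  have eq: "AE x in \<omega>. ln \<bar>- v - x\<bar> = ln (x + v)"
    using ae by eventually_elim (use v in \<open>auto simp: abs_if add.commute\<close>)
  have [measurable_cong]: "sets \<omega> = sets borel" by (rule mass_on_sets[OF swept_mass_on])
  have i': "integrable \<omega> (\<lambda>x. ln \<bar>- v - x\<bar>)"
    using i by (subst integrable_cong_AE[OF _ _ eq]) auto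
  have "AE x in \<omega>. x \<noteq> - v" using ae by eventually_elim (use v in auto)
  from log_potential_eq_integral[OF mass_on_sets[OF swept_mass_on] i' this]
  have "log_potential \<omega> (- v) = ereal (- (\<integral>x. ln (x + v) \<partial>\<omega>))"
    by (simp add: integral_cong_AE[OF _ _ eq])
  hence "(\<integral>x. ln (x + v) \<partial>\<omega>) = ln (r / 2) - ln p + 2 * ln (1 - p * p)" using pot by simp
  also have "1 - p * p = (1 - p) * (1 + p)" by (simp add: algebra_simps)
  also have "ln (r / 2) - ln p + 2 * ln ((1 - p) * (1 + p)) = ln (r / (2 * p) * (1 - p)\<^sup>2) + 2 * ln (1 + p)"
    using p(1,2) r by (simp add: ln_mult ln_div power2_eq_square)
  finally show ?thesis using p(3) by simp
qed

text \<open>Mean value formula for the identity function. Since the measure lives on nonnegative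
  numbers and \<open>p\<close> tends to 1, this moment controls its concentration at 0.\<close>

lemma swept_first_moment: "(\<integral>x. x \<partial>\<omega>) = r * (1 - p)"
proof -
  let ?h = "arc_density 0 0 0 1 (- p)"
  have q: "\<bar>- p\<bar> < 1" using p by simp
  have "((\<lambda>\<theta>. cos \<theta> * ?h \<theta>) has_integral 2 * pi * (- p)) {0..2*pi}"
    using has_integral_Re[OF arc_mean_value[OF holomorphic_on_ident open_UNIV subset_UNIV q, of 0 0 0 1]] by simp
  note c = has_integral_imp_lborel[OF _ this]
  have cc: "continuous_on {0..2*pi} (\<lambda>\<theta>. cos \<theta> * ?h \<theta>)"
    by (intro continuous_on_mult continuous_arc_density[OF q] continuous_intros)
  note c = c[OF cc] and d = density_integral
  have "(\<integral>x. x \<partial>\<omega>) = (\<integral>\<theta>. indicator {0..2*pi} \<theta> * (?h \<theta> / (2*pi)) * (r + r * cos \<theta>) \<partial>lborel)"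
    unfolding swept_def by (subst arc_integral) auto
  also have "\<dots> = (\<integral>\<theta>. r / (2*pi) * (indicator {0..2*pi} \<theta> * ?h \<theta> + indicator {0..2*pi} \<theta> * (cos \<theta> * ?h \<theta>)) \<partial>lborel)"
    by (intro Bochner_Integration.integral_cong) (auto simp: algebra_simps add_divide_distrib)
  also have "\<dots> = r / (2*pi) * (2 * pi * 1 + 2 * pi * (- p))"
    using c d by simp
  also have "\<dots> = r / (2*pi) * (2 * pi * (1 - p))" by (simp add: algebra_simps)
  finally show ?thesis by simp
qed

end

section \<open>Uniform bounds and the case t \<le> \<gamma>\<close>

lemma bounded_quadratic_plus:
  fixes x R \<beta> :: real
  assumes "x \<in> {0..R}" shows "\<bar>x\<^sup>2 / 2 + \<beta> * x\<bar> \<le> (R / 2 + \<bar>\<beta>\<bar>) * x" "(R / 2 + \<bar>\<beta>\<bar>) * x \<le> (R / 2 + \<bar>\<beta>\<bar>) * R"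
proof -
  have "x * x \<le> R * x" using assms by (intro mult_right_mono) auto
  moreover have "\<bar>\<beta> * x\<bar> = \<bar>\<beta>\<bar> * x" using assms by (simp add: abs_mult)
  moreover have "\<bar>x\<^sup>2 / 2 + \<beta> * x\<bar> \<le> x\<^sup>2 / 2 + \<bar>\<beta> * x\<bar>" using abs_triangle_ineq[of "x\<^sup>2 / 2" "\<beta> * x"] by simp
  ultimately show "\<bar>x\<^sup>2 / 2 + \<beta> * x\<bar> \<le> (R / 2 + \<bar>\<beta>\<bar>) * x"
    by (simp add: power2_eq_square distrib_right)
  show "(R / 2 + \<bar>\<beta>\<bar>) * x \<le> (R / 2 + \<bar>\<beta>\<bar>) * R" using assms by (intro mult_left_mono) auto
qed

lemma near_zero_bound:
  fixes f :: "real \<Rightarrow> real"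
  assumes f: "continuous_on UNIV f" and F: "\<And>x. \<bar>f x\<bar> \<le> F" and e: "0 < e"
  obtains \<delta> where "0 < \<delta>" "\<delta> < 1" "\<And>x. 0 \<le> x \<Longrightarrow> \<bar>f x - f 0\<bar> \<le> e + 2 * F * indicator {\<delta><..} x"
proof -
  have "isCont f 0" using f by (simp add: continuous_on_eq_continuous_at)
  then obtain d where d: "0 < d" "\<And>x. \<bar>x\<bar> < d \<Longrightarrow> \<bar>f x - f 0\<bar> < e"
    using e unfolding continuous_at_eps_delta dist_real_def by (metis diff_zero)
  have F0: "0 \<le> F" using F[of 0] by linarith
  define \<delta> where "\<delta> = min (d / 2) (1 / 2)"
  have \<delta>: "0 < \<delta>" "\<delta> < 1" "\<delta> < d" using d by (auto simp: \<delta>_def)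
  show thesis
  proof (rule that[of \<delta>])
    fix x :: real assume x: "0 \<le> x"
    show "\<bar>f x - f 0\<bar> \<le> e + 2 * F * indicator {\<delta><..} x"
    proof (cases "x \<le> \<delta>")
      case True
      hence "\<bar>f x - f 0\<bar> < e" using d \<delta> x by auto
      thus ?thesis using True by (simp add: indicator_def)
    next
      case False
      thus ?thesis using F[of x] F[of 0] e by (auto simp: indicator_def)
    qed
  qed (use \<delta> in auto)
qed

text \<open>For \<open>x \<ge> 1\<close> the attracting logarithm is nonnegative and only helps to
  confine the measure, and on \<open>{1..2}\<close> it is at most \<open>ln 3\<close>; so the
  support bound is uniform in \<open>v \<le> 1\<close>.\<close>

lemma uniform_support_bound:
  fixes \<beta> \<gamma> t :: real
  assumes t: "0 < t" and \<gamma>: "0 < \<gamma>"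
    and nu: "\<And>v. v > 0 \<Longrightarrow> equilibrium_measure {0..} (\<lambda>x. x\<^sup>2 / 2 + \<beta> * x + \<gamma> * ln (x + v)) t (\<nu> v)"
  obtains R where "1 \<le> R" "\<And>v. 0 < v \<Longrightarrow> v \<le> 1 \<Longrightarrow> measure_support (\<nu> v) \<subseteq> {..R}"
proof -
  define B where "B = 2 + 2 * \<bar>\<beta>\<bar> + \<gamma> * ln 3"
  have B0: "0 \<le> B" using \<gamma> by (simp add: B_def)
  define R where "R = 2 * (\<bar>\<beta>\<bar> + t) + 2 * (B + 2 * t) + 2"
  have R1: "1 \<le> R" using B0 t by (simp add: R_def)
  show thesis
  proof (rule that[OF R1])
    fix v :: real assume v: "0 < v" "v \<le> 1"
    show "measure_support (\<nu> v) \<subseteq> {..R}"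
    proof (rule equilibrium_support_bound[OF nu[OF v(1)] t _ R1])
      fix x :: real assume x: "x \<in> {1..2}"
      have "x * x \<le> 2 * 2" using x by (intro mult_mono) auto
      moreover have "\<beta> * x \<le> \<bar>\<beta>\<bar> * x" using x by (intro mult_right_mono) auto
      moreover have "\<bar>\<beta>\<bar> * x \<le> \<bar>\<beta>\<bar> * 2" using x by (intro mult_left_mono) auto
      moreover have "\<gamma> * ln (x + v) \<le> \<gamma> * ln 3" using x v \<gamma> by (intro mult_left_mono) auto
      ultimately show "x\<^sup>2 / 2 + \<beta> * x + \<gamma> * ln (x + v) \<le> B" by (simp add: B_def power2_eq_square)
    next
      fix x assume x: "R < x"
      have x1: "1 < x" using x R1 by simp
      have "0 \<le> \<gamma> * ln (x + v)" using x1 v \<gamma> by simp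
      moreover have "t * ln x \<le> t * x" using t x1 ln_bound[of x] by (intro mult_left_mono) auto
      moreover have "- \<bar>\<beta>\<bar> * x \<le> \<beta> * x" using x1 by (intro mult_right_mono) auto
      ultimately have "x\<^sup>2 / 2 + \<beta> * x + \<gamma> * ln (x + v) - t * ln x \<ge> x * (x / 2 - \<bar>\<beta>\<bar> - t)"
        by (simp add: power2_eq_square algebra_simps)
      moreover have "1 * (B + 2 * t + 1) \<le> x * (x / 2 - \<bar>\<beta>\<bar> - t)"
        using x1 x B0 t by (intro mult_mono) (auto simp: R_def)
      ultimately show "B + 2 * t < x\<^sup>2 / 2 + \<beta> * x + \<gamma> * ln (x + v) - t * ln x" by simp
    qed
  qed
qed

text \<open>Integrating the lower bound of the potential of \<open>\<nu>\<close> against the balayage and exchanging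
  the roles of the two measures shows that mass at least \<open>\<gamma> - o(1)\<close> concentrates at \<open>0\<close>
  unless the whole support shrinks to \<open>0\<close>.\<close>
lemma tail_mass_bound:
  fixes \<beta> \<gamma> t :: real
  assumes t: "0 < t" "t \<le> \<gamma>" and hr: "1 \<le> 2 * r" and hv: "0 < v" "v < 1" and hp: "1 / 2 \<le> sweep_par r v"
    and e: "equilibrium_measure {0..} (\<lambda>x. x\<^sup>2 / 2 + \<beta> * x + \<gamma> * ln (x + v)) t \<nu>"
    and S: "measure_support \<nu> \<subseteq> {..2 * r}" and \<delta>: "0 < \<delta>" "\<delta> < 1"
  shows "measure \<nu> {\<delta><..} * (- ln v) \<le>
    2 * (r + \<bar>\<beta>\<bar>) * (2 * r) + 2 * \<gamma> * ln 2 + t * ln 2 + t * ln (2 * r) - \<gamma> * ln \<delta> - t * ln \<delta>"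
proof -
  have r0: "0 < r" using hr by simp
  interpret sweeping r v by unfold_locales (use r0 hv in auto)
  let ?R = "2 * r" and ?\<phi> = "\<lambda>x. x\<^sup>2 / 2 + \<beta> * x + \<gamma> * ln (x + v)" and ?\<psi> = "\<lambda>x. x\<^sup>2 / 2 + \<beta> * x"
  let ?K = "(r + \<bar>\<beta>\<bar>) * (2 * r)"
  have m: "mass_on ?R t \<nu>" using equilibrium_mass_on[OF e _ S] t by simp
  interpret n: finite_measure \<nu> by (rule mass_on_finite[OF m])
  interpret w: finite_measure \<omega> by (rule mass_on_finite[OF swept_mass_on])
  have [measurable_cong]: "sets \<nu> = sets borel" by (rule mass_on_sets[OF m])
  have lnd: "ln \<delta> < 0" and lnv: "ln v < 0" and lnR: "0 \<le> ln ?R" using \<delta> hv hr by auto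
  have rhs: "0 \<le> 2 * (r + \<bar>\<beta>\<bar>) * (2 * r) + 2 * \<gamma> * ln 2 + t * ln 2 + t * ln ?R - \<gamma> * ln \<delta> - t * ln \<delta>"
  proof -
    have "\<gamma> * ln \<delta> \<le> 0" "t * ln \<delta> \<le> 0" using t lnd by (auto intro!: mult_nonneg_nonpos)
    moreover have "0 \<le> \<gamma> * ln 2" "0 \<le> t * ln 2" "0 \<le> t * ln ?R" "0 \<le> ?K" using t lnR r0 by auto
    ultimately show ?thesis by (simp only: mult.assoc)
  qed
  obtain c where c: "\<And>x. x \<in> measure_support \<nu> \<Longrightarrow> log_potential \<nu> x = ereal (c - ?\<phi> x)"
    "\<And>x. x \<in> {0..} \<Longrightarrow> ereal (c - ?\<phi> x) \<le> log_potential \<nu> x"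
    using equilibrium_potential[OF e] by blast
  \<comment> \<open>If the support lies in \<open>{..\<delta>}\<close>, the tail is null. Otherwise
    a support point beyond \<open>\<delta>\<close> bounds the equilibrium constant \<open>c\<close>
    from below independently of \<open>v\<close>.\<close>
  show ?thesis
  proof (cases "measure_support \<nu> \<subseteq> {..\<delta>}")
    case True
    have "emeasure \<nu> (- {..\<delta>}) = 0" by (rule emeasure_UNIV_of_support(2)[OF mass_on_sets[OF m] True]) simp
    moreover have "- {..\<delta>} = {\<delta><..}" by auto
    ultimately have "measure \<nu> {\<delta><..} = 0" by (simp add: measure_def)
    thus ?thesis using rhs by simp
  next
    case False
    then obtain x where x: "x \<in> measure_support \<nu>" "\<delta> < x" by force
    have xR: "x \<in> {0..?R}" using x S \<delta> by auto
    have psi: "\<bar>?\<psi> y\<bar> \<le> ?K" if "y \<in> {0..?R}" for y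
      using bounded_quadratic_plus[OF that, of \<beta>] by simp
    have "ereal (- t * ln ?R) \<le> ereal (c - ?\<phi> x)"
      unfolding c(1)[OF x(1), symmetric] by (rule log_potential_lower_bound[OF m _ xR]) (use r0 in simp)
    moreover have "\<gamma> * ln \<delta> \<le> \<gamma> * ln (x + v)" using x \<delta> v t by (intro mult_left_mono) auto
    ultimately have c_ge: "- t * ln ?R - ?K + \<gamma> * ln \<delta> \<le> c" using psi[OF xR] by (simp add: abs_le_iff)
    have ipsi: "integrable M ?\<psi>" if "mass_on ?R a M" for a M
      by (rule mass_on_integrable_bounded[OF that _ psi]) auto
    have iw: "integrable \<omega> (\<lambda>x. c - ?\<phi> x)"
      using ipsi[OF swept_mass_on] ln_shift_integrable[OF swept_mass_on] by auto
    have inu: "integrable \<nu> (\<lambda>x. - ln (x + v) - ln p)" using ln_shift_integrable[OF m] by auto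
    have "AE x in \<nu>. log_potential \<omega> x \<le> ereal (- ln (x + v) - ln p)"
      using mass_on_AE[OF m] by eventually_elim (simp add: swept_potential)
    note le = menergy_le[OF swept_mass_on m _ inu this]
    have "AE x in \<omega>. ereal (c - ?\<phi> x) \<le> log_potential \<nu> x"
      using mass_on_AE[OF swept_mass_on] by eventually_elim (auto intro: c(2))
    hence "(\<integral>x. c - ?\<phi> x \<partial>\<omega>) \<le> menergy ?R \<nu> \<omega>"
      using le(1) energy_commute[OF mass_on_finite[OF m] mass_on_sets[OF m] mass_on_finite[OF swept_mass_on] mass_on_sets[OF swept_mass_on]] r0
      by (intro menergy_ge[OF m swept_mass_on _ iw]) auto
    also have "\<dots> \<le> (\<integral>x. - ln (x + v) - ln p \<partial>\<nu>)"
      using le(2) menergy_commute[OF m swept_mass_on] r0 by simp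
    also have "\<dots> = - (\<integral>x. ln (x + v) \<partial>\<nu>) - t * ln p"
      using ln_shift_integrable[OF m] mass_on_measure[OF m] mass_on_space[OF m] by simp
    finally have 1: "(\<integral>x. c - ?\<phi> x \<partial>\<omega>) \<le> - (\<integral>x. ln (x + v) \<partial>\<nu>) - t * ln p" .
    have "(\<integral>x. ?\<psi> x \<partial>\<omega>) \<le> (\<integral>x. ?K \<partial>\<omega>)"
    proof (rule integral_mono_AE[OF ipsi[OF swept_mass_on]])
      show "AE x in \<omega>. ?\<psi> x \<le> ?K"
        using mass_on_AE[OF swept_mass_on]
      proof eventually_elim
        case (elim x)
        show ?case using psi[OF elim] by linarith
      qed
    qed simp
    hence "(\<integral>x. ?\<psi> x \<partial>\<omega>) \<le> ?K" using mass_on_measure[OF swept_mass_on] mass_on_space[OF swept_mass_on] by simp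
    moreover have "(\<integral>x. c - ?\<phi> x \<partial>\<omega>) = c - (\<integral>x. ?\<psi> x \<partial>\<omega>) - \<gamma> * (ln v + 2 * ln (1 + p))"
      using ipsi[OF swept_mass_on] ln_shift_integrable[OF swept_mass_on] mass_on_measure[OF swept_mass_on] mass_on_space[OF swept_mass_on]
      by (subst Bochner_Integration.integral_diff) (auto simp: swept_ln_integral[symmetric])
    moreover have "\<gamma> * ln (1 + p) \<le> \<gamma> * ln 2" using p t by (intro mult_left_mono) auto
    ultimately have 2: "c - ?K - \<gamma> * ln v - 2 * \<gamma> * ln 2 \<le> - (\<integral>x. ln (x + v) \<partial>\<nu>) - t * ln p"
      using 1 by (simp add: distrib_left)
    have "ln (1 / 2) \<le> ln p" using hp p by (subst ln_le_cancel_iff) auto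
    hence "- ln 2 \<le> ln p" by (simp add: ln_div)
    hence lp: "- t * ln p \<le> t * ln 2" using t mult_left_mono[of "- ln 2" "ln p" t] by simp
    let ?n = "measure \<nu> {\<delta><..}"
    \<comment> \<open>Per unit of mass, \<open>{..\<delta>}\<close> contributes at most
      \<open>- ln v\<close> and the rest at most \<open>- ln \<delta>\<close>. In combination with
      fact \<open>2\<close>, whose left side contains \<open>- \<gamma> * ln v\<close>, the
      hypothesis \<open>t \<le> \<gamma>\<close> removes the logarithm of \<open>v\<close> except in
      front of the tail mass.\<close>
    have "(\<integral>x. - ln (x + v) \<partial>\<nu>) \<le> (\<integral>x. - ln v + indicator {\<delta><..} x * (ln v - ln \<delta>) \<partial>\<nu>)"
    proof (rule integral_mono_AE)
      show "AE x in \<nu>. - ln (x + v) \<le> - ln v + indicator {\<delta><..} x * (ln v - ln \<delta>)"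
        using mass_on_AE[OF m]
      proof eventually_elim
        case (elim x)
        thus ?case using hv \<delta> by (cases "\<delta> < x") auto
      qed
      show "integrable \<nu> (\<lambda>x. - ln (x + v))" using ln_shift_integrable[OF m] by simp
      show "integrable \<nu> (\<lambda>x. - ln v + indicator {\<delta><..} x * (ln v - ln \<delta>))"
        by (intro Bochner_Integration.integrable_add integrable_mult_left) (auto simp: mass_on_sets[OF m] less_top[symmetric])
    qed
    also have "\<dots> = - ln v * t + ?n * (ln v - ln \<delta>)"
      using mass_on_measure[OF m] mass_on_space[OF m] mass_on_sets[OF m]
      by (subst Bochner_Integration.integral_add) (auto simp: less_top[symmetric])
    finally have 3: "- (\<integral>x. ln (x + v) \<partial>\<nu>) \<le> - ln v * t + ?n * (ln v - ln \<delta>)" by simp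
    have nt: "?n \<le> t" using n.bounded_measure[of "{\<delta><..}"] mass_on_measure[OF m] mass_on_space[OF m] by simp
    have 4: "?n * (- ln \<delta>) \<le> t * (- ln \<delta>)" using nt lnd by (intro mult_right_mono) auto
    have 5: "t * (- ln v) \<le> \<gamma> * (- ln v)" using t lnv by (intro mult_right_mono) auto
    show ?thesis using c_ge 2 3 4 5 lp by (simp add: algebra_simps)
  qed
qed

text \<open>By \<open>tail_mass_bound\<close> the mass beyond any fixed \<open>\<delta>\<close> is
  \<open>O(1 / (- ln v))\<close>, so the whole mass \<open>t\<close> gathers at 0; the test function
  is split by \<open>near_zero_bound\<close>.\<close>

lemma limit_subcritical:
  fixes \<beta> \<gamma> t :: real
  assumes t: "0 < t" "t \<le> \<gamma>"
    and nu: "\<And>v. v > 0 \<Longrightarrow> equilibrium_measure {0..} (\<lambda>x. x\<^sup>2 / 2 + \<beta> * x + \<gamma> * ln (x + v)) t (\<nu> v)"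
  shows "weak_star_tendsto \<nu> (scale_measure (ennreal t) (dirac 0)) (at_right 0)"
  unfolding weak_star_tendsto_def
proof (intro allI impI)
  fix f :: "real \<Rightarrow> real" assume f: "continuous_on UNIV f \<and> bounded (range f)"
  then obtain F where F: "\<And>x. \<bar>f x\<bar> \<le> F" by (auto simp: bounded_iff)
  have fm [measurable]: "f \<in> borel_measurable borel" using f by (intro borel_measurable_continuous_onI) auto
  have lim: "(\<integral>x. f x \<partial>scale_measure (ennreal t) (dirac 0)) = t * f 0"
  proof -
    have s: "sets (dirac 0) = sets borel" by (simp add: dirac_def)
    have i: "integrable (dirac 0) f" by (rule integrableI_bounded_set_indicator[of UNIV _ _ F, simplified]) (auto simp: dirac_def F)
    have d: "scale_measure (ennreal t) (dirac 0) = density (dirac 0) (\<lambda>_. ennreal t)"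
      by (rule measure_eqI) (auto simp: emeasure_density dirac_def nn_integral_cmult)
    show ?thesis unfolding d using t by (subst integral_real_density) (auto simp: dirac_def integral_return)
  qed
  obtain R where R: "1 \<le> R" "\<And>v. 0 < v \<Longrightarrow> v \<le> 1 \<Longrightarrow> measure_support (\<nu> v) \<subseteq> {..R}"
    using uniform_support_bound[OF t(1) less_le_trans[OF t] nu] by blast
  define r where "r = R / 2"
  have r: "1 \<le> 2 * r" "0 < r" using R by (auto simp: r_def)
  show "((\<lambda>v. \<integral>x. f x \<partial>\<nu> v) \<longlongrightarrow> (\<integral>x. f x \<partial>scale_measure (ennreal t) (dirac 0))) (at_right 0)"
    unfolding lim
  proof (rule tendstoI)
    fix e :: real assume e: "0 < e"
    define e' where "e' = e / (2 * (t + 1))"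
    have e': "0 < e'" "e' * t < e / 2" using e t by (auto simp: e'_def field_simps)
    obtain \<delta> where \<delta>: "0 < \<delta>" "\<delta> < 1" "\<And>x. 0 \<le> x \<Longrightarrow> \<bar>f x - f 0\<bar> \<le> e' + 2 * F * indicator {\<delta><..} x"
      using near_zero_bound[of f F e'] f F e' by blast
    define K where "K = 2 * (r + \<bar>\<beta>\<bar>) * (2 * r) + 2 * \<gamma> * ln 2 + t * ln 2 + t * ln (2 * r) - \<gamma> * ln \<delta> - t * ln \<delta>"
    have F0: "0 \<le> F" using F[of 0] by linarith
    have "((\<lambda>v. 2 * F * (K / (- ln v))) \<longlongrightarrow> 0) (at_right 0)" by real_asymp
    hence "\<forall>\<^sub>F v in at_right 0. 2 * F * (K / (- ln v)) < e / 2" using e by (intro order_tendstoD) auto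
    moreover have "\<forall>\<^sub>F v in at_right 0. 1 / 2 < sweep_par r v"
      by (rule order_tendstoD(1)[OF sweep_par_tendsto[OF r(2)]]) simp
    moreover have "\<forall>\<^sub>F v in at_right (0::real). 0 < v \<and> v < 1" 
      by (auto simp: eventually_at_right_field intro: exI[of _ 1])
    ultimately show "\<forall>\<^sub>F v in at_right 0. dist (\<integral>x. f x \<partial>\<nu> v) (t * f 0) < e"
    proof eventually_elim
      case (elim v)
      hence S: "measure_support (\<nu> v) \<subseteq> {..2 * r}" using R(2)[of v] by (simp add: r_def)
      have m: "mass_on (2 * r) t (\<nu> v)" using equilibrium_mass_on[OF nu _ S] elim t by simp
      interpret n: finite_measure "\<nu> v" by (rule mass_on_finite[OF m])
      have s: "sets (\<nu> v) = sets borel" by (rule mass_on_sets[OF m])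
      have fi: "integrable (\<nu> v) f" by (rule mass_on_integrable_bounded[OF m fm F])
      have "measure (\<nu> v) {\<delta><..} * (- ln v) \<le> K"
        unfolding K_def by (rule tail_mass_bound[OF t r(1) _ _ _ nu S \<delta>(1,2)]) (use elim in auto)
      hence n: "measure (\<nu> v) {\<delta><..} \<le> K / (- ln v)"
        using elim by (subst pos_le_divide_eq) auto
      have "\<bar>(\<integral>x. f x \<partial>\<nu> v) - t * f 0\<bar> = \<bar>\<integral>x. f x - f 0 \<partial>\<nu> v\<bar>"
        using fi mass_on_measure[OF m] mass_on_space[OF m] by simp
      also have "\<dots> \<le> (\<integral>x. \<bar>f x - f 0\<bar> \<partial>\<nu> v)" by (rule integral_abs_bound)
      also have "\<dots> \<le> (\<integral>x. e' + 2 * F * indicator {\<delta><..} x \<partial>\<nu> v)"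
      proof (rule integral_mono_AE)
        show "AE x in \<nu> v. \<bar>f x - f 0\<bar> \<le> e' + 2 * F * indicator {\<delta><..} x"
          using mass_on_AE[OF m] by eventually_elim (use \<delta> in auto)
        show "integrable (\<nu> v) (\<lambda>x. \<bar>f x - f 0\<bar>)" using fi by simp
        show "integrable (\<nu> v) (\<lambda>x. e' + 2 * F * indicator {\<delta><..} x)"
          by (auto simp: s less_top[symmetric])
      qed
      also have "\<dots> = e' * t + 2 * F * measure (\<nu> v) {\<delta><..}"
        using mass_on_measure[OF m] mass_on_space[OF m] s by (subst Bochner_Integration.integral_add) (auto simp: less_top[symmetric])
      also have "\<dots> \<le> e' * t + 2 * F * (K / (- ln v))" using n F0 by (intro add_left_mono mult_left_mono) auto
      also have "\<dots> < e" using e' elim by simp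
      finally show ?case by (simp add: dist_real_def)
    qed
  qed
qed

section \<open>The case t > \<gamma>\<close>

text \<open>The balayage concentrates at 0, where \<open>\<rho>\<close> need not satisfy the
  equilibrium equality. If 0 belongs to the support, \<open>u\<close> is the equilibrium constant
  and the lower bound near 0 is the equilibrium inequality; otherwise the support keeps a distance
  from 0 and the potential is an ordinary integral there.\<close>

lemma equilibrium_potential_at_zero:
  assumes e: "equilibrium_measure {0..} \<psi> 1 \<rho>" and m: "mass_on R 1 \<rho>" and R: "0 < R"
    and \<psi>: "continuous_on UNIV \<psi>" "\<psi> 0 = 0"
  obtains u where "log_potential \<rho> 0 = ereal u"
    "\<And>v. 0 < v \<Longrightarrow> - (\<integral>s. ln (s + v) \<partial>\<rho>) \<le> u"
    "\<And>\<eta>. 0 < \<eta> \<Longrightarrow> \<exists>h>0. \<forall>x\<in>{0..h}. x \<le> R \<longrightarrow> ereal (u - \<eta>) \<le> log_potential \<rho> x"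
proof -
  interpret finite_measure \<rho> by (rule mass_on_finite[OF m])
  note s = mass_on_sets[OF m]
  note [measurable_cong] = s
  obtain c where c: "\<And>x. x \<in> measure_support \<rho> \<Longrightarrow> log_potential \<rho> x = ereal (c - \<psi> x)"
    "\<And>x. x \<in> {0..} \<Longrightarrow> ereal (c - \<psi> x) \<le> log_potential \<rho> x"
    using equilibrium_potential[OF e] by blast
  have z: "0 \<in> {0..R}" using R by simp
  have upper: "- (\<integral>s. ln (s + v) \<partial>\<rho>) \<le> u" if u: "log_potential \<rho> 0 = ereal u" and v: "0 < v" for u v
  proof -
    interpret sweeping 1 v by unfold_locales (use v in auto)
    note f = log_potential_finite_imp[OF m R z u]
    have "(\<integral>s. ln \<bar>0 - s\<bar> \<partial>\<rho>) \<le> (\<integral>s. ln (s + v) \<partial>\<rho>)"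
    proof (rule integral_mono_AE[OF f(2) ln_shift_integrable[OF m]])
      show "AE s in \<rho>. ln \<bar>0 - s\<bar> \<le> ln (s + v)"
        using f(1) mass_on_AE[OF m] by eventually_elim (use v in auto)
    qed
    thus ?thesis using f(3) by simp
  qed
  show thesis
  proof (cases "0 \<in> measure_support \<rho>")
    case True
    hence u: "log_potential \<rho> 0 = ereal c" using c(1) \<psi>(2) by simp
    show thesis
    proof (rule that[OF u upper[OF u]])
      fix \<eta> :: real assume \<eta>: "0 < \<eta>"
      have "isCont \<psi> 0" using \<psi> by (simp add: continuous_on_eq_continuous_at)
      then obtain d where d: "0 < d" "\<And>x. \<bar>x\<bar> < d \<Longrightarrow> \<bar>\<psi> x - \<psi> 0\<bar> < \<eta>"
        using \<eta> unfolding continuous_at_eps_delta dist_real_def by (metis diff_zero)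
      show "\<exists>h>0. \<forall>x\<in>{0..h}. x \<le> R \<longrightarrow> ereal (c - \<eta>) \<le> log_potential \<rho> x"
      proof (intro exI[of _ "d / 2"] conjI ballI impI)
        fix x assume x: "x \<in> {0..d/2}"
        have "\<bar>\<psi> x\<bar> < \<eta>" using d x \<psi>(2) by fastforce
        hence "ereal (c - \<eta>) \<le> ereal (c - \<psi> x)" by simp
        also have "\<dots> \<le> log_potential \<rho> x" using x by (intro c(2)) auto
        finally show "ereal (c - \<eta>) \<le> log_potential \<rho> x" .
      qed (use d in auto)
    qed
  next
    case False
    have "open (- measure_support \<rho>)" using closed_measure_support[of \<rho>] by (simp add: open_Compl)
    then obtain d where d: "0 < d" "ball 0 d \<subseteq> - measure_support \<rho>"
      using False by (auto simp: open_contains_ball)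
    have ae: "AE s in \<rho>. d \<le> s \<and> s \<le> R"
      using AE_measure_support[OF s] mass_on_AE[OF m]
    proof eventually_elim
      case (elim s)
      hence "s \<notin> ball 0 d" using d by blast
      thus ?case using elim by auto
    qed
    have int: "integrable \<rho> (\<lambda>s. ln \<bar>0 - s\<bar>)"
    proof (rule integrable_const_bound[where B="\<bar>ln d\<bar> + \<bar>ln R\<bar>"])
      show "AE s in \<rho>. norm (ln \<bar>0 - s\<bar>) \<le> \<bar>ln d\<bar> + \<bar>ln R\<bar>"
        using ae
      proof eventually_elim
        case (elim s)
        hence "ln d \<le> ln s" "ln s \<le> ln R" using d by auto
        hence "\<bar>ln s\<bar> \<le> \<bar>ln d\<bar> + \<bar>ln R\<bar>" by linarith
        thus ?case using elim d by simp
      qed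
    qed measurable
    have ne: "AE s in \<rho>. s \<noteq> 0" using ae by eventually_elim (use d in auto)
    note u = log_potential_eq_integral[OF s int ne]
    show thesis
    proof (rule that[OF u upper[OF u]])
      fix \<eta> :: real assume \<eta>: "0 < \<eta>"
      define h where "h = min (d / 2) (d * \<eta> / 2)"
      have h: "0 < h" "h < d" "h / d \<le> \<eta> / 2" using d \<eta> by (auto simp: h_def min_def field_simps)
      show "\<exists>h>0. \<forall>x\<in>{0..h}. x \<le> R \<longrightarrow> ereal (- (\<integral>s. ln \<bar>0 - s\<bar> \<partial>\<rho>) - \<eta>) \<le> log_potential \<rho> x"
      proof (intro exI[of _ h] conjI ballI impI h(1))
        fix x assume x: "x \<in> {0..h}"
        have int': "integrable \<rho> (\<lambda>s. ln \<bar>x - s\<bar>)"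
        proof (rule integrable_const_bound[where B="\<bar>ln (d - h)\<bar> + \<bar>ln R\<bar>"])
          show "AE s in \<rho>. norm (ln \<bar>x - s\<bar>) \<le> \<bar>ln (d - h)\<bar> + \<bar>ln R\<bar>"
            using ae
          proof eventually_elim
            case (elim s)
            hence "ln (d - h) \<le> ln \<bar>x - s\<bar>" "ln \<bar>x - s\<bar> \<le> ln R" using d h x by auto
            hence "\<bar>ln \<bar>x - s\<bar>\<bar> \<le> \<bar>ln (d - h)\<bar> + \<bar>ln R\<bar>" by linarith
            thus ?case by simp
          qed
        qed measurable
        have ne': "AE s in \<rho>. s \<noteq> x" using ae by eventually_elim (use d h x in auto)
        \<comment> \<open>Moving from 0 towards the support brings \<open>x\<close> closer to every
          \<open>s\<close> in it, so no logarithm of a distance increases.\<close>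
        have "(\<integral>s. ln \<bar>x - s\<bar> \<partial>\<rho>) \<le> (\<integral>s. ln \<bar>0 - s\<bar> + \<eta> \<partial>\<rho>)"
        proof (rule integral_mono_AE[OF int'])
          show "integrable \<rho> (\<lambda>s. ln \<bar>0 - s\<bar> + \<eta>)" using int by auto
          show "AE s in \<rho>. ln \<bar>x - s\<bar> \<le> ln \<bar>0 - s\<bar> + \<eta>"
            using ae
          proof eventually_elim
            case (elim s)
            have "ln \<bar>x - s\<bar> \<le> ln s" using elim d h x by (subst ln_le_cancel_iff) auto
            thus ?case using elim d \<eta> by auto
          qed
        qed
        also have "\<dots> = (\<integral>s. ln \<bar>0 - s\<bar> \<partial>\<rho>) + \<eta>"
          using int mass_on_measure[OF m] mass_on_space[OF m] by simp
        finally show "ereal (- (\<integral>s. ln \<bar>0 - s\<bar> \<partial>\<rho>) - \<eta>) \<le> log_potential \<rho> x"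
          unfolding log_potential_eq_integral[OF s int' ne'] by simp
      qed
    qed
  qed
qed

text \<open>A Markov estimate: the indicator of \<open>{\<delta><..}\<close> is at most
  \<open>x / \<delta>\<close>, and the first moment \<open>r * (1 - sweep_par r v)\<close> tends to
  0.\<close>

lemma swept_integral_tendsto:
  fixes f :: "real \<Rightarrow> real"
  assumes r: "0 < r" and f: "continuous_on UNIV f" and F: "\<And>x. \<bar>f x\<bar> \<le> F"
  shows "((\<lambda>v. \<integral>x. f x \<partial>swept r v) \<longlongrightarrow> f 0) (at_right 0)"
proof (rule tendstoI)
  fix e :: real assume e: "0 < e"
  have F0: "0 \<le> F" using F[of 0] by linarith
  obtain \<delta> where \<delta>: "0 < \<delta>" "\<And>x. 0 \<le> x \<Longrightarrow> \<bar>f x - f 0\<bar> \<le> e / 2 + 2 * F * indicator {\<delta><..} x"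
    using near_zero_bound[of f F "e / 2"] f F e by (metis half_gt_zero)
  have fm: "f \<in> borel_measurable borel" using f by (rule borel_measurable_continuous_onI)
  have "((\<lambda>v. 2 * F / \<delta> * (r * (1 - sweep_par r v))) \<longlongrightarrow> 2 * F / \<delta> * (r * (1 - 1))) (at_right 0)"
    by (intro tendsto_intros sweep_par_tendsto r)
  hence "\<forall>\<^sub>F v in at_right 0. 2 * F / \<delta> * (r * (1 - sweep_par r v)) < e / 2"
    using e by (intro order_tendstoD) auto
  moreover have "\<forall>\<^sub>F v in at_right (0::real). 0 < v" by (simp add: eventually_at_right_less)
  ultimately show "\<forall>\<^sub>F v in at_right 0. dist (\<integral>x. f x \<partial>swept r v) (f 0) < e"
  proof eventually_elim
    case (elim v)
    interpret sweeping r v by unfold_locales (use r elim in auto)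
    interpret finite_measure \<omega> by (rule mass_on_finite[OF swept_mass_on])
    note sp = mass_on_measure[OF swept_mass_on] mass_on_space[OF swept_mass_on]
    have fi: "integrable \<omega> f" by (rule mass_on_integrable_bounded[OF swept_mass_on fm F])
    have ii: "integrable \<omega> (\<lambda>x. x)" by (rule mass_on_integrable_bounded[OF swept_mass_on, of _ "2 * r"]) auto
    have "\<bar>(\<integral>x. f x \<partial>\<omega>) - f 0\<bar> = \<bar>\<integral>x. f x - f 0 \<partial>\<omega>\<bar>" using fi sp by simp
    also have "\<dots> \<le> (\<integral>x. \<bar>f x - f 0\<bar> \<partial>\<omega>)" by (rule integral_abs_bound)
    also have "\<dots> \<le> (\<integral>x. e / 2 + 2 * F / \<delta> * x \<partial>\<omega>)"
    proof (rule integral_mono_AE)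
      show "AE x in \<omega>. \<bar>f x - f 0\<bar> \<le> e / 2 + 2 * F / \<delta> * x"
        using mass_on_AE[OF swept_mass_on]
      proof eventually_elim
        case (elim x)
        have "2 * F * indicator {\<delta><..} x \<le> 2 * F * (x / \<delta>)"
          using F0 elim \<delta> by (intro mult_left_mono) (auto simp: indicator_def)
        thus ?case using \<delta>(2)[of x] elim by simp
      qed
    qed (use fi ii in auto)
    also have "\<dots> = e / 2 + 2 * F / \<delta> * (r * (1 - p))"
      using ii sp by (simp add: swept_first_moment)
    also have "\<dots> < e" using elim by simp
    finally show ?case by (simp add: dist_real_def)
  qed
qed

lemma normalized_field_continuous: "continuous_on UNIV (normalized_field \<beta> T)"
  unfolding normalized_field_def[abs_def] by (cases "T = 0") (auto intro!: continuous_intros)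

text \<open>The comparison measure is \<open>(\<gamma> - \<epsilon>) \<omega> + (t - \<gamma> + \<epsilon>) \<rho>\<close>, where \<open>\<omega>\<close> is the balayage of the point
  mass at \<open>-v\<close>. The correction \<open>\<epsilon> = O(1 / ln (1 / v))\<close> equalizes the potential at \<open>0\<close> and on the
  support of \<open>\<rho>\<close>; these differ if \<open>0\<close> does not belong to the support of \<open>\<rho>\<close>.\<close>
lemma supercritical_comparison:
  fixes \<beta> \<gamma> t :: real
  assumes \<gamma>: "0 < \<gamma>" "\<gamma> < t" and r: "1 \<le> 2 * r"
    and nu: "\<And>v. v > 0 \<Longrightarrow> equilibrium_measure {0..} (\<lambda>x. x\<^sup>2 / 2 + \<beta> * x + \<gamma> * ln (x + v)) t (\<nu> v)"
    and S: "\<And>v. 0 < v \<Longrightarrow> v \<le> 1 \<Longrightarrow> measure_support (\<nu> v) \<subseteq> {..2 * r}"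
    and \<rho>: "equilibrium_measure {0..} (normalized_field \<beta> (t - \<gamma>)) 1 \<rho>"
    and m\<rho>: "mass_on (2 * r) 1 \<rho>"
  obtains \<epsilon> where "(\<epsilon> \<longlongrightarrow> 0) (at_right 0)"
    "\<forall>\<^sub>F v in at_right 0. 0 \<le> \<epsilon> v \<and> \<epsilon> v \<le> \<gamma>"
    "((\<lambda>v. \<integral>z. (cdf (\<nu> v) z - cdf (combo (\<gamma> - \<epsilon> v) (swept r v) (t - \<gamma> + \<epsilon> v) \<rho>) z)\<^sup>2 \<partial>lborel) \<longlongrightarrow> 0) (at_right 0)"
proof -
  let ?R = "2 * r"
  have r0: "0 < r" and R0: "0 < ?R" using r by auto
  have t: "0 < t" using \<gamma> by simp
  define T where "T = t - \<gamma>"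
  have T: "0 < T" using \<gamma> by (simp add: T_def)
  let ?\<psi> = "\<lambda>x. x\<^sup>2 / 2 + \<beta> * x"
  have nf: "normalized_field \<beta> T x = ?\<psi> x / T" for x by (simp add: normalized_field_def)
  interpret rho: finite_measure \<rho> by (rule mass_on_finite[OF m\<rho>])
  note sr = mass_on_measure[OF m\<rho>] mass_on_space[OF m\<rho>]
  obtain c where c: "\<And>x. x \<in> measure_support \<rho> \<Longrightarrow> log_potential \<rho> x = ereal (c - ?\<psi> x / T)"
    "\<And>x. x \<in> {0..} \<Longrightarrow> ereal (c - ?\<psi> x / T) \<le> log_potential \<rho> x"
    using equilibrium_potential[OF \<rho>[folded T_def]] unfolding nf by blast
  obtain u where u: "log_potential \<rho> 0 = ereal u"
    "\<And>v. 0 < v \<Longrightarrow> - (\<integral>s. ln (s + v) \<partial>\<rho>) \<le> u"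
    "\<And>\<eta>. 0 < \<eta> \<Longrightarrow> \<exists>h>0. \<forall>x\<in>{0..h}. x \<le> ?R \<longrightarrow> ereal (u - \<eta>) \<le> log_potential \<rho> x"
    by (rule equilibrium_potential_at_zero[OF \<rho> m\<rho> R0 normalized_field_continuous])
       (auto simp: normalized_field_def)
  have uc: "c \<le> u" using c(2)[of 0] u(1) by simp
  define K where "K = r + \<bar>\<beta>\<bar>"
  define M where "M = K * ?R"
  have psi: "\<bar>?\<psi> x\<bar> \<le> K * x" "K * x \<le> M" if "x \<in> {0..?R}" for x
    using bounded_quadratic_plus[OF that, of \<beta>] by (simp_all add: K_def M_def)
  have K0: "0 \<le> K" using r0 by (simp add: K_def)
  have ipsi: "integrable N ?\<psi>" if "mass_on ?R a N" for a N
    by (rule mass_on_integrable_bounded[OF that, where B=M]) (use psi in \<open>auto intro: order_trans\<close>)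
  define \<Psi> where "\<Psi> = (\<integral>x. ?\<psi> x \<partial>\<rho>)"
  \<comment> \<open>At 0 the potential of the combination plus the field is about
    \<open>\<epsilon> v * ln v + T * u\<close>, and on the support of \<open>\<rho>\<close> it is
    about \<open>T * c\<close>. The two agree for this choice.\<close>
  define \<epsilon> where "\<epsilon> v = T * (u - c) / (- ln v)" for v
  have \<epsilon>_lim: "(\<epsilon> \<longlongrightarrow> 0) (at_right 0)" unfolding \<epsilon>_def by real_asymp
  have p_lim: "(sweep_par r \<longlongrightarrow> 1) (at_right 0)" by (rule sweep_par_tendsto[OF r0])
  have ev: "\<forall>\<^sub>F v in at_right 0. 0 < v \<and> v < 1 \<and> 1 / 2 < sweep_par r v \<and> \<epsilon> v < \<gamma> / 2"
    using order_tendstoD(1)[OF p_lim, of "1/2"] order_tendstoD(2)[OF \<epsilon>_lim, of "\<gamma> / 2"] \<gamma>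
    by (auto simp: eventually_conj_iff eventually_at_right_less eventually_at_right_field intro: exI[of _ 1])
  have \<epsilon>0: "0 \<le> \<epsilon> v" if "0 < v" "v < 1" for v
    unfolding \<epsilon>_def using that T uc by (intro divide_nonneg_nonneg mult_nonneg_nonneg) auto
  have \<epsilon>_ln: "\<epsilon> v * ln v = - T * (u - c)" if "0 < v" "v < 1" for v
    using that ln_less_zero[of v] by (simp add: \<epsilon>_def)
  \<comment> \<open>Upper bound, proved below, for the energy of the combination plus the integral
    of the field. The terms with \<open>u\<close> cancel in the limit, which is the ideal value
    \<open>T * c * t\<close>.\<close>
  define U where "U v = (\<gamma> - \<epsilon> v) * (- T * (u - c) + 2 * \<epsilon> v * ln 2)
      + (T + \<epsilon> v) * (\<gamma> - 2 * \<epsilon> v) * u + (T + \<epsilon> v)\<^sup>2 * c - (T + \<epsilon> v) * \<epsilon> v / T * \<Psi>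
      + (\<gamma> - \<epsilon> v) * (K * (r * (1 - sweep_par r v)))
      + ((\<gamma> - \<epsilon> v)\<^sup>2 + 2 * (\<gamma> - \<epsilon> v) * (T + \<epsilon> v)) * (- ln (sweep_par r v))" for v
  have U_lim: "(U \<longlongrightarrow> T * c * t) (at_right 0)"
  proof -
    have "(U \<longlongrightarrow> (\<gamma> - 0) * (- T * (u - c) + 2 * 0 * ln 2)
      + (T + 0) * (\<gamma> - 2 * 0) * u + (T + 0)\<^sup>2 * c - (T + 0) * 0 / T * \<Psi>
      + (\<gamma> - 0) * (K * (r * (1 - 1)))
      + ((\<gamma> - 0)\<^sup>2 + 2 * (\<gamma> - 0) * (T + 0)) * (- ln 1)) (at_right 0)"
      unfolding U_def[abs_def] using T by (intro tendsto_intros \<epsilon>_lim p_lim) auto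
    thus ?thesis by (simp add: T_def power2_eq_square algebra_simps)
  qed
  have main: "\<forall>\<^sub>F v in at_right 0.
      (\<integral>z. (cdf (\<nu> v) z - cdf (combo (\<gamma> - \<epsilon> v) (swept r v) (t - \<gamma> + \<epsilon> v) \<rho>) z)\<^sup>2 \<partial>lborel) \<le> ?R * (\<delta> * t + \<delta>) / 2"
    if \<delta>: "0 < \<delta>" for \<delta>
  proof -
    define \<eta> where "\<eta> = \<delta> / (4 * t)"
    have \<eta>: "0 < \<eta>" using \<delta> t by (simp add: \<eta>_def)
    obtain h0 where h0: "0 < h0" "\<And>x. x \<in> {0..h0} \<Longrightarrow> x \<le> ?R \<Longrightarrow> ereal (u - \<eta>) \<le> log_potential \<rho> x"
      using u(3)[OF \<eta>] by blast
    \<comment> \<open>Up to \<open>h\<close> the potential of \<open>\<rho>\<close> is compared with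
      \<open>u\<close>, beyond \<open>h\<close> its equilibrium inequality is used. The second entry
      of the minimum keeps the quadratic part of the field within \<open>\<delta> / 4\<close> on
      \<open>{0..h}\<close>.\<close>
    define h where "h = min h0 (\<delta> / (4 * (K + 1)))"
    have h: "0 < h" "h \<le> h0" using h0 \<delta> K0 by (auto simp: h_def)
    have "K * h \<le> K * (\<delta> / (4 * (K + 1)))" using K0 by (intro mult_left_mono) (auto simp: h_def)
    also have "\<dots> \<le> (K + 1) * (\<delta> / (4 * (K + 1)))" using K0 \<delta> by (intro mult_right_mono) auto
    also have "\<dots> = \<delta> / 4" using K0 by (simp add: divide_simps)
    finally have Kh: "K * h \<le> \<delta> / 4" .
    have "((\<lambda>v. \<epsilon> v * u) \<longlongrightarrow> 0 * u) (at_right 0)" by (intro tendsto_intros \<epsilon>_lim)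
    hence e1: "\<forall>\<^sub>F v in at_right 0. - (\<delta> / 4) < \<epsilon> v * u" using \<delta> by (intro order_tendstoD) auto
    have "((\<lambda>v. \<epsilon> v * ln h + \<epsilon> v * c - \<epsilon> v * M / T) \<longlongrightarrow> 0 * ln h + 0 * c - 0 * M / T) (at_right 0)"
      using T by (intro tendsto_intros \<epsilon>_lim) auto
    hence e2: "\<forall>\<^sub>F v in at_right 0. - \<delta> < \<epsilon> v * ln h + \<epsilon> v * c - \<epsilon> v * M / T" using \<delta> by (intro order_tendstoD) auto
    have e3: "\<forall>\<^sub>F v in at_right 0. U v < T * c * t + \<delta>" using \<delta> by (intro order_tendstoD(2)[OF U_lim]) auto
    show ?thesis
      using ev e1 e2 e3
    proof eventually_elim
      case (elim v)
      hence hv: "0 < v" "v < 1" by auto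
      interpret sweeping r v by unfold_locales (use r0 hv in auto)
      interpret w: finite_measure \<omega> by (rule mass_on_finite[OF swept_mass_on])
      note sw = mass_on_measure[OF swept_mass_on] mass_on_space[OF swept_mass_on]
      let ?e = "\<epsilon> v" and ?\<phi> = "\<lambda>x. x\<^sup>2 / 2 + \<beta> * x + \<gamma> * ln (x + v)"
      define a where "a = \<gamma> - ?e"
      define b where "b = T + ?e"
      have e0: "0 \<le> ?e" by (rule \<epsilon>0[OF hv])
      have ab: "0 \<le> a" "0 \<le> b" "a + b = t" "0 \<le> \<gamma> - 2 * ?e"
        using elim e0 \<gamma> T by (auto simp: a_def b_def T_def)
      have b_le: "b \<le> t" using ab by simp
      have bt: "t - \<gamma> + ?e = b" by (simp add: b_def T_def)
      let ?\<kappa> = "combo a \<omega> b \<rho>"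
      have m\<nu>: "mass_on ?R t (\<nu> v)" using equilibrium_mass_on[OF nu[OF hv(1)] _ S] hv t by simp
      have m\<kappa>: "mass_on ?R t ?\<kappa>" using mass_on_combo[OF swept_mass_on m\<rho> ab(1,2)] ab(3) by simp
      have i\<phi>: "integrable N ?\<phi>" if "mass_on ?R x N" for x N
        using ipsi[OF that] ln_shift_integrable[OF that] by simp
      obtain cn where cn: "\<And>x. x \<in> measure_support (\<nu> v) \<Longrightarrow> log_potential (\<nu> v) x = ereal (cn - ?\<phi> x)"
        "\<And>x. x \<in> {0..} \<Longrightarrow> ereal (cn - ?\<phi> x) \<le> log_potential (\<nu> v) x"
        using equilibrium_potential[OF nu[OF hv(1)]] by blast
      have lp: "0 \<le> - ln p" using p by simp
      have kge: "ereal (T * c - \<delta> - ?\<phi> x) \<le> log_potential ?\<kappa> x" if x: "x \<in> {0..?R}" for x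
      proof -
        have w: "ereal (- ln (x + v)) \<le> log_potential \<omega> x" unfolding swept_potential[OF x] using lp by simp
        have comb: "ereal (a * (- ln (x + v)) + b * y) \<le> log_potential ?\<kappa> x" if "ereal y \<le> log_potential \<rho> x" for y
          by (rule log_potential_combo_ge[OF swept_mass_on m\<rho> ab(1,2) R0 x w that])
        show ?thesis
        proof (cases "x \<le> h")
          \<comment> \<open>Three losses of at most \<open>\<delta> / 4\<close> each occur: from
            \<open>b * \<eta>\<close>, from the quadratic part of the field, and from
            \<open>\<epsilon> v * u\<close>. The logarithm is compensated by
            \<open>\<epsilon>_ln\<close>.\<close>
          case True
          have 1: "ereal (u - \<eta>) \<le> log_potential \<rho> x" using True h x by (intro h0(2)) auto
          have "?e * ln v \<le> ?e * ln (x + v)" using e0 hv x by (intro mult_left_mono) auto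
          moreover have "b * \<eta> \<le> t * \<eta>" using b_le \<eta> by (intro mult_right_mono) auto
          moreover have "t * \<eta> = \<delta> / 4" using t by (simp add: \<eta>_def)
          moreover have "K * x \<le> K * h" using True K0 by (intro mult_left_mono)
          moreover have "\<bar>?\<psi> x\<bar> \<le> K * x" using psi x by simp
          ultimately have "T * c - \<delta> - ?\<phi> x \<le> a * (- ln (x + v)) + b * (u - \<eta>)"
            using \<epsilon>_ln[OF hv] Kh elim by (simp add: a_def b_def algebra_simps)
          thus ?thesis using comb[OF 1] by (meson ereal_less_eq(3) order_trans)
        next
          \<comment> \<open>Here \<open>ln (x + v)\<close> is bounded below by \<open>ln h\<close>,
            so the terms with the factor \<open>\<epsilon> v\<close> together lose less than
            \<open>\<delta>\<close>.\<close>
          case False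
          have 1: "ereal (c - ?\<psi> x / T) \<le> log_potential \<rho> x" using x by (intro c(2)) auto
          have "?e * ln h \<le> ?e * ln (x + v)" using e0 hv x False h by (intro mult_left_mono) auto
          moreover have "?e * (?\<psi> x) / T \<le> ?e * M / T"
            using e0 T psi[OF x] by (intro divide_right_mono mult_left_mono) auto
          moreover have "b * (c - ?\<psi> x / T) = T * c + ?e * c - ?\<psi> x - ?e * (?\<psi> x) / T"
            using T by (simp add: b_def field_simps)
          ultimately have "T * c - \<delta> - ?\<phi> x \<le> a * (- ln (x + v)) + b * (c - ?\<psi> x / T)"
            using elim by (simp add: a_def algebra_simps)
          thus ?thesis using comb[OF 1] by (meson ereal_less_eq(3) order_trans)
        qed
      qed
      define J where "J = - (\<integral>s. ln (s + v) \<partial>\<rho>)"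
      have Ju: "J \<le> u" unfolding J_def by (rule u(2)[OF hv(1)])
      have iw: "integrable N (\<lambda>x. - ln (x + v) - ln p)" if "mass_on ?R 1 N" for N
        using ln_shift_integrable[OF that] mass_on_finite[OF that] by (auto simp: finite_measure.integrable_const)
      have pw: "AE x in N. log_potential \<omega> x \<le> ereal (- ln (x + v) - ln p)" if "mass_on ?R 1 N" for N
        using mass_on_AE[OF that] by eventually_elim (simp add: swept_potential)
      note Eww = menergy_le[OF swept_mass_on swept_mass_on R0 iw[OF swept_mass_on] pw[OF swept_mass_on]]
      note Ewr = menergy_le[OF swept_mass_on m\<rho> R0 iw[OF m\<rho>] pw[OF m\<rho>]]
      have ir: "integrable \<rho> (\<lambda>x. c - ?\<psi> x / T)" using ipsi[OF m\<rho>] by auto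
      have "AE x in \<rho>. log_potential \<rho> x \<le> ereal (c - ?\<psi> x / T)"
        using AE_measure_support[OF mass_on_sets[OF m\<rho>]] by eventually_elim (simp add: c)
      note Err = menergy_le[OF m\<rho> m\<rho> R0 ir this]
      have Erw: "energy ?R \<rho> \<omega> < \<infinity>"
        using Ewr(1) energy_commute[OF mass_on_finite[OF m\<rho>] mass_on_sets[OF m\<rho>] mass_on_finite[OF swept_mass_on] mass_on_sets[OF swept_mass_on]] by simp
      have fin: "energy ?R \<omega> ?\<kappa> < \<infinity>" "energy ?R \<rho> ?\<kappa> < \<infinity>"
        using Eww(1) Ewr(1) Err(1) Erw
        by (auto simp: energy_combo[OF swept_mass_on m\<rho> swept_mass_on] energy_combo[OF swept_mass_on m\<rho> m\<rho>] ennreal_mult_less_top)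
      have fin': "energy ?R ?\<kappa> \<omega> < \<infinity>" "energy ?R ?\<kappa> \<rho> < \<infinity>"
        using fin energy_commute[OF mass_on_finite[OF m\<kappa>] mass_on_sets[OF m\<kappa>] mass_on_finite[OF swept_mass_on] mass_on_sets[OF swept_mass_on]]
          energy_commute[OF mass_on_finite[OF m\<kappa>] mass_on_sets[OF m\<kappa>] mass_on_finite[OF m\<rho>] mass_on_sets[OF m\<rho>]] by simp_all
      have kfin: "energy ?R ?\<kappa> ?\<kappa> < \<infinity>"
        using fin' by (auto simp: energy_combo[OF swept_mass_on m\<rho> m\<kappa>] ennreal_mult_less_top)
      have kk: "menergy ?R ?\<kappa> ?\<kappa> = a\<^sup>2 * menergy ?R \<omega> \<omega> + 2 * a * b * menergy ?R \<omega> \<rho> + b\<^sup>2 * menergy ?R \<rho> \<rho>"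
        unfolding menergy_combo[OF swept_mass_on m\<rho> m\<kappa> ab(1,2) fin'] menergy_commute[OF m\<kappa> swept_mass_on R0]
          menergy_commute[OF m\<kappa> m\<rho> R0] menergy_combo[OF swept_mass_on m\<rho> swept_mass_on ab(1,2) Eww(1) Ewr(1)]
          menergy_combo[OF swept_mass_on m\<rho> m\<rho> ab(1,2) Erw Err(1)] menergy_commute[OF m\<rho> swept_mass_on R0]
        by (simp add: power2_eq_square algebra_simps)
      have E1: "menergy ?R \<omega> \<omega> \<le> - (ln v + 2 * ln (1 + p)) - ln p"
        using Eww(2) ln_shift_integrable[OF swept_mass_on] sw by (simp add: swept_ln_integral)
      have E2: "menergy ?R \<omega> \<rho> \<le> J - ln p"
        using Ewr(2) ln_shift_integrable[OF m\<rho>] sr by (simp add: J_def)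
      have E3: "menergy ?R \<rho> \<rho> \<le> c - \<Psi> / T"
        using Err(2) ipsi[OF m\<rho>] sr by (simp add: \<Psi>_def)
      have "(\<integral>x. ?\<psi> x \<partial>\<omega>) \<le> (\<integral>x. K * x \<partial>\<omega>)"
      proof (rule integral_mono_AE)
        show "AE x in \<omega>. ?\<psi> x \<le> K * x"
          using mass_on_AE[OF swept_mass_on] by eventually_elim (use psi in \<open>auto simp: abs_le_iff\<close>)
        show "integrable \<omega> (\<lambda>x. K * x)"
          by (rule mass_on_integrable_bounded[OF swept_mass_on, where B=M]) (use psi K0 in \<open>auto simp: abs_mult\<close>)
      qed (rule ipsi[OF swept_mass_on])
      hence P1: "(\<integral>x. ?\<psi> x \<partial>\<omega>) \<le> K * (r * (1 - p))" by (simp add: swept_first_moment)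
      have P2: "(\<integral>x. ?\<phi> x \<partial>?\<kappa>) = a * ((\<integral>x. ?\<psi> x \<partial>\<omega>) + \<gamma> * (ln v + 2 * ln (1 + p))) + b * (\<Psi> - \<gamma> * J)"
      proof -
        have "(\<integral>x. ?\<phi> x \<partial>?\<kappa>) = a * (\<integral>x. ?\<phi> x \<partial>\<omega>) + b * (\<integral>x. ?\<phi> x \<partial>\<rho>)"
          by (intro integral_combo ab mass_on_sets[OF swept_mass_on] mass_on_sets[OF m\<rho>] i\<phi>[OF swept_mass_on] i\<phi>[OF m\<rho>]) measurable
        thus ?thesis
          using ipsi[OF swept_mass_on] ipsi[OF m\<rho>] ln_shift_integrable[OF swept_mass_on] ln_shift_integrable[OF m\<rho>]
          by (simp add: swept_ln_integral \<Psi>_def J_def)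
      qed
      have kle: "menergy ?R ?\<kappa> ?\<kappa> \<le> (T * c) * t + \<delta> - (\<integral>x. ?\<phi> x \<partial>?\<kappa>)"
      proof -
        let ?L = "ln v + 2 * ln (1 + p)"
        have "menergy ?R ?\<kappa> ?\<kappa> + (\<integral>x. ?\<phi> x \<partial>?\<kappa>) \<le>
          a\<^sup>2 * (- ?L - ln p) + 2 * a * b * (J - ln p) + b\<^sup>2 * (c - \<Psi> / T) + (a * (K * (r * (1 - p)) + \<gamma> * ?L) + b * (\<Psi> - \<gamma> * J))"
          unfolding kk P2 using E1 E2 E3 P1 ab \<gamma> by (intro add_mono mult_left_mono) auto
        \<comment> \<open>The self-energy of the balayage brings \<open>- a\<^sup>2 * ?L\<close> and
          the field \<open>a * \<gamma> * ?L\<close>; with \<open>a = \<gamma> - ?e\<close> only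
          \<open>a * ?e * ?L\<close> survives, which stays bounded as \<open>v\<close> tends to
          0.\<close>
        also have "\<dots> = a * (?e * ?L) + b * (\<gamma> - 2 * ?e) * J + b\<^sup>2 * c - b * ?e / T * \<Psi>
            + a * (K * (r * (1 - p))) + (a\<^sup>2 + 2 * a * b) * (- ln p)"
        proof -
          have aa: "a\<^sup>2 = a * (\<gamma> - ?e)" by (simp add: a_def power2_eq_square)
          have bb: "b\<^sup>2 * (c - \<Psi> / T) = b\<^sup>2 * c - b * \<Psi> - b * ?e / T * \<Psi>"
            using T by (simp add: b_def power2_eq_square field_simps)
          have ab2: "2 * a * b * (J - ln p) - b * \<gamma> * J = b * (\<gamma> - 2 * ?e) * J + 2 * a * b * (- ln p)"
            by (simp add: a_def algebra_simps)
          show ?thesis using ab2 unfolding bb by (simp add: aa algebra_simps)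
        qed
        also have "\<dots> \<le> U v"
        proof -
          have "?e * ln (1 + p) \<le> ?e * ln 2" using e0 p by (intro mult_left_mono) auto
          hence 1: "a * (?e * ?L) \<le> a * (- T * (u - c) + 2 * ?e * ln 2)"
            using \<epsilon>_ln[OF hv] ab by (intro mult_left_mono) (auto simp: algebra_simps)
          \<comment> \<open>The coefficient of \<open>J\<close> is nonnegative because
            \<open>ev\<close> imposes \<open>\<epsilon> v < \<gamma> / 2\<close>.\<close>
          have 2: "b * (\<gamma> - 2 * ?e) * J \<le> b * (\<gamma> - 2 * ?e) * u" using Ju ab by (intro mult_left_mono) auto
          show ?thesis unfolding U_def a_def[symmetric] b_def[symmetric] using 1 2 by simp
        qed
        finally show ?thesis using elim by simp
      qed
      have "(\<integral>z. (cdf (\<nu> v) z - cdf ?\<kappa> z)\<^sup>2 \<partial>lborel) \<le> ?R * (\<delta> * t + \<delta>) / 2"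
      proof (rule equilibrium_stability[OF m\<nu> m\<kappa> R0 i\<phi>[OF m\<nu>] i\<phi>[OF m\<kappa>] _ _ _ kfin kle])
        show "AE x in \<nu> v. log_potential (\<nu> v) x = ereal (cn - ?\<phi> x)"
          using AE_measure_support[OF mass_on_sets[OF m\<nu>]] by eventually_elim (rule cn(1))
        show "AE x in ?\<kappa>. ereal (cn - ?\<phi> x) \<le> log_potential (\<nu> v) x"
          using mass_on_AE[OF m\<kappa>] by eventually_elim (rule cn(2), auto)
        show "AE x in \<nu> v. ereal (T * c - \<delta> - ?\<phi> x) \<le> log_potential ?\<kappa> x"
          using mass_on_AE[OF m\<nu>] by eventually_elim (rule kge)
      qed
      thus ?case unfolding bt a_def .
    qed
  qed
  show thesis
  proof (rule that[OF \<epsilon>_lim])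
    show "\<forall>\<^sub>F v in at_right 0. 0 \<le> \<epsilon> v \<and> \<epsilon> v \<le> \<gamma>"
      using ev by eventually_elim (use \<epsilon>0 \<gamma> in auto)
    show "((\<lambda>v. \<integral>z. (cdf (\<nu> v) z - cdf (combo (\<gamma> - \<epsilon> v) (swept r v) (t - \<gamma> + \<epsilon> v) \<rho>) z)\<^sup>2 \<partial>lborel) \<longlongrightarrow> 0) (at_right 0)"
    proof (rule tendstoI)
      fix e :: real assume e: "0 < e"
      define \<delta> where "\<delta> = e / (?R * (t + 1))"
      have \<delta>: "0 < \<delta>" using e R0 t by (simp add: \<delta>_def)
      have "?R * (\<delta> * t + \<delta>) / 2 = (?R * (t + 1)) * \<delta> / 2" by (simp add: algebra_simps)
      also have "\<dots> = e / 2" using R0 t by (simp add: \<delta>_def)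
      finally have lt: "?R * (\<delta> * t + \<delta>) / 2 < e" using e by simp
      show "\<forall>\<^sub>F v in at_right 0. dist (\<integral>z. (cdf (\<nu> v) z - cdf (combo (\<gamma> - \<epsilon> v) (swept r v) (t - \<gamma> + \<epsilon> v) \<rho>) z)\<^sup>2 \<partial>lborel) 0 < e"
        using main[OF \<delta>]
      proof eventually_elim
        case (elim v)
        have "0 \<le> (\<integral>z. (cdf (\<nu> v) z - cdf (combo (\<gamma> - \<epsilon> v) (swept r v) (t - \<gamma> + \<epsilon> v) \<rho>) z)\<^sup>2 \<partial>lborel)"
          by (intro Bochner_Integration.integral_nonneg) auto
        thus ?case using elim lt by (simp add: dist_real_def)
      qed
    qed
  qed
qed

text \<open>The distance of \<open>\<nu> v\<close> from the comparison measure tends to 0, and the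
  comparison measure tends to the claimed limit since the balayage tends to the point mass and the
  correction to 0. The radius is taken large enough for the supports of \<open>\<rho>\<close> and of
  all \<open>\<nu> v\<close> with \<open>v \<le> 1\<close>.\<close>

lemma limit_supercritical:
  fixes \<beta> \<gamma> t :: real
  assumes \<gamma>: "0 < \<gamma>" "\<gamma> < t"
    and nu: "\<And>v. v > 0 \<Longrightarrow> equilibrium_measure {0..} (\<lambda>x. x\<^sup>2 / 2 + \<beta> * x + \<gamma> * ln (x + v)) t (\<nu> v)"
    and \<rho>: "equilibrium_measure {0..} (normalized_field \<beta> (t - \<gamma>)) 1 \<rho>"
  shows "weak_star_tendsto \<nu> (combo \<gamma> (dirac 0) (t - \<gamma>) \<rho>) (at_right 0)"
  unfolding weak_star_tendsto_def
proof (intro allI impI)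
  fix f :: "real \<Rightarrow> real" assume f: "continuous_on UNIV f \<and> bounded (range f)"
  then obtain F where F: "\<And>x. \<bar>f x\<bar> \<le> F" by (auto simp: bounded_iff)
  have fc: "continuous_on UNIV f" using f by simp
  have fm [measurable]: "f \<in> borel_measurable borel" using fc by (rule borel_measurable_continuous_onI)
  have t: "0 < t" using \<gamma> by simp
  obtain R where R: "1 \<le> R" "\<And>v. 0 < v \<Longrightarrow> v \<le> 1 \<Longrightarrow> measure_support (\<nu> v) \<subseteq> {..R}"
    using uniform_support_bound[OF t \<gamma>(1) nu] by blast
  have "bounded (measure_support \<rho>)" using \<rho> by (simp add: equilibrium_measure_def compact_imp_bounded)
  then obtain R' where R': "measure_support \<rho> \<subseteq> {..R'}"
    by (metis bounded_subset_cbox_symmetric box_real(2) atMost_iff atLeastAtMost_iff subset_eq)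
  define r where "r = max R R' / 2"
  have r: "1 \<le> 2 * r" "0 < r" using R by (auto simp: r_def)
  have S: "measure_support (\<nu> v) \<subseteq> {..2 * r}" if "0 < v" "v \<le> 1" for v
    using R(2)[OF that] by (auto simp: r_def)
  have m\<rho>: "mass_on (2 * r) 1 \<rho>"
    by (rule equilibrium_mass_on[OF \<rho>]) (use R' in \<open>auto simp: r_def\<close>)
  obtain \<epsilon> where \<epsilon>: "(\<epsilon> \<longlongrightarrow> 0) (at_right 0)"
    "\<forall>\<^sub>F v in at_right 0. 0 \<le> \<epsilon> v \<and> \<epsilon> v \<le> \<gamma>"
    "((\<lambda>v. \<integral>z. (cdf (\<nu> v) z - cdf (combo (\<gamma> - \<epsilon> v) (swept r v) (t - \<gamma> + \<epsilon> v) \<rho>) z)\<^sup>2 \<partial>lborel) \<longlongrightarrow> 0) (at_right 0)"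
    by (rule supercritical_comparison[OF \<gamma> r(1) nu S \<rho> m\<rho>])
  let ?\<kappa> = "\<lambda>v. combo (\<gamma> - \<epsilon> v) (swept r v) (t - \<gamma> + \<epsilon> v) \<rho>"
  have ev: "\<forall>\<^sub>F v in at_right (0::real). 0 < v \<and> v < 1"
    by (auto simp: eventually_at_right_field intro: exI[of _ 1])
  have sw: "mass_on (2 * r) 1 (swept r v)" if "0 < v" for v
  proof -
    interpret sweeping r v by unfold_locales (use r that in auto)
    show ?thesis by (rule swept_mass_on)
  qed
  have mn: "\<forall>\<^sub>F v in at_right 0. mass_on (2 * r) t (\<nu> v)"
    using ev by eventually_elim (use equilibrium_mass_on[OF nu _ S] t in auto)
  have mk: "\<forall>\<^sub>F v in at_right 0. mass_on (2 * r) t (?\<kappa> v)"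
    using ev \<epsilon>(2)
  proof eventually_elim
    case (elim v)
    show ?case using mass_on_combo[OF sw m\<rho>, of v "\<gamma> - \<epsilon> v" "t - \<gamma> + \<epsilon> v"] elim \<gamma> by simp
  qed
  have "((\<lambda>v. (\<integral>x. f x \<partial>\<nu> v) - (\<integral>x. f x \<partial>?\<kappa> v)) \<longlongrightarrow> 0) (at_right 0)"
    by (rule integral_diff_tendsto_of_cdf_L2[OF _ _ mn mk \<epsilon>(3) fc]) (use r t in auto)
  moreover have "((\<lambda>v. \<integral>x. f x \<partial>?\<kappa> v) \<longlongrightarrow> \<gamma> * f 0 + (t - \<gamma>) * (\<integral>x. f x \<partial>\<rho>)) (at_right 0)"
  proof -
    have "\<forall>\<^sub>F v in at_right 0. (\<gamma> - \<epsilon> v) * (\<integral>x. f x \<partial>swept r v) + (t - \<gamma> + \<epsilon> v) * (\<integral>x. f x \<partial>\<rho>) = (\<integral>x. f x \<partial>?\<kappa> v)"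
      using ev \<epsilon>(2)
    proof eventually_elim
      case (elim v)
      show ?case
        using elim \<gamma> sw[of v]
        by (intro integral_combo(2)[symmetric] mass_on_sets[OF m\<rho>] fm mass_on_integrable_bounded[OF m\<rho> fm F]
            mass_on_sets[OF sw] mass_on_integrable_bounded[OF sw fm F]) auto
    qed
    moreover have "((\<lambda>v. (\<gamma> - \<epsilon> v) * (\<integral>x. f x \<partial>swept r v) + (t - \<gamma> + \<epsilon> v) * (\<integral>x. f x \<partial>\<rho>))
        \<longlongrightarrow> (\<gamma> - 0) * f 0 + (t - \<gamma> + 0) * (\<integral>x. f x \<partial>\<rho>)) (at_right 0)"
      by (intro tendsto_intros \<epsilon>(1) swept_integral_tendsto[OF r(2) fc F])
    ultimately show ?thesis by (simp add: filterlim_cong)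
  qed
  ultimately have "((\<lambda>v. ((\<integral>x. f x \<partial>\<nu> v) - (\<integral>x. f x \<partial>?\<kappa> v)) + (\<integral>x. f x \<partial>?\<kappa> v)) \<longlongrightarrow>
      0 + (\<gamma> * f 0 + (t - \<gamma>) * (\<integral>x. f x \<partial>\<rho>))) (at_right 0)"
    by (rule tendsto_add)
  moreover have "(\<integral>x. f x \<partial>combo \<gamma> (dirac 0) (t - \<gamma>) \<rho>) = \<gamma> * f 0 + (t - \<gamma>) * (\<integral>x. f x \<partial>\<rho>)"
  proof -
    have d: "sets (dirac 0) = sets borel" by (simp add: dirac_def)
    have i: "integrable (dirac 0) f" "(\<integral>x. f x \<partial>dirac 0) = f 0"
      unfolding dirac_def by (auto simp: integral_return intro!: finite_measure.integrable_const_bound[where B=F] prob_space.finite_measure prob_space_return F)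
    show ?thesis
      using \<gamma> i(2) by (subst integral_combo(2)[OF d mass_on_sets[OF m\<rho>] fm i(1) mass_on_integrable_bounded[OF m\<rho> fm F]]) auto
  qed
  ultimately show "((\<lambda>v. \<integral>x. f x \<partial>\<nu> v) \<longlongrightarrow> (\<integral>x. f x \<partial>combo \<gamma> (dirac 0) (t - \<gamma>) \<rho>)) (at_right 0)"
    by simp
qed

section \<open>The repulsive case: the explicit measure\<close>

text \<open>\<open>\<bar>z\<bar> - s\<close> and \<open>\<bar>z\<bar> + s\<close> are reciprocal
  since \<open>s\<^sup>2 = z\<^sup>2 - 1\<close>; the smaller one, with the sign of
  \<open>z\<close>, is the coordinate inside the unit disc.\<close>

lemma joukowski:
  assumes z: "1 < \<bar>z\<bar>"
  obtains w :: real where "z = (w + 1 / w) / 2" "0 < \<bar>w\<bar>" "\<bar>w\<bar> < 1" "0 < w \<longleftrightarrow> 0 < z"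
proof -
  define s where "s = sqrt (z\<^sup>2 - 1)"
  have "1 < \<bar>z\<bar>\<^sup>2" using z by (intro one_less_power) auto
  hence z2: "1 < z\<^sup>2" by simp
  have s: "0 < s" "s\<^sup>2 = z\<^sup>2 - 1" using z2 by (auto simp: s_def)
  have sz: "s < \<bar>z\<bar>" using s power_less_imp_less_base[of s 2 "\<bar>z\<bar>"] by simp
  have "(\<bar>z\<bar> - 1)\<^sup>2 < s\<^sup>2" unfolding s(2) using z by (simp add: power2_eq_square algebra_simps)
  hence s1: "\<bar>z\<bar> - 1 < s" using power_less_imp_less_base[of "\<bar>z\<bar> - 1" 2 s] s by simp
  define w where "w = sgn z * (\<bar>z\<bar> - s)"
  have ws: "w * (sgn z * (\<bar>z\<bar> + s)) = 1"
  proof -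
    have "w * (sgn z * (\<bar>z\<bar> + s)) = (sgn z)\<^sup>2 * (\<bar>z\<bar>\<^sup>2 - s\<^sup>2)" by (simp add: w_def power2_eq_square algebra_simps)
    also have "(sgn z)\<^sup>2 = 1" using z by (auto simp: sgn_if)
    finally show ?thesis using s(2) by simp
  qed
  have w0: "w \<noteq> 0" using ws by auto
  have inv: "1 / w = sgn z * (\<bar>z\<bar> + s)" using ws w0 by (simp add: divide_eq_eq mult.commute)
  show thesis
  proof (rule that[of w])
    have "w + 1 / w = 2 * (sgn z * \<bar>z\<bar>)" unfolding inv by (simp add: w_def algebra_simps)
    thus "z = (w + 1 / w) / 2" unfolding sgn_mult_abs by simp
    show "0 < \<bar>w\<bar>" using w0 by simp
    show "\<bar>w\<bar> < 1" using sz s1 z by (simp add: w_def abs_mult abs_sgn_eq)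
    show "0 < w \<longleftrightarrow> 0 < z" using sz z by (auto simp: w_def sgn_if split: if_splits)
  qed
qed

text \<open>Coordinates are shifted by \<open>y = x + v\<close>, so that the charge, of strength
  \<open>g = - \<gamma>\<close>, sits at 0 and the linear coefficient becomes
  \<open>B = \<beta> - v\<close>. The interval has centre \<open>m0\<close> and half-length
  \<open>R\<close>, and \<open>w = - p\<close> is the coordinate of the charge. The equation for
  \<open>S\<close> makes the angular density vanish at both endpoints; \<open>param\<close> balances
  the \<open>cos\<close> term of the potential against that of the field.\<close>

locale soft_edge =
  fixes t g B p S R Q m0 :: real
  assumes t: "0 < t" and g: "0 < g" and p: "0 < p" "p < 1"
    and S_def: "S = 2 * t - 4 * g * p\<^sup>2 / (1 - p\<^sup>2)" and S: "0 < S" and R_def: "R = sqrt S"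
    and m0_def: "m0 = R / 2 * (p + 1 / p)" and Q_def: "Q = 1 - p\<^sup>2"
    and param: "(m0 + B) * R = 2 * g * p / Q"
begin

definition ang :: "real \<Rightarrow> real" where
  "ang = arc_density (t + g) (- g * p / Q) (- S / 4) (- g) (- p)"

lemma R: "0 < R" "R\<^sup>2 = S" using S by (auto simp: R_def)

lemma Q: "0 < Q" using p by (simp add: Q_def power_less_one_iff)

lemma t_eq: "t = S / 2 + 2 * g * p\<^sup>2 / Q"
  using S_def Q unfolding Q_def[symmetric] by (simp add: field_simps)

lemma D_pos: "0 < 1 + 2 * p * cos \<theta> + p\<^sup>2" using poisson_denom_pos[of "- p" \<theta>] p by simp

text \<open>The squared sine shows that the density is nonnegative and that both edges are soft. The
  other factor equals \<open>S * (y - b) / y\<close> at \<open>y = m0 + R * cos \<theta>\<close>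
  with \<open>b = - (m0 + B)\<close>, which links it to the density in the theorem.\<close>

lemma ang_eq: "ang \<theta> = (sin \<theta>)\<^sup>2 * (S + 4 * g * p\<^sup>2 / (Q * (1 + 2 * p * cos \<theta> + p\<^sup>2)))"
proof -
  define c where "c = cos \<theta>"
  define D where "D = 1 + 2 * p * c + p\<^sup>2"
  have D: "0 < D" using D_pos[of \<theta>] by (simp add: D_def c_def)
  have s: "(sin \<theta>)\<^sup>2 = 1 - c\<^sup>2" by (simp add: c_def sin_squared_eq)
  have "ang \<theta> = t + g - 2 * g * p * c / Q - S / 2 * (2 * c\<^sup>2 - 1) - g * Q / D"
    by (simp add: ang_def arc_density_def c_def D_def Q_def[symmetric] cos_double_cos)
  also have "\<dots> = S * (1 - c\<^sup>2) + (2 * g * p\<^sup>2 / Q + g - 2 * g * p * c / Q - g * Q / D)"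
    using Q by (subst t_eq) (simp add: field_simps)
  also have "2 * g * p\<^sup>2 / Q + g - 2 * g * p * c / Q - g * Q / D = 4 * g * p\<^sup>2 * (1 - c\<^sup>2) / (Q * D)"
  proof -
    have "(2 * g * p\<^sup>2 / Q + g - 2 * g * p * c / Q - g * Q / D) * (Q * D) =
      g * ((2 * p\<^sup>2 + Q - 2 * p * c) * D - Q * Q)"
      using Q D by (simp add: field_simps)
    also have "\<dots> = 4 * g * p\<^sup>2 * (1 - c\<^sup>2)"
      unfolding D_def Q_def by algebra
    finally show ?thesis using Q D by (simp add: eq_divide_eq)
  qed
  finally show ?thesis unfolding s c_def[symmetric] D_def[symmetric] using Q D by (simp add: field_simps)
qed

lemma ang_nonneg: "0 \<le> ang \<theta>"
  unfolding ang_eq using S g p mult_pos_pos[OF Q D_pos[of \<theta>]]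
  by (intro mult_nonneg_nonneg add_nonneg_nonneg divide_nonneg_pos) auto

lemma ang_pos: "sin \<theta> \<noteq> 0 \<Longrightarrow> 0 < ang \<theta>"
  unfolding ang_eq using S g p mult_pos_pos[OF Q D_pos[of \<theta>]]
  by (intro mult_pos_pos[of "(sin \<theta>)\<^sup>2"] add_pos_nonneg divide_nonneg_pos) auto

text \<open>\<open>y = 0\<close> has coordinate \<open>w = - p\<close>, so the distance to the
  charge is the Poisson denominator up to a factor; this is why the logarithms cancel below.\<close>

lemma y_eq: "m0 + R * c = R / (2 * p) * (1 + 2 * p * c + p\<^sup>2)"
  using p by (simp add: m0_def field_simps power2_eq_square)

lemma m0_gt_R: "R < m0"
proof -
  have "0 < R / (2 * p) * (1 - p)\<^sup>2" using R p by simp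
  also have "\<dots> = m0 - R" using y_eq[of "-1"] by (simp add: power2_eq_square algebra_simps)
  finally show ?thesis by simp
qed

definition field :: "real \<Rightarrow> real" where "field y = y\<^sup>2 / 2 + B * y - g * ln y"

lemma field_deriv: "0 < y \<Longrightarrow> (field has_real_derivative (y + B - g / y)) (at y)"
  unfolding field_def[abs_def] by (auto intro!: derivative_eq_intros)

definition level :: real where
  "level = - t * ln (R / 2) + m0\<^sup>2 / 2 + S / 4 + B * m0 - g * ln (R / (2 * p))"

text \<open>The Poisson part cancels \<open>- g * ln y\<close>, the second harmonic cancels the
  quadratic term, and \<open>param\<close> cancels the first harmonic.\<close>

lemma level_on_arc:
  "(- t * ln (R / 2) + 2 * (- g * p / Q) * cos \<phi> + (- S / 4) * cos (2 * \<phi>) - (- g) * ln (1 - 2 * (- p) * cos \<phi> + (- p)\<^sup>2))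
    + field (m0 + R * cos \<phi>) = level"
proof -
  define c where "c = cos \<phi>"
  have "ln (m0 + R * c) = ln (R / (2 * p)) + ln (1 + 2 * p * c + p\<^sup>2)"
    unfolding y_eq using R p D_pos[of \<phi>] by (subst ln_mult) (auto simp: c_def)
  moreover have "(m0 + R * c)\<^sup>2 / 2 = m0\<^sup>2 / 2 + m0 * R * c + S * c\<^sup>2 / 2"
    unfolding R(2)[symmetric] by (simp add: power2_eq_square field_simps)
  moreover have "m0 * R * c + B * (R * c) = 2 * g * p / Q * c"
    unfolding param[symmetric] by (simp add: algebra_simps)
  ultimately show ?thesis
    unfolding c_def[symmetric] cos_double_cos field_def level_def
    by (simp add: algebra_simps add_divide_distrib)
qed

lemma arc_locale: "poisson_arc R (t + g) (- g * p / Q) (- S / 4) (- g) (- p)"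
proof
  show "0 \<le> arc_density (t + g) (- g * p / Q) (- S / 4) (- g) (- p) \<theta>" for \<theta>
    using ang_nonneg[of \<theta>] by (simp add: ang_def)
qed (use p R in auto)

text \<open>Potential plus field at a real point off the arc, as a function of its coordinate
  \<open>w\<close>: values in \<open>(0, 1)\<close> describe points to the right of the arc, values
  in \<open>(- 1, - p)\<close> the points between the charge and the arc.\<close>

definition outer :: "real \<Rightarrow> real" where
  "outer w = t * ln \<bar>w\<bar> - t * ln (R / 2) + 2 * (- g * p / Q) * w + (- S / 4) * w\<^sup>2 + 2 * g * ln (1 + p * w)
     + field (m0 + R / 2 * (w + 1 / w))"

lemma outer_y: "w \<noteq> 0 \<Longrightarrow> m0 + R / 2 * (w + 1 / w) = R / 2 * ((w + p) * (1 + p * w) / (p * w))"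
  using p by (simp add: m0_def field_simps power2_eq_square)

text \<open>All terms combine into a multiple of \<open>(1 - w\<^sup>2)\<^sup>2\<close>, which
  reflects the soft edges at \<open>w = 1\<close> and \<open>w = - 1\<close>; on either branch the
  sign can be read off.\<close>

lemma outer_deriv:
  assumes w: "w \<noteq> 0" "0 < 1 + p * w" "0 < (w + p) * (1 + p * w) / (p * w)"
  shows "(outer has_real_derivative
    (- (1 - w\<^sup>2)\<^sup>2 * (S / (4 * w ^ 3) + g * p\<^sup>2 / (Q * w\<^sup>2 * ((w + p) * (1 + p * w)))))) (at w)"
proof -
  let ?y = "m0 + R / 2 * (w + 1 / w)" and ?y' = "R / 2 * (1 - 1 / w\<^sup>2)"
  have y: "0 < ?y" unfolding outer_y[OF w(1)] using w(3) R(1) by (intro mult_pos_pos) simp_all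
  have wp: "w + p \<noteq> 0" using w by auto
  have absd: "((\<lambda>w. ln \<bar>w\<bar>) has_real_derivative 1 / w) (at w)"
  proof (cases "0 < w")
    case True
    have "((\<lambda>w. ln w) has_real_derivative 1 / w) (at w)" using True by (auto intro!: derivative_eq_intros simp: divide_inverse)
    thus ?thesis
      by (rule DERIV_cong_ev[OF refl _ refl, THEN iffD1, rotated])
         (use eventually_nhds_in_open[of "{0<..}" w] True in \<open>auto elim!: eventually_mono\<close>)
  next
    case False
    hence "((\<lambda>w. ln (- w)) has_real_derivative 1 / w) (at w)" using w
      by (auto intro!: derivative_eq_intros simp: divide_inverse)
    thus ?thesis
      by (rule DERIV_cong_ev[OF refl _ refl, THEN iffD1, rotated])
         (use eventually_nhds_in_open[of "{..<0}" w] False w in \<open>auto elim!: eventually_mono\<close>)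
  qed
  have dy: "((\<lambda>w. m0 + R / 2 * (w + 1 / w)) has_real_derivative ?y') (at w)"
  proof -
    have "((\<lambda>w. 1 / w) has_real_derivative - (1 / w\<^sup>2)) (at w)"
      using w(1) by (auto intro!: derivative_eq_intros simp: power2_eq_square)
    from DERIV_add[OF DERIV_const[of m0] DERIV_cmult[OF DERIV_add[OF DERIV_ident this], of "R / 2"]]
    show ?thesis by simp
  qed
  have df: "((\<lambda>w. field (m0 + R / 2 * (w + 1 / w))) has_real_derivative (?y + B) * ?y' - g * (?y' / ?y)) (at w)"
  proof -
    have eq: "(Y + B - g / Y) * Y' = (Y + B) * Y' - g * (Y' / Y)" for Y Y' :: real by (simp add: algebra_simps)
    show ?thesis using DERIV_chain2[OF field_deriv[OF y] dy] unfolding eq .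
  qed
  have d: "(outer has_real_derivative
     t * (1 / w) - 0 + 2 * (- g * p / Q) + (- S / 4) * (2 * w) + 2 * g * (p / (1 + p * w)) + ((?y + B) * ?y' - g * (?y' / ?y))) (at w)"
    unfolding outer_def[abs_def]
  proof (intro DERIV_add DERIV_diff DERIV_cmult absd df DERIV_const)
    show "((\<lambda>w. 2 * (- g * p / Q) * w) has_real_derivative 2 * (- g * p / Q)) (at w)"
      by (rule DERIV_cmult_Id)
    show "((\<lambda>w. w\<^sup>2) has_real_derivative 2 * w) (at w)" by (auto intro!: derivative_eq_intros)
    show "((\<lambda>w. ln (1 + p * w)) has_real_derivative p / (1 + p * w)) (at w)"
      using w(2) by (auto intro!: derivative_eq_intros)
  qed
  have yB: "?y + B = R / 2 * (w + 1 / w) + 2 * g * p / (Q * R)"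
    using param R(1) Q by (simp add: field_simps)
  have "(R / 2 * a + 2 * g * p / (Q * R)) * (R / 2 * b) = S / 4 * a * b + g * p / Q * b" for a b
    using R(1) Q unfolding R(2)[symmetric] by (simp add: field_simps power2_eq_square)
  hence 1: "(?y + B) * ?y' = S / 4 * (w + 1 / w) * (1 - 1 / w\<^sup>2) + g * p / Q * (1 - 1 / w\<^sup>2)"
    unfolding yB .
  have 2: "?y' / ?y = - p * (1 - w\<^sup>2) / (w * ((w + p) * (1 + p * w)))"
    unfolding outer_y[OF w(1)] using R w wp p by (simp add: divide_simps power2_eq_square) (simp add: algebra_simps)
  \<comment> \<open>The derivative is linear in \<open>S\<close> and \<open>g\<close> once
    \<open>t\<close> is eliminated by \<open>t_eq\<close>; \<open>s\<close> and \<open>gg\<close>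
    are the two rational identities for the coefficients.\<close>
  have s: "S / 2 * (1 / w) - S / 2 * w + S / 4 * (w + 1 / w) * (1 - 1 / w\<^sup>2) = - (1 - w\<^sup>2)\<^sup>2 * (S / (4 * w ^ 3))"
    using w by (simp add: field_simps power2_eq_square power3_eq_cube)
  have gg: "2 * p\<^sup>2 / Q * (1 / w) - 2 * p / Q + 2 * (p / (1 + p * w)) + p / Q * (1 - 1 / w\<^sup>2)
     + p * (1 - w\<^sup>2) / (w * ((w + p) * (1 + p * w))) = - (1 - w\<^sup>2)\<^sup>2 * (p\<^sup>2 / (Q * w\<^sup>2 * ((w + p) * (1 + p * w))))"
  proof -
    let ?E = "Q * w\<^sup>2 * ((w + p) * (1 + p * w))"
    have E: "?E \<noteq> 0" using Q w wp by auto
    have "(2 * p\<^sup>2 / Q * (1 / w) - 2 * p / Q + 2 * (p / (1 + p * w)) + p / Q * (1 - 1 / w\<^sup>2)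
     + p * (1 - w\<^sup>2) / (w * ((w + p) * (1 + p * w)))) * ?E =
      2 * p\<^sup>2 * w * ((w + p) * (1 + p * w)) - 2 * p * w\<^sup>2 * ((w + p) * (1 + p * w)) + 2 * p * Q * w\<^sup>2 * (w + p)
      + p * (w\<^sup>2 - 1) * ((w + p) * (1 + p * w)) + p * (1 - w\<^sup>2) * Q * w"
    proof -
      have "2 * p\<^sup>2 / Q * (1 / w) * ?E = 2 * p\<^sup>2 * w * ((w + p) * (1 + p * w))" using Q w by (simp add: power2_eq_square)
      moreover have "2 * p / Q * ?E = 2 * p * w\<^sup>2 * ((w + p) * (1 + p * w))" using Q by simp
      moreover have "2 * (p / (1 + p * w)) * ?E = 2 * p * Q * w\<^sup>2 * (w + p)" using w(2) by (simp add: divide_simps)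
      moreover have "p / Q * (1 - 1 / w\<^sup>2) * ?E = p * (w\<^sup>2 - 1) * ((w + p) * (1 + p * w))"
        using Q w(1) by (simp add: divide_simps)
      moreover have "p * (1 - w\<^sup>2) / (w * ((w + p) * (1 + p * w))) * ?E = p * (1 - w\<^sup>2) * Q * w"
        using w(1,2) wp by (simp add: divide_simps power2_eq_square)
      ultimately show ?thesis by (simp only: distrib_right left_diff_distrib)
    qed
    also have "\<dots> = - (1 - w\<^sup>2)\<^sup>2 * p\<^sup>2" unfolding Q_def by algebra
    finally have "2 * p\<^sup>2 / Q * (1 / w) - 2 * p / Q + 2 * (p / (1 + p * w)) + p / Q * (1 - 1 / w\<^sup>2)
      + p * (1 - w\<^sup>2) / (w * ((w + p) * (1 + p * w))) = - (1 - w\<^sup>2)\<^sup>2 * p\<^sup>2 / ?E"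
      by (rule nonzero_eq_divide_eq[OF E, THEN iffD2])
    thus ?thesis by (simp only: times_divide_eq_right)
  qed
  have "t * (1 / w) - 0 + 2 * (- g * p / Q) + (- S / 4) * (2 * w) + 2 * g * (p / (1 + p * w)) + ((?y + B) * ?y' - g * (?y' / ?y))
    = (S / 2 * (1 / w) - S / 2 * w + S / 4 * (w + 1 / w) * (1 - 1 / w\<^sup>2))
    + g * (2 * p\<^sup>2 / Q * (1 / w) - 2 * p / Q + 2 * (p / (1 + p * w)) + p / Q * (1 - 1 / w\<^sup>2)
     + p * (1 - w\<^sup>2) / (w * ((w + p) * (1 + p * w))))"
    unfolding 1 2 by (subst t_eq) (simp add: algebra_simps diff_divide_distrib add_divide_distrib)
  also have "\<dots> = - (1 - w\<^sup>2)\<^sup>2 * (S / (4 * w ^ 3) + g * p\<^sup>2 / (Q * w\<^sup>2 * ((w + p) * (1 + p * w))))"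
    unfolding s gg by (simp add: algebra_simps)
  finally show ?thesis using d by simp
qed

lemma outer_ends: "outer 1 = level" "outer (- 1) = level"
proof -
  have s: "(1 + p)\<^sup>2 = 1 + 2 * p + p\<^sup>2" "(1 - p)\<^sup>2 = 1 - 2 * p + p\<^sup>2" by (simp_all add: power2_eq_square algebra_simps)
  have l: "ln (1 + 2 * p + p\<^sup>2) = 2 * ln (1 + p)" "ln (1 - 2 * p + p\<^sup>2) = 2 * ln (1 - p)"
    unfolding s[symmetric] using p by (simp_all add: ln_realpow)
  show "outer 1 = level" using level_on_arc[of 0] l by (simp add: outer_def algebra_simps)
  show "outer (- 1) = level" using level_on_arc[of pi] l by (simp add: outer_def algebra_simps)
qed

text \<open>The derivative is nonpositive on the right branch and nonnegative on the left one, so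
  both branches attain their minimum at the edge, where \<open>outer_ends\<close> gives
  \<open>level\<close>.\<close>

lemma outer_ge_level:
  assumes w: "(0 < w \<and> w \<le> 1) \<or> (- 1 \<le> w \<and> w < - p)"
  shows "level \<le> outer w"
  using w
proof
  assume w: "0 < w \<and> w \<le> 1"
  have "outer 1 \<le> outer w"
  proof (rule DERIV_nonpos_imp_nonincreasing[of w 1 outer])
    fix x assume x: "w \<le> x" "x \<le> 1"
    have x0: "0 < x" "0 < 1 + p * x" using x w p by (auto intro!: add_pos_pos mult_pos_pos)
    have e: "0 < (x + p) * (1 + p * x)" using x0 p by (intro mult_pos_pos) auto
    have "0 \<le> S / (4 * x ^ 3) + g * p\<^sup>2 / (Q * x\<^sup>2 * ((x + p) * (1 + p * x)))"
    proof (intro add_nonneg_nonneg divide_nonneg_pos)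
      show "0 < Q * x\<^sup>2 * ((x + p) * (1 + p * x))" using Q x0 by (intro mult_pos_pos[OF _ e]) auto
    qed (use S g x0 in auto)
    hence "- (1 - x\<^sup>2)\<^sup>2 * (S / (4 * x ^ 3) + g * p\<^sup>2 / (Q * x\<^sup>2 * ((x + p) * (1 + p * x)))) \<le> 0"
      by (intro mult_nonpos_nonneg) auto
    thus "\<exists>y. (outer has_real_derivative y) (at x) \<and> y \<le> 0"
      using outer_deriv[of x] x0 e p by auto
  qed (use w in auto)
  thus ?thesis by (simp add: outer_ends)
next
  assume w: "- 1 \<le> w \<and> w < - p"
  have "outer (- 1) \<le> outer w"
  proof (rule DERIV_nonneg_imp_nondecreasing[of "- 1" w outer])
    fix x assume x: "- 1 \<le> x" "x \<le> w"
    have "p * (- 1) \<le> p * x" using x p by (intro mult_left_mono) auto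
    hence x0: "x < 0" "0 < 1 + p * x" using x w p by auto
    have e: "(x + p) * (1 + p * x) < 0" using x0 x w by (intro mult_neg_pos) auto
    have "x ^ 3 < 0" using x0 by (simp add: power_less_zero_eq)
    hence "S / (4 * x ^ 3) \<le> 0" using S by (intro divide_nonneg_nonpos) auto
    moreover have "g * p\<^sup>2 / (Q * x\<^sup>2 * ((x + p) * (1 + p * x))) \<le> 0"
    proof (rule divide_nonneg_nonpos)
      show "Q * x\<^sup>2 * ((x + p) * (1 + p * x)) \<le> 0" by (rule mult_nonneg_nonpos) (use Q e in auto)
    qed (use g in simp)
    ultimately have "0 \<le> - (1 - x\<^sup>2)\<^sup>2 * (S / (4 * x ^ 3) + g * p\<^sup>2 / (Q * x\<^sup>2 * ((x + p) * (1 + p * x))))"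
      by (intro mult_nonpos_nonpos) auto
    moreover have "0 < (x + p) * (1 + p * x) / (p * x)" by (rule divide_neg_neg[OF e]) (use p x0 in \<open>simp add: mult_pos_neg\<close>)
    ultimately show "\<exists>y. (outer has_real_derivative y) (at x) \<and> 0 \<le> y"
      using outer_deriv[of x] x0 by blast
  qed (use w in auto)
  thus ?thesis by (simp add: outer_ends)
qed

definition N :: "real \<Rightarrow> real measure" where "N v = arc_measure (m0 - v) R ang"

lemma N_potential_on:
  assumes x: "x \<in> {m0 - v - R..m0 - v + R}"
  shows "log_potential (N v) x = ereal (level - field (x + v))"
proof -
  interpret poisson_arc "m0 - v" R "t + g" "- g * p / Q" "- S / 4" "- g" "- p" by (rule arc_locale)
  obtain \<phi> where \<phi>: "x = m0 - v + R * cos \<phi>"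
    "log_potential \<mu> x = ereal (- (t + g + - g) * ln (R / 2) + 2 * (- g * p / Q) * cos \<phi> + (- S / 4) * cos (2 * \<phi>)
      - (- g) * ln (1 - 2 * (- p) * cos \<phi> + (- p)\<^sup>2))"
    by (rule potential_on_arc[OF x])
  have "log_potential (N v) x = ereal (- t * ln (R / 2) + 2 * (- g * p / Q) * cos \<phi> + (- S / 4) * cos (2 * \<phi>)
      - (- g) * ln (1 - 2 * (- p) * cos \<phi> + (- p)\<^sup>2))"
    using \<phi>(2) by (simp add: N_def ang_def)
  moreover have "x + v = m0 + R * cos \<phi>" using \<phi>(1) by simp
  ultimately show ?thesis using level_on_arc[of \<phi>] by (simp add: eq_diff_eq)
qed

text \<open>The inequality reaches every point to the right of the charge; for \<open>v > 0\<close>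
  this includes the half-line \<open>{0..}\<close>.\<close>

lemma N_potential_ge:
  assumes x: "0 < x + v"
  shows "ereal (level - field (x + v)) \<le> log_potential (N v) x"
proof (cases "x \<in> {m0 - v - R..m0 - v + R}")
  case True
  thus ?thesis by (simp add: N_potential_on)
next
  case False
  interpret poisson_arc "m0 - v" R "t + g" "- g * p / Q" "- S / 4" "- g" "- p" by (rule arc_locale)
  define z where "z = (x + v - m0) / R"
  have xz: "x + v = m0 + R * z" using R by (simp add: z_def)
  have "1 < \<bar>z\<bar>"
  proof (rule ccontr)
    assume "\<not> 1 < \<bar>z\<bar>"
    hence "\<bar>R * z\<bar> \<le> R" using R by (simp add: abs_mult mult_left_le)
    thus False using False xz by auto
  qed
  then obtain w where w: "z = (w + 1 / w) / 2" "0 < \<bar>w\<bar>" "\<bar>w\<bar> < 1" "0 < w \<longleftrightarrow> 0 < z" by (rule joukowski)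
  have xw: "x + v = m0 + R / 2 * (w + 1 / w)" using xz w(1) by simp
  have "\<bar>p * w\<bar> < 1 * 1" unfolding abs_mult using w p by (intro mult_strict_mono) auto
  hence pw: "0 < 1 + p * w" by linarith
  \<comment> \<open>Positivity of \<open>x + v\<close> restricts negative \<open>w\<close> to values
    below \<open>- p\<close>, the coordinate of the charge.\<close>
  have wcase: "(0 < w \<and> w \<le> 1) \<or> (- 1 \<le> w \<and> w < - p)"
  proof (cases "0 < w")
    case False
    hence wn: "w < 0" using w by auto
    have "0 < (w + p) * (1 + p * w) / (p * w)"
    proof -
      have w0: "w \<noteq> 0" using wn by simp
      have "0 < R / 2 * ((w + p) * (1 + p * w) / (p * w))"
        unfolding outer_y[OF w0, symmetric] xw[symmetric] by (rule x)
      thus ?thesis by (rule zero_less_mult_pos) (use R in simp)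
    qed
    moreover have "p * w < 0" using wn p by (simp add: mult_pos_neg)
    ultimately have "(w + p) * (1 + p * w) < 0" by (simp add: zero_less_divide_iff)
    hence "w + p < 0" using pw by (simp add: mult_less_0_iff)
    thus ?thesis using w wn by auto
  qed (use w in auto)
  have "complex_of_real x = complex_of_real (m0 - v) + complex_of_real (R / 2) * (complex_of_real w + 1 / complex_of_real w)"
  proof -
    have "x = (m0 - v) + R / 2 * (w + 1 / w)" using xw by simp
    hence "complex_of_real x = complex_of_real ((m0 - v) + R / 2 * (w + 1 / w))" by (rule arg_cong)
    thus ?thesis by simp
  qed
  hence "log_potential \<mu> x = ereal (- (t + g + - g) * (ln (R / 2) - ln (cmod (complex_of_real w)))
     + 2 * (- g * p / Q) * Re (complex_of_real w) + (- S / 4) * Re (complex_of_real w ^ 2)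
     - 2 * (- g) * ln (cmod (1 - complex_of_real w * complex_of_real (- p))))"
    using w by (intro potential) auto
  also have "1 - complex_of_real w * complex_of_real (- p) = complex_of_real (1 + p * w)" by simp
  finally have pot: "log_potential \<mu> x = ereal (- (t + g + - g) * (ln (R / 2) - ln \<bar>w\<bar>)
     + 2 * (- g * p / Q) * w + (- S / 4) * w\<^sup>2 - 2 * (- g) * ln \<bar>1 + p * w\<bar>)"
    unfolding norm_of_real of_real_power[symmetric] Re_complex_of_real .
  have "outer w - field (x + v) = - (t + g + - g) * (ln (R / 2) - ln \<bar>w\<bar>)
     + 2 * (- g * p / Q) * w + (- S / 4) * w\<^sup>2 - 2 * (- g) * ln \<bar>1 + p * w\<bar>"
    unfolding outer_def xw[symmetric] using pw by (simp add: algebra_simps)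
  with pot have "log_potential (N v) x = ereal (outer w - field (x + v))" by (simp only: N_def ang_def)
  thus ?thesis using outer_ge_level[OF wcase] by simp
qed

lemma N_mass_on:
  assumes "0 \<le> m0 - v - R" "m0 - v + R \<le> L"
  shows "mass_on L t (N v)"
proof -
  interpret poisson_arc "m0 - v" R "t + g" "- g * p / Q" "- S / 4" "- g" "- p" by (rule arc_locale)
  show ?thesis using mass_on[OF assms] by (simp add: N_def ang_def)
qed

lemma N_AE: "AE x in N v. x \<in> {m0 - v - R..m0 - v + R}"
proof -
  interpret poisson_arc "m0 - v" R "t + g" "- g * p / Q" "- S / 4" "- g" "- p" by (rule arc_locale)
  have "AE x in \<mu>. x \<in> {m0 - v - R..m0 - v + R}"
    by (rule arc_AE[OF AE_I2]) (use arc_bounds in auto)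
  thus ?thesis unfolding N_def ang_def .
qed

text \<open>Stability with zero errors: \<open>N v\<close> satisfies the equilibrium conditions
  exactly, and both measures have the same mass. The assumption \<open>edge\<close> places the arc
  inside the half-line.\<close>

lemma equilibrium_eq_N:
  assumes v: "0 < v" and edge: "0 \<le> m0 - v - R" and \<beta>: "B = \<beta> - v"
    and e: "equilibrium_measure {0..} (\<lambda>x. x\<^sup>2 / 2 + \<beta> * x + (- g) * ln (x + v)) t \<nu>"
  shows "\<nu> = N v"
proof -
  let ?\<phi> = "\<lambda>x. x\<^sup>2 / 2 + \<beta> * x + (- g) * ln (x + v)"
  have "bounded (measure_support \<nu>)" using e by (simp add: equilibrium_measure_def compact_imp_bounded)
  then obtain L' where L': "measure_support \<nu> \<subseteq> {..L'}"
    by (metis bounded_subset_cbox_symmetric box_real(2) atMost_iff atLeastAtMost_iff subset_eq)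
  define L where "L = max L' (m0 - v + R)"
  have L: "0 < L" "m0 - v + R \<le> L" "measure_support \<nu> \<subseteq> {..L}" using L' edge R by (auto simp: L_def)
  have m: "mass_on L t \<nu>" by (rule equilibrium_mass_on[OF e _ L(3)]) (use t in simp)
  have k: "mass_on L t (N v)" by (rule N_mass_on[OF edge L(2)])
  interpret sweeping 1 v by unfold_locales (use v in auto)
  have i\<phi>: "integrable M ?\<phi>" if M: "mass_on L t M" for M
  proof -
    have "integrable M (\<lambda>x. x\<^sup>2 / 2 + \<beta> * x)"
    proof (rule mass_on_integrable_bounded[OF M])
      fix x assume "x \<in> {0..L}"
      from bounded_quadratic_plus[OF this, of \<beta>]
      show "\<bar>x\<^sup>2 / 2 + \<beta> * x\<bar> \<le> (L / 2 + \<bar>\<beta>\<bar>) * L" by linarith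
    qed measurable
    thus ?thesis using ln_shift_integrable[OF M] by simp
  qed
  define C' where "C' = level + v\<^sup>2 / 2 - \<beta> * v"
  have f': "level - field (x + v) = C' - ?\<phi> x" for x
    unfolding field_def C'_def unfolding \<beta> by (simp add: power2_eq_square algebra_simps add_divide_distrib)
  obtain c where c: "\<And>x. x \<in> measure_support \<nu> \<Longrightarrow> log_potential \<nu> x = ereal (c - ?\<phi> x)"
    "\<And>x. x \<in> {0..} \<Longrightarrow> ereal (c - ?\<phi> x) \<le> log_potential \<nu> x"
    using equilibrium_potential[OF e] by blast
  have kpot: "AE x in N v. log_potential (N v) x \<le> ereal (C' - ?\<phi> x)"
    using N_AE by eventually_elim (simp add: N_potential_on f')
  interpret kf: finite_measure "N v" by (rule mass_on_finite[OF k])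
  have ik: "integrable (N v) (\<lambda>x. C' - ?\<phi> x)" using i\<phi>[OF k] by simp
  note kk = menergy_le[OF k k L(1) ik kpot]
  have "(\<integral>z. (cdf \<nu> z - cdf (N v) z)\<^sup>2 \<partial>lborel) \<le> L * (0 * t + 0) / 2"
  proof (rule equilibrium_stability[OF m k L(1) i\<phi>[OF m] i\<phi>[OF k] _ _ _ kk(1)])
    show "AE x in \<nu>. log_potential \<nu> x = ereal (c - ?\<phi> x)"
      using AE_measure_support[OF mass_on_sets[OF m]] by eventually_elim (rule c(1))
    show "AE x in N v. ereal (c - ?\<phi> x) \<le> log_potential \<nu> x"
      using mass_on_AE[OF k] by eventually_elim (rule c(2), auto)
    show "AE x in \<nu>. ereal (C' - 0 - ?\<phi> x) \<le> log_potential (N v) x"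
      using mass_on_AE[OF m]
    proof eventually_elim
      case (elim x)
      thus ?case using N_potential_ge[of x v] v by (simp add: f')
    qed
    show "menergy L (N v) (N v) \<le> C' * t + 0 - (\<integral>x. ?\<phi> x \<partial>N v)"
      using kk(2) i\<phi>[OF k] mass_on_measure[OF k] mass_on_space[OF k] by (simp add: mult.commute)
  qed
  thus ?thesis by (intro cdf_L2_zero_imp_eq[OF m k L(1)]) simp
qed

end

section \<open>Dependence on the parameter\<close>

text \<open>The Taylor series of \<open>g\<close> has the real parts of the coefficients of
  \<open>G\<close>; on the real axis the power \<open>h ^ n\<close> is real, so taking real parts
  commutes with summation and the radius does not shrink.\<close>

lemma real_analytic_at_of_complex:
  assumes G: "G analytic_on {complex_of_real v}"
    and eq: "\<forall>\<^sub>F w in nhds v. g w = Re (G (of_real w))"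
  shows "real_analytic_at g v"
proof -
  obtain F where F: "(\<lambda>h. G (of_real v + h)) has_fps_expansion F"
    using analytic_at_imp_has_fps_expansion[OF G] by blast
  define F' where "F' = Abs_fps (\<lambda>n. Re (fps_nth F n))"
  have pos: "0 < fps_conv_radius F" using F by (simp add: has_fps_expansion_def)
  have sm: "(\<lambda>n. fps_nth F' n * h ^ n) sums Re (eval_fps F (of_real h))" if "ereal \<bar>h\<bar> < fps_conv_radius F" for h
  proof -
    have "(\<lambda>n. fps_nth F n * of_real h ^ n) sums eval_fps F (of_real h)"
      by (rule sums_eval_fps) (use that in simp)
    hence "(\<lambda>n. Re (fps_nth F n * of_real h ^ n)) sums Re (eval_fps F (of_real h))" by (rule sums_Re)
    thus ?thesis by (simp add: F'_def flip: of_real_power)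
  qed
  have ev: "eval_fps F' h = Re (eval_fps F (of_real h))" if "ereal \<bar>h\<bar> < fps_conv_radius F" for h
    using sm[OF that] by (simp add: eval_fps_def sums_iff)
  have rad: "fps_conv_radius F \<le> fps_conv_radius F'"
    unfolding fps_conv_radius_def[of F']
  proof (rule conv_radius_geI_ex')
    fix r :: real assume "0 < r" "ereal r < fps_conv_radius F"
    thus "summable (\<lambda>n. fps_nth F' n * of_real r ^ n)" using sm[of r] by (auto simp: sums_iff)
  qed
  obtain r where r: "0 < r" "ereal r < fps_conv_radius F" using pos by (metis ereal_dense2 ereal_less(2))
  have e1: "\<forall>\<^sub>F h in nhds (0::real). \<bar>h\<bar> < r"
    using eventually_nhds_in_open[of "{-r<..<r}" 0] r(1) by (auto elim!: eventually_mono)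
  have "\<forall>\<^sub>F h in nhds 0. eval_fps F h = G (of_real v + h)" using F by (simp add: has_fps_expansion_def)
  moreover have c1: "((\<lambda>h. complex_of_real h) \<longlongrightarrow> 0) (nhds 0)"
    using tendsto_of_real[of "\<lambda>h. h" 0 "nhds (0::real)", where 'a=complex] filterlim_ident by fastforce
  ultimately have e2: "\<forall>\<^sub>F h in nhds (0::real). eval_fps F (of_real h) = G (of_real v + of_real h)"
    by (rule eventually_compose_filterlim)
  have "((\<lambda>h. v + h) \<longlongrightarrow> v + 0) (nhds 0)" by (intro tendsto_intros filterlim_ident)
  hence vh: "((\<lambda>h. v + h) \<longlongrightarrow> v) (nhds 0)" by simp
  have e3: "\<forall>\<^sub>F h in nhds 0. g (v + h) = Re (G (of_real (v + h)))"
    by (rule eventually_compose_filterlim[OF eq vh])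
  have "\<forall>\<^sub>F h in nhds 0. eval_fps F' h = g (v + h)"
    using e1 e2 e3
  proof eventually_elim
    case (elim h)
    have "ereal \<bar>h\<bar> < fps_conv_radius F" using elim(1) r(2) by (metis ereal_less_eq(3) less_imp_le order_le_less_trans)
    thus ?case using ev elim by simp
  qed
  moreover have "0 < fps_conv_radius F'" using pos rad by simp
  ultimately show ?thesis unfolding real_analytic_at_def has_fps_expansion_def by blast
qed

lemma real_analytic_at_complexify:
  assumes "real_analytic_at f x"
  obtains F :: "complex fps" and \<rho> :: real where "0 < \<rho>" "ereal \<rho> \<le> fps_conv_radius F"
    "\<And>h. \<bar>h\<bar> < \<rho> \<Longrightarrow> f (x + h) = Re (eval_fps F (of_real h))"
proof -
  obtain F0 where F0: "(\<lambda>h. f (x + h)) has_fps_expansion F0" using assms by (auto simp: real_analytic_at_def)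
  define F where "F = Abs_fps (\<lambda>n. complex_of_real (fps_nth F0 n))"
  have rad: "fps_conv_radius F = fps_conv_radius F0"
    by (simp add: fps_conv_radius_def conv_radius_def F_def)
  have pos: "0 < fps_conv_radius F0" using F0 by (simp add: has_fps_expansion_def)
  obtain r where r: "0 < r" "ereal r < fps_conv_radius F0" using pos by (metis ereal_dense2 ereal_less(2))
  have "\<forall>\<^sub>F h in nhds 0. eval_fps F0 h = f (x + h)" using F0 by (simp add: has_fps_expansion_def)
  then obtain d where d: "0 < d" "\<And>h. \<bar>h\<bar> < d \<Longrightarrow> eval_fps F0 h = f (x + h)"
    by (auto simp: eventually_nhds_metric dist_real_def)
  show thesis
  proof (rule that[of "min r d" F])
    fix h assume h: "\<bar>h\<bar> < min r d"
    have hr: "ereal \<bar>h\<bar> < fps_conv_radius F" using h r(2) rad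
      by (metis ereal_less_eq(3) less_imp_le min.strict_boundedE order_le_less_trans)
    have "(\<lambda>n. fps_nth F n * of_real h ^ n) sums eval_fps F (of_real h)"
      by (rule sums_eval_fps) (use hr in simp)
    hence "(\<lambda>n. Re (fps_nth F n * of_real h ^ n)) sums Re (eval_fps F (of_real h))" by (rule sums_Re)
    hence "(\<lambda>n. fps_nth F0 n * h ^ n) sums Re (eval_fps F (of_real h))"
      by (simp add: F_def flip: of_real_power)
    thus "f (x + h) = Re (eval_fps F (of_real h))" using d(2)[of h] h by (simp add: eval_fps_def sums_iff)
  next
    show "ereal (min r d) \<le> fps_conv_radius F"
      by (rule order_trans[of _ "ereal r"]) (use r rad in auto)
  qed (use r d in auto)
qed

section \<open>The parameter p as a function of v\<close>

locale soft_family =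
  fixes t g \<beta> :: real
  assumes t: "0 < t" and g: "0 < g"
begin

definition Sf :: "real \<Rightarrow> real" where "Sf p = 2 * t - 4 * g * p\<^sup>2 / (1 - p\<^sup>2)"
definition Rf :: "real \<Rightarrow> real" where "Rf p = sqrt (Sf p)"
definition dom :: "real set" where "dom = {p. 0 < p \<and> p < 1 \<and> 0 < Sf p}"
text \<open>\<open>bf p\<close> is \<open>m0 + B\<close> in the notation of
  \<open>soft_edge\<close>; at \<open>v = 0\<close> its negative turns out to be the root
  \<open>b1\<close> of the quartic equation.\<close>

definition bf :: "real \<Rightarrow> real" where "bf p = 2 * g * p / ((1 - p\<^sup>2) * Rf p)"
text \<open>The equation \<open>param\<close> solved for the linear coefficient \<open>B\<close>;
  the parameter is found by inverting this function.\<close>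

definition \<Phi> :: "real \<Rightarrow> real" where "\<Phi> p = bf p - Rf p / 2 * (p + 1 / p)"

lemma one_minus_sq: "0 < p \<Longrightarrow> p < 1 \<Longrightarrow> 0 < 1 - p\<^sup>2" for p :: real
  by (simp add: power_less_one_iff)

lemma Sf_decreasing: "0 \<le> p \<Longrightarrow> p < p' \<Longrightarrow> p' < 1 \<Longrightarrow> Sf p' < Sf p"
proof -
  assume p: "0 \<le> p" "p < p'" "p' < 1"
  have sq: "p\<^sup>2 < p'\<^sup>2" using p by (intro power_strict_mono) auto
  have 1: "0 < 1 - p'\<^sup>2" using p one_minus_sq[of p'] by simp
  have "p\<^sup>2 / (1 - p\<^sup>2) < p'\<^sup>2 / (1 - p'\<^sup>2)" using sq 1 by (intro frac_less) auto
  hence "4 * g * (p\<^sup>2 / (1 - p\<^sup>2)) < 4 * g * (p'\<^sup>2 / (1 - p'\<^sup>2))" using g by (intro mult_strict_left_mono) auto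
  thus ?thesis by (simp add: Sf_def)
qed

lemma dom_down: "p' \<in> dom \<Longrightarrow> 0 < p \<Longrightarrow> p \<le> p' \<Longrightarrow> p \<in> dom"
  using Sf_decreasing[of p p'] by (cases "p = p'") (auto simp: dom_def)

lemma domD: "p \<in> dom \<Longrightarrow> 0 < p" "p \<in> dom \<Longrightarrow> p < 1" "p \<in> dom \<Longrightarrow> 0 < Sf p" "p \<in> dom \<Longrightarrow> 0 < Rf p"
  "p \<in> dom \<Longrightarrow> 0 < 1 - p\<^sup>2"
  using one_minus_sq[of p] by (auto simp: dom_def Rf_def)

lemma Rf_deriv:
  assumes p: "p \<in> dom"
  shows "(Rf has_real_derivative - (4 * g * p / ((1 - p\<^sup>2)\<^sup>2 * Rf p))) (at p)"
proof -
  note d = domD[OF p]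
  have "(Sf has_real_derivative - (8 * g * p / (1 - p\<^sup>2)\<^sup>2)) (at p)"
  proof -
    have "((\<lambda>p. p\<^sup>2 / (1 - p\<^sup>2)) has_real_derivative ((2 * p) * (1 - p\<^sup>2) - p\<^sup>2 * (- (2 * p))) / ((1 - p\<^sup>2) * (1 - p\<^sup>2))) (at p)"
      by (rule DERIV_divide) (use d in \<open>auto intro!: derivative_eq_intros\<close>)
    from DERIV_diff[OF DERIV_const[of "2 * t"] DERIV_cmult[OF this, of "4 * g"]]
    have "((\<lambda>p. 2 * t - 4 * g * (p\<^sup>2 / (1 - p\<^sup>2))) has_real_derivative
       0 - 4 * g * (((2 * p) * (1 - p\<^sup>2) - p\<^sup>2 * (- (2 * p))) / ((1 - p\<^sup>2) * (1 - p\<^sup>2)))) (at p)" .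
    moreover have "(2 * p) * (1 - p\<^sup>2) - p\<^sup>2 * (- (2 * p)) = 2 * p" by (simp add: algebra_simps)
    ultimately show ?thesis unfolding Sf_def[abs_def] by (simp add: power2_eq_square mult.assoc)
  qed
  from DERIV_chain2[OF DERIV_real_sqrt[OF d(3)] this]
  show ?thesis unfolding Rf_def[abs_def] using d by (simp add: field_simps)
qed

definition \<Phi>' :: "real \<Rightarrow> real" where
  "\<Phi>' p = (let R = Rf p; R' = - (4 * g * p / ((1 - p\<^sup>2)\<^sup>2 * Rf p)) in
     2 * g * ((1 * ((1 - p\<^sup>2) * R) - p * (- (2 * p) * R + R' * (1 - p\<^sup>2))) / (((1 - p\<^sup>2) * R) * ((1 - p\<^sup>2) * R)))
     - (R' / 2 * (p + 1 / p) + (1 + - (1 / p\<^sup>2)) * (R / 2)))"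

text \<open>As \<open>p\<close> grows, \<open>R\<close> decreases. Hence \<open>bf\<close>, with
  \<open>R\<close> in the denominator, increases, and the product of \<open>R / 2\<close> and
  \<open>p + 1 / p\<close> decreases because both factors do on \<open>(0, 1)\<close>.\<close>

lemma \<Phi>_deriv:
  assumes p: "p \<in> dom"
  shows "(\<Phi> has_real_derivative \<Phi>' p) (at p)" "0 < \<Phi>' p"
proof -
  note d = domD[OF p] and dR = Rf_deriv[OF p]
  define R where "R = Rf p"
  define R' where "R' = - (4 * g * p / ((1 - p\<^sup>2)\<^sup>2 * Rf p))"
  have R: "0 < R" using d by (simp add: R_def)
  have R'neg: "R' < 0" using d g by (simp add: R'_def)
  note dR' = dR[folded R'_def]
  have d1: "((\<lambda>p. 1 - p\<^sup>2) has_real_derivative - (2 * p)) (at p)" by (auto intro!: derivative_eq_intros)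
  have d2: "((\<lambda>p. (1 - p\<^sup>2) * Rf p) has_real_derivative - (2 * p) * R + R' * (1 - p\<^sup>2)) (at p)"
    unfolding R_def by (rule DERIV_mult[OF d1 dR'])
  have ne: "(1 - p\<^sup>2) * Rf p \<noteq> 0" using d by auto
  have d3: "(bf has_real_derivative
    2 * g * ((1 * ((1 - p\<^sup>2) * R) - p * (- (2 * p) * R + R' * (1 - p\<^sup>2))) / (((1 - p\<^sup>2) * R) * ((1 - p\<^sup>2) * R)))) (at p)"
  proof -
    have "bf = (\<lambda>p. 2 * g * (p / ((1 - p\<^sup>2) * Rf p)))" by (simp add: bf_def fun_eq_iff)
    thus ?thesis using DERIV_cmult[OF DERIV_divide[OF DERIV_ident d2 ne], of "2 * g"] by (simp only: R_def)
  qed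
  have inv: "((\<lambda>p. 1 / p) has_real_derivative - (1 / p\<^sup>2)) (at p)"
    using d(1) by (auto intro!: derivative_eq_intros simp: power2_eq_square)
  have d4: "((\<lambda>p. Rf p / 2 * (p + 1 / p)) has_real_derivative R' / 2 * (p + 1 / p) + (1 + - (1 / p\<^sup>2)) * (R / 2)) (at p)"
    unfolding R_def by (rule DERIV_mult[OF DERIV_cdivide[OF dR'] DERIV_add[OF DERIV_ident inv]])
  show "(\<Phi> has_real_derivative \<Phi>' p) (at p)"
    using DERIV_diff[OF d3 d4] unfolding \<Phi>_def[abs_def] \<Phi>'_def Let_def R'_def R_def .
  have n1: "1 * ((1 - p\<^sup>2) * R) - p * (- (2 * p) * R + R' * (1 - p\<^sup>2)) = (1 + p\<^sup>2) * R + p * (1 - p\<^sup>2) * (- R')"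
    by (simp add: power2_eq_square algebra_simps)
  have "0 < (1 + p\<^sup>2) * R + p * (1 - p\<^sup>2) * (- R')"
    using R R'neg d by (intro add_pos_pos mult_pos_pos) (auto simp: add_pos_nonneg)
  hence p1: "0 < 2 * g * (((1 + p\<^sup>2) * R + p * (1 - p\<^sup>2) * (- R')) / (((1 - p\<^sup>2) * R) * ((1 - p\<^sup>2) * R)))"
    using g R d by (intro mult_pos_pos divide_pos_pos) auto
  have "R' / 2 * (p + 1 / p) < 0" using R'neg d by (intro mult_neg_pos add_pos_pos) auto
  moreover have "(1 + - (1 / p\<^sup>2)) * (R / 2) < 0"
    using d R by (intro mult_neg_pos) (auto simp: field_simps power_less_one_iff)
  moreover have "\<Phi>' p = 2 * g * ((1 * ((1 - p\<^sup>2) * R) - p * (- (2 * p) * R + R' * (1 - p\<^sup>2))) / (((1 - p\<^sup>2) * R) * ((1 - p\<^sup>2) * R)))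
     - (R' / 2 * (p + 1 / p) + (1 + - (1 / p\<^sup>2)) * (R / 2))"
    unfolding \<Phi>'_def Let_def R'_def R_def ..
  ultimately show "0 < \<Phi>' p" using p1 unfolding n1 by linarith
qed

lemma \<Phi>_mono:
  assumes "p \<in> dom" "p' \<in> dom" "p < p'" shows "\<Phi> p < \<Phi> p'"
proof (rule DERIV_pos_imp_increasing[OF assms(3)])
  fix x assume "p \<le> x" "x \<le> p'"
  hence "x \<in> dom" using dom_down[OF assms(2)] domD(1)[OF assms(1)] by auto
  thus "\<exists>y. (\<Phi> has_real_derivative y) (at x) \<and> 0 < y" using \<Phi>_deriv by blast
qed

lemma \<Phi>_less_iff: "p \<in> dom \<Longrightarrow> p' \<in> dom \<Longrightarrow> \<Phi> p < \<Phi> p' \<longleftrightarrow> p < p'"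
  using \<Phi>_mono by (metis less_asym linorder_neqE_linordered_idom order_less_irrefl)

text \<open>\<open>p * Rf p * (\<Phi> p - B)\<close> extends continuously to the endpoints of
  \<open>dom\<close>, near which \<Phi> itself is unbounded, and takes the values \<open>- t\<close>
  and \<open>t\<close> there; the intermediate value theorem applies to it. The right endpoint
  \<open>pm\<close> is the zero of \<open>Sf\<close>.\<close>

lemma \<Phi>_surj: "\<exists>p\<in>dom. \<Phi> p = B"
proof -
  define pm where "pm = sqrt (t / (t + 2 * g))"
  have pm2: "pm\<^sup>2 = t / (t + 2 * g)" using t g by (simp add: pm_def)
  have pm: "0 < pm" "pm < 1" using t g by (auto simp: pm_def)
  have S0: "Sf pm = 0"
  proof -
    have e1: "1 - pm\<^sup>2 = 2 * g / (t + 2 * g)" unfolding pm2 using t g by (simp add: field_simps)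
    have "pm\<^sup>2 / (1 - pm\<^sup>2) = (t / (t + 2 * g)) / (2 * g / (t + 2 * g))" by (subst e1) (simp only: pm2)
    also have "\<dots> = t / (2 * g)" using t g by simp
    finally have "4 * g * (pm\<^sup>2 / (1 - pm\<^sup>2)) = 2 * t" using g by simp
    thus ?thesis by (simp add: Sf_def)
  qed
  let ?\<Theta> = "\<lambda>p. 2 * g * p\<^sup>2 / (1 - p\<^sup>2) - Sf p / 2 * (p\<^sup>2 + 1) - B * p * sqrt (Sf p)"
  have sq: "1 - p\<^sup>2 \<noteq> 0" if "p \<in> {0..pm}" for p
  proof -
    have "p\<^sup>2 \<le> pm\<^sup>2" using that by (intro power_mono) auto
    also have "\<dots> < 1" using pm by (simp add: power_less_one_iff)
    finally show ?thesis by simp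
  qed
  have c: "continuous_on {0..pm} ?\<Theta>"
    unfolding Sf_def by (intro continuous_intros) (use sq in auto)
  have "?\<Theta> 0 \<le> 0" using t by (simp add: Sf_def)
  moreover have th: "?\<Theta> pm = t"
  proof -
    have "4 * g * pm\<^sup>2 / (1 - pm\<^sup>2) = 2 * t" using S0 by (simp add: Sf_def)
    moreover have "4 * g * pm\<^sup>2 / (1 - pm\<^sup>2) = 2 * (2 * g * pm\<^sup>2 / (1 - pm\<^sup>2))" by simp
    ultimately have "2 * g * pm\<^sup>2 / (1 - pm\<^sup>2) = t" by linarith
    thus ?thesis by (simp add: S0)
  qed
  ultimately obtain p where p: "0 \<le> p" "p \<le> pm" "?\<Theta> p = 0"
    using IVT'[of ?\<Theta> 0 0 pm] c t pm by (auto simp: th)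
  have "p \<noteq> 0" using p(3) t by (auto simp: Sf_def)
  moreover have "p \<noteq> pm" using p(3) th t by auto
  ultimately have pp: "0 < p" "p < pm" using p by auto
  have pd: "p \<in> dom" using Sf_decreasing[of p pm] pp pm S0 by (simp add: dom_def)
  note d = domD[OF pd]
  have R2: "Sf p = Rf p * Rf p" using d by (simp add: Rf_def)
  have "(\<Phi> p - B) * (p * Rf p) = ?\<Theta> p"
  proof -
    have "bf p * (p * Rf p) = 2 * g * p\<^sup>2 / (1 - p\<^sup>2)" using d by (simp add: bf_def power2_eq_square)
    moreover have "Rf p / 2 * (p + 1 / p) * (p * Rf p) = Sf p / 2 * (p\<^sup>2 + 1)"
      unfolding R2 using d by (simp add: field_simps power2_eq_square)
    moreover have "B * (p * Rf p) = B * p * sqrt (Sf p)" by (simp add: Rf_def)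
    ultimately show ?thesis unfolding \<Phi>_def by (simp only: left_diff_distrib)
  qed
  hence "\<Phi> p = B" using p(3) d by auto
  thus ?thesis using pd by blast
qed

text \<open>Defined for every real \<open>v\<close>, also for \<open>v \<le> 0\<close>; this
  provides the continuation of the family.\<close>

definition par :: "real \<Rightarrow> real" where "par v = (THE p. p \<in> dom \<and> \<Phi> p = \<beta> - v)"

lemma par: "par v \<in> dom" "\<Phi> (par v) = \<beta> - v"
proof -
  obtain p where p: "p \<in> dom" "\<Phi> p = \<beta> - v" using \<Phi>_surj by blast
  have "par v \<in> dom \<and> \<Phi> (par v) = \<beta> - v"
    unfolding par_def
  proof (rule theI[of _ p])
    show "p \<in> dom \<and> \<Phi> p = \<beta> - v" using p by simp
    fix x assume "x \<in> dom \<and> \<Phi> x = \<beta> - v"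
    thus "x = p" using \<Phi>_less_iff[of x p] \<Phi>_less_iff[of p x] p by (metis linorder_neqE_linordered_idom order_less_irrefl)
  qed
  thus "par v \<in> dom" "\<Phi> (par v) = \<beta> - v" by auto
qed

lemma par_unique: "p \<in> dom \<Longrightarrow> \<Phi> p = \<beta> - v \<Longrightarrow> p = par v"
  using \<Phi>_less_iff[of p "par v"] \<Phi>_less_iff[of "par v" p] par by (metis linorder_neqE_linordered_idom order_less_irrefl)

lemma par_near:
  assumes e: "0 < e" shows "\<forall>\<^sub>F w in nhds v. \<bar>par w - par v\<bar> < e"
proof -
  let ?p = "par v"
  note d = domD[OF par(1)[of v]]
  define p1 where "p1 = max (?p / 2) (?p - e / 2)"
  have p1: "0 < p1" "p1 < ?p" "?p - e < p1" using d e by (auto simp: p1_def)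
  have p1d: "p1 \<in> dom" by (rule dom_down[OF par(1)[of v]]) (use p1 in auto)
  obtain p2 where p2: "?p < p2" "p2 < ?p + e" "p2 \<in> dom"
  proof -
    obtain q where q: "q \<in> dom" "?p < q"
    proof -
      obtain q where "q \<in> dom" "\<Phi> q = \<Phi> ?p + 1" using \<Phi>_surj by blast
      thus thesis using that \<Phi>_less_iff[OF par(1)[of v], of q] by simp
    qed
    define p2 where "p2 = min q (?p + e / 2)"
    have "?p < p2" "p2 < ?p + e" "p2 \<le> q" using q e by (auto simp: p2_def)
    thus thesis using that[of p2] dom_down[OF q(1), of p2] d by simp
  qed
  have "\<Phi> p1 < \<beta> - v" "\<beta> - v < \<Phi> p2"
    using \<Phi>_mono[OF p1d par(1) p1(2)] \<Phi>_mono[OF par(1) p2(3) p2(1)] par(2) by auto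
  hence "v \<in> {\<beta> - \<Phi> p2<..<\<beta> - \<Phi> p1}" by auto
  hence "\<forall>\<^sub>F w in nhds v. w \<in> {\<beta> - \<Phi> p2<..<\<beta> - \<Phi> p1}" by (intro eventually_nhds_in_open) auto
  thus ?thesis
  proof eventually_elim
    case (elim w)
    have "\<Phi> p1 < \<Phi> (par w)" "\<Phi> (par w) < \<Phi> p2" using elim par(2)[of w] by auto
    hence "p1 < par w" "par w < p2" using \<Phi>_less_iff p1d p2(3) par(1) by auto
    thus ?case using p1 p2 by auto
  qed
qed

section \<open>Holomorphic continuation of the parameter\<close>

text \<open>Complex versions of \<open>Sf\<close>, \<open>bf\<close> and \<Phi>. On
  \<open>cdom\<close> the real part of \<open>Sc\<close> is positive, so \<open>csqrt\<close> stays
  off its branch cut and extends the real root.\<close>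

definition Sc :: "complex \<Rightarrow> complex" where "Sc z = complex_of_real (2 * t) - complex_of_real (4 * g) * z\<^sup>2 / (1 - z\<^sup>2)"
definition bc :: "complex \<Rightarrow> complex" where "bc z = complex_of_real (2 * g) * z / ((1 - z\<^sup>2) * csqrt (Sc z))"
definition \<Phi>c :: "complex \<Rightarrow> complex" where "\<Phi>c z = bc z - csqrt (Sc z) / 2 * (z + 1 / z)"
definition cdom :: "complex set" where "cdom = {z. z \<noteq> 0 \<and> cmod z < 1 \<and> 0 < Re (Sc z)}"

lemma one_minus_sq_c: "cmod z < 1 \<Longrightarrow> z\<^sup>2 \<noteq> 1" for z :: complex
proof
  assume z: "cmod z < 1" "z\<^sup>2 = 1"
  hence "(cmod z)\<^sup>2 = 1" by (metis norm_power norm_one)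
  thus False using z(1) norm_ge_zero[of z] by (auto simp: power2_eq_1_iff)
qed

lemma open_cdom: "open cdom"
proof -
  have c: "continuous_on (ball 0 1) (\<lambda>z. Re (Sc z))"
    unfolding Sc_def by (intro continuous_intros) (use one_minus_sq_c in auto)
  have "open (ball 0 1 \<inter> (\<lambda>z. Re (Sc z)) -` {0<..})"
    by (rule continuous_open_preimage[OF c]) auto
  hence "open ((ball 0 1 \<inter> (\<lambda>z. Re (Sc z)) -` {0<..}) - {0})" by (rule open_Diff) auto
  moreover have "cdom = (ball 0 1 \<inter> (\<lambda>z. Re (Sc z)) -` {0<..}) - {0}" by (auto simp: cdom_def)
  ultimately show ?thesis by simp
qed

lemma Sc_real: "Sc (of_real p) = of_real (Sf p)"
  by (simp add: Sc_def Sf_def)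

lemma dom_cdom: "p \<in> dom \<Longrightarrow> of_real p \<in> cdom"
  by (auto simp: cdom_def dom_def Sc_real)

lemma complex_ext_real:
  assumes "p \<in> dom"
  shows "csqrt (Sc (of_real p)) = of_real (Rf p)" "bc (of_real p) = of_real (bf p)" "\<Phi>c (of_real p) = of_real (\<Phi> p)"
proof -
  show 1: "csqrt (Sc (of_real p)) = of_real (Rf p)"
    using domD(3)[OF assms] by (simp add: Sc_real Rf_def)
  show 2: "bc (of_real p) = of_real (bf p)" unfolding bc_def 1 by (simp add: bf_def)
  show "\<Phi>c (of_real p) = of_real (\<Phi> p)" unfolding \<Phi>c_def 1 2 by (simp add: \<Phi>_def)
qed

lemma holomorphic_Sc: "Sc holomorphic_on cdom"
  unfolding Sc_def[abs_def] by (intro holomorphic_intros) (auto simp: cdom_def dest: one_minus_sq_c)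

lemma Sc_slit: "z \<in> cdom \<Longrightarrow> Sc z \<notin> \<real>\<^sub>\<le>\<^sub>0"
  by (auto simp: cdom_def complex_nonpos_Reals_iff)

lemma holomorphic_csqrt_Sc: "(\<lambda>z. csqrt (Sc z)) holomorphic_on cdom"
  by (rule holomorphic_on_csqrt'[OF holomorphic_Sc Sc_slit])

lemma holomorphic_bc: "bc holomorphic_on cdom"
proof -
  have "(1 - z\<^sup>2) * csqrt (Sc z) \<noteq> 0" if "z \<in> cdom" for z
    using Sc_slit[OF that] that one_minus_sq_c[of z] by (auto simp: cdom_def)
  thus ?thesis unfolding bc_def[abs_def]
    by (intro holomorphic_on_divide holomorphic_on_mult holomorphic_csqrt_Sc holomorphic_intros)
qed

lemma holomorphic_\<Phi>c: "\<Phi>c holomorphic_on cdom"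
  unfolding \<Phi>c_def[abs_def]
  by (intro holomorphic_on_diff holomorphic_on_mult holomorphic_on_divide holomorphic_on_add holomorphic_csqrt_Sc
      holomorphic_bc holomorphic_on_ident holomorphic_on_const) (auto simp: cdom_def)

lemma dom_nhds: "p \<in> dom \<Longrightarrow> \<forall>\<^sub>F x in nhds p. x \<in> dom"
proof -
  assume p: "p \<in> dom"
  obtain q where q: "q \<in> dom" "\<Phi> q = \<Phi> p + 1" using \<Phi>_surj by blast
  hence "p < q" using \<Phi>_less_iff[OF p q(1)] by simp
  hence "\<forall>\<^sub>F x in nhds p. x \<in> {0<..<q}" using domD(1)[OF p] by (intro eventually_nhds_in_open) auto
  thus ?thesis by eventually_elim (use dom_down[OF q(1)] in auto)
qed

text \<open>Along the real axis the complex derivative must agree with \<open>\<Phi>'\<close>, which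
  is positive.\<close>

lemma deriv_\<Phi>c_nonzero:
  assumes p: "p \<in> dom" shows "deriv \<Phi>c (of_real p) \<noteq> 0"
proof -
  obtain N where N: "open N" "p \<in> N" "\<And>x. x \<in> N \<Longrightarrow> x \<in> dom"
    using dom_nhds[OF p] by (auto simp: eventually_nhds)
  have "(\<Phi>c has_field_derivative deriv \<Phi>c (of_real p)) (at (of_real p))"
    by (rule holomorphic_derivI[OF holomorphic_\<Phi>c open_cdom dom_cdom[OF p]])
  hence "((\<lambda>x. \<Phi>c (of_real x)) has_vector_derivative deriv \<Phi>c (of_real p)) (at p)"
    by (rule has_vector_derivative_real_field)
  moreover have "((\<lambda>x. complex_of_real (\<Phi> x)) has_vector_derivative of_real (\<Phi>' p)) (at p)"
    using \<Phi>_deriv(1)[OF p] by (intro has_vector_derivative_of_real)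
  hence "((\<lambda>x. \<Phi>c (of_real x)) has_vector_derivative of_real (\<Phi>' p)) (at p)"
  proof (rule has_vector_derivative_transform_within_open[OF _ N(1,2)])
    show "complex_of_real (\<Phi> x) = \<Phi>c (of_real x)" if "x \<in> N" for x
      using N(3)[OF that] by (simp add: complex_ext_real)
  qed
  ultimately have "deriv \<Phi>c (of_real p) = of_real (\<Phi>' p)" by (rule vector_derivative_unique_at)
  thus ?thesis using \<Phi>_deriv(2)[OF p] by simp
qed

text \<open>Local inversion of \<open>\<Phi>c\<close>. \<open>par_near\<close> keeps
  \<open>par w\<close> in the ball of injectivity, so the holomorphic inverse selects the same
  solution as \<open>par\<close>.\<close>

lemma par_complex:
  obtains G W where "open W" "complex_of_real v \<in> W" "G holomorphic_on W"
    "\<forall>\<^sub>F w in nhds v. G (of_real w) = of_real (par w)"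
proof -
  let ?p = "par v"
  note pd = par(1)[of v]
  obtain r where r: "r > 0" "ball (of_real ?p) r \<subseteq> cdom" "inj_on \<Phi>c (ball (of_real ?p) r)"
    by (rule has_complex_derivative_locally_injective[OF holomorphic_\<Phi>c dom_cdom[OF pd] open_cdom deriv_\<Phi>c_nonzero[OF pd]])
  let ?U = "ball (complex_of_real ?p) r"
  have h: "\<Phi>c holomorphic_on ?U" by (rule holomorphic_on_subset[OF holomorphic_\<Phi>c r(2)])
  obtain G where G: "G holomorphic_on (\<Phi>c ` ?U)" "\<And>z. z \<in> ?U \<Longrightarrow> G (\<Phi>c z) = z"
    using holomorphic_has_inverse[OF h open_ball r(3)] by metis
  have oV: "open (\<Phi>c ` ?U)" by (rule open_mapping_thm3[OF h open_ball r(3)])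
  let ?W = "(\<lambda>s. of_real \<beta> - s) -` (\<Phi>c ` ?U)"
  show thesis
  proof (rule that[of ?W "\<lambda>s. G (of_real \<beta> - s)"])
    show "open ?W" by (rule open_vimage[OF oV]) (intro continuous_intros)
    have "\<Phi>c (of_real ?p) = of_real \<beta> - of_real v"
      by (simp add: complex_ext_real[OF pd] par(2))
    moreover have "of_real ?p \<in> ?U" using r by simp
    ultimately show "complex_of_real v \<in> ?W" by (metis imageI vimageI)
    have "(G \<circ> (\<lambda>s. of_real \<beta> - s)) holomorphic_on ?W"
      by (rule holomorphic_on_compose_gen[OF _ G(1)]) (auto intro!: holomorphic_intros)
    thus "(\<lambda>s. G (of_real \<beta> - s)) holomorphic_on ?W" by (simp add: o_def)
    show "\<forall>\<^sub>F w in nhds v. G (of_real \<beta> - of_real w) = of_real (par w)"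
      using par_near[OF r(1), of v]
    proof eventually_elim
      case (elim w)
      have "of_real (par w) \<in> ?U" using elim by (simp add: dist_of_real dist_real_def abs_minus_commute)
      moreover have "\<Phi>c (of_real (par w)) = of_real \<beta> - of_real w"
        by (simp add: complex_ext_real[OF par(1)] par(2))
      ultimately show ?case using G(2) by metis
    qed
  qed
qed

end

section \<open>Integrals depending holomorphically on a parameter\<close>

lemma poisson_denom_nonzero:
  fixes z :: complex
  assumes "cmod z < 1" shows "1 + 2 * z * of_real (cos \<theta>) + z\<^sup>2 \<noteq> 0"
proof
  assume e: "1 + 2 * z * of_real (cos \<theta>) + z\<^sup>2 = 0"
  have c: "2 * complex_of_real (cos \<theta>) = cis \<theta> + cis (- \<theta>)" by (simp add: complex_eq_iff)
  have "(z + cis \<theta>) * (z + cis (- \<theta>)) = z\<^sup>2 + z * (cis \<theta> + cis (- \<theta>)) + cis \<theta> * cis (- \<theta>)"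
    by (simp add: power2_eq_square algebra_simps)
  also have "\<dots> = 1 + 2 * z * of_real (cos \<theta>) + z\<^sup>2" unfolding c[symmetric] cis_mult by simp
  finally have "z = - cis \<theta> \<or> z = - cis (- \<theta>)" using e by (simp add: eq_neg_iff_add_eq_0)
  hence "cmod z = 1" by (metis norm_cis norm_minus_cancel)
  thus False using assms by simp
qed

text \<open>Differentiation under the integral over a fixed interval of angles. One power series
  \<open>F\<close> at \<open>x0\<close> represents the test function, and its argument must stay in
  the disc of convergence; this is why \<open>{a..b}\<close> is kept arbitrary and is later taken
  short.\<close>

lemma holomorphic_arc_integral:
  fixes F :: "complex fps" and x0 a b k0 k3 :: real
  assumes U: "open U" "convex U"
    and hol: "A holomorphic_on U" "R holomorphic_on U" "K1 holomorphic_on U" "K2 holomorphic_on U" "Z holomorphic_on U"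
    and F: "\<And>s \<theta>. s \<in> U \<Longrightarrow> \<theta> \<in> {a..b} \<Longrightarrow> ereal (cmod (A s + R s * of_real (cos \<theta>) - of_real x0)) < fps_conv_radius F"
    and Z: "\<And>s. s \<in> U \<Longrightarrow> cmod (Z s) < 1"
  shows "(\<lambda>s. integral {a..b} (\<lambda>\<theta>. eval_fps F (A s + R s * of_real (cos \<theta>) - of_real x0) *
     (of_real k0 + K1 s * of_real (cos \<theta>) + K2 s * of_real (cos (2 * \<theta>))
       - of_real k3 * (1 - (Z s)\<^sup>2) / (1 + 2 * Z s * of_real (cos \<theta>) + (Z s)\<^sup>2)))) holomorphic_on U" (is "?P U")
    and "\<And>s. s \<in> U \<Longrightarrow> continuous_on {a..b} (\<lambda>\<theta>. eval_fps F (A s + R s * of_real (cos \<theta>) - of_real x0) *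
     (of_real k0 + K1 s * of_real (cos \<theta>) + K2 s * of_real (cos (2 * \<theta>))
       - of_real k3 * (1 - (Z s)\<^sup>2) / (1 + 2 * Z s * of_real (cos \<theta>) + (Z s)\<^sup>2)))"
proof -
  let ?u = "\<lambda>s \<theta>. A s + R s * of_real (cos \<theta>) - of_real x0"
  let ?D = "\<lambda>s \<theta>. 1 + 2 * Z s * of_real (cos \<theta>) + (Z s)\<^sup>2"
  let ?H = "\<lambda>s \<theta>. of_real k0 + K1 s * of_real (cos \<theta>) + K2 s * of_real (cos (2 * \<theta>)) - of_real k3 * (1 - (Z s)\<^sup>2) / ?D s \<theta>"
  let ?u' = "\<lambda>s \<theta>. deriv A s + deriv R s * of_real (cos \<theta>) - 0"
  let ?H' = "\<lambda>s \<theta>. 0 + deriv K1 s * of_real (cos \<theta>) + deriv K2 s * of_real (cos (2 * \<theta>))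
      - ((of_real k3 * (0 - of_nat 2 * (deriv Z s * Z s ^ (2 - Suc 0)))) * ?D s \<theta>
         - (of_real k3 * (1 - (Z s)\<^sup>2)) * (0 + (2 * deriv Z s) * of_real (cos \<theta>) + of_nat 2 * (deriv Z s * Z s ^ (2 - Suc 0))))
        / (?D s \<theta> * ?D s \<theta>)"
  have D: "?D s \<theta> \<noteq> 0" if "s \<in> U" for s \<theta> using poisson_denom_nonzero[OF Z[OF that]] .
  note d = holomorphic_derivI[OF hol(1) U(1)] holomorphic_derivI[OF hol(2) U(1)] holomorphic_derivI[OF hol(3) U(1)]
    holomorphic_derivI[OF hol(4) U(1)] holomorphic_derivI[OF hol(5) U(1)]
  have du: "((\<lambda>s. ?u s \<theta>) has_field_derivative ?u' s \<theta>) (at s within U)" if "s \<in> U" for s \<theta>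
    by (intro DERIV_diff DERIV_add DERIV_cmult_right d DERIV_const that)
  have dH: "((\<lambda>s. ?H s \<theta>) has_field_derivative ?H' s \<theta>) (at s within U)" if "s \<in> U" for s \<theta>
    by (intro DERIV_diff DERIV_add DERIV_cmult_right DERIV_cmult DERIV_divide DERIV_power d DERIV_const that D)
  have dE: "((\<lambda>s. eval_fps F (?u s \<theta>)) has_field_derivative eval_fps (fps_deriv F) (?u s \<theta>) * ?u' s \<theta>) (at s within U)"
    if "s \<in> U" "\<theta> \<in> {a..b}" for s \<theta>
    by (rule DERIV_chain2[OF has_field_derivative_eval_fps[OF F[OF that]] du[OF that(1)]])
  let ?fx = "\<lambda>s \<theta>. (eval_fps (fps_deriv F) (?u s \<theta>) * ?u' s \<theta>) * ?H s \<theta> + ?H' s \<theta> * eval_fps F (?u s \<theta>)"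
  have der: "((\<lambda>s. eval_fps F (?u s \<theta>) * ?H s \<theta>) has_field_derivative ?fx s \<theta>) (at s within U)"
    if "s \<in> U" "\<theta> \<in> cbox a b" for s \<theta>
    by (rule DERIV_mult[OF dE dH]) (use that in auto)
  have hc: "continuous_on U h" if "h holomorphic_on U" for h by (rule holomorphic_on_imp_continuous_on[OF that])
  have c0: "continuous_on (U \<times> {a..b}) (\<lambda>x. h (fst x))" if "h holomorphic_on U" for h
    by (rule continuous_on_compose2[OF hc[OF that] continuous_on_fst[OF continuous_on_id]]) auto
  note cA = c0[OF hol(1)] c0[OF hol(2)] c0[OF hol(3)] c0[OF hol(4)] c0[OF hol(5)]
    c0[OF holomorphic_deriv[OF hol(1) U(1)]] c0[OF holomorphic_deriv[OF hol(2) U(1)]] c0[OF holomorphic_deriv[OF hol(3) U(1)]]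
    c0[OF holomorphic_deriv[OF hol(4) U(1)]] c0[OF holomorphic_deriv[OF hol(5) U(1)]]
  have rad: "fps_conv_radius F \<le> fps_conv_radius (fps_deriv F)" by (rule fps_conv_radius_deriv)
  have im: "(\<lambda>x. ?u (fst x) (snd x)) ` (U \<times> {a..b}) \<subseteq> eball 0 (fps_conv_radius F)"
    "(\<lambda>x. ?u (fst x) (snd x)) ` (U \<times> {a..b}) \<subseteq> eball 0 (fps_conv_radius (fps_deriv F))"
    using F rad by (fastforce simp: in_eball_iff intro: less_le_trans)+
  have cu: "continuous_on (U \<times> {a..b}) (\<lambda>x. ?u (fst x) (snd x))" by (intro continuous_intros cA)
  have cD: "continuous_on (U \<times> {a..b}) (\<lambda>x. ?D (fst x) (snd x))" by (intro continuous_intros cA)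
  have cE: "continuous_on (U \<times> {a..b}) (\<lambda>x. eval_fps F (?u (fst x) (snd x)))"
    "continuous_on (U \<times> {a..b}) (\<lambda>x. eval_fps (fps_deriv F) (?u (fst x) (snd x)))"
    by (intro continuous_on_eval_fps' cu im)+
  have cH: "continuous_on (U \<times> {a..b}) (\<lambda>x. ?H (fst x) (snd x))"
    by (intro continuous_intros cA cD) (use D in auto)
  have cH': "continuous_on (U \<times> {a..b}) (\<lambda>x. ?H' (fst x) (snd x))"
    by (intro continuous_intros cA cD) (use D in auto)
  have cu': "continuous_on (U \<times> {a..b}) (\<lambda>x. ?u' (fst x) (snd x))" by (intro continuous_intros cA)
  have cfx: "continuous_on (U \<times> cbox a b) (\<lambda>(s, \<theta>). ?fx s \<theta>)"
    unfolding split_beta' cbox_interval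
    by (intro continuous_on_add continuous_on_mult cE cH cH' cu')
  have cf: "continuous_on {a..b} (\<lambda>\<theta>. eval_fps F (?u s \<theta>) * ?H s \<theta>)" if s: "s \<in> U" for s
  proof -
    have c: "continuous_on (U \<times> {a..b}) (\<lambda>x. eval_fps F (?u (fst x) (snd x)) * ?H (fst x) (snd x))"
      by (intro continuous_on_mult cE cH)
    have "continuous_on {a..b} (\<lambda>\<theta>. (\<lambda>x. eval_fps F (?u (fst x) (snd x)) * ?H (fst x) (snd x)) (s, \<theta>))"
      by (rule continuous_on_compose2[OF c]) (use s in \<open>auto intro!: continuous_intros\<close>)
    thus ?thesis by simp
  qed
  show "\<And>s. s \<in> U \<Longrightarrow> continuous_on {a..b} (\<lambda>\<theta>. eval_fps F (?u s \<theta>) * ?H s \<theta>)" by (rule cf)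
  have "(\<lambda>s. integral (cbox a b) (\<lambda>\<theta>. eval_fps F (?u s \<theta>) * ?H s \<theta>)) holomorphic_on U"
    by (rule leibniz_rule_holomorphic[OF der _ cfx U(2)])
       (use cf in \<open>auto simp: cbox_interval intro!: integrable_continuous_real\<close>)
  thus "?P U" by (simp add: cbox_interval)
qed

lemma real_analytic_at_cong:
  assumes "real_analytic_at f x" "\<forall>\<^sub>F y in nhds x. f y = g y"
  shows "real_analytic_at g x"
proof -
  have "((\<lambda>h. x + h) \<longlongrightarrow> x + 0) (nhds 0)" by (intro tendsto_intros filterlim_ident)
  hence xh: "((\<lambda>h. x + h) \<longlongrightarrow> x) (nhds 0)" by simp
  have e: "\<forall>\<^sub>F h in nhds 0. f (x + h) = g (x + h)" by (rule eventually_compose_filterlim[OF assms(2) xh])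
  obtain F where F: "(\<lambda>h. f (x + h)) has_fps_expansion F" using assms(1) by (auto simp: real_analytic_at_def)
  hence "\<forall>\<^sub>F h in nhds 0. eval_fps F h = f (x + h)" by (simp add: has_fps_expansion_def)
  with e have "\<forall>\<^sub>F h in nhds 0. eval_fps F h = g (x + h)" by eventually_elim simp
  hence "(\<lambda>h. g (x + h)) has_fps_expansion F" using F by (simp add: has_fps_expansion_def)
  thus ?thesis unfolding real_analytic_at_def by blast
qed

lemma real_analytic_at_add:
  "real_analytic_at f x \<Longrightarrow> real_analytic_at g x \<Longrightarrow> real_analytic_at (\<lambda>y. f y + g y) x"
  unfolding real_analytic_at_def by (elim exE, rule exI, rule has_fps_expansion_add)

lemma real_analytic_at_cmult: "real_analytic_at f x \<Longrightarrow> real_analytic_at (\<lambda>y. c * f y) x"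
  unfolding real_analytic_at_def by (elim exE, rule exI, rule has_fps_expansion_cmult_left)

section \<open>The continued family of measures\<close>

context soft_family
begin

definition hf :: "real \<Rightarrow> real \<Rightarrow> real" where
  "hf p = arc_density (t + g) (- g * p / (1 - p\<^sup>2)) (- Sf p / 4) (- g) (- p)"

text \<open>The centre \<open>m0 - v\<close> equals \<open>bf (par v) - \<beta>\<close>, because
  \<open>m0 + B\<close> is \<open>bf (par v)\<close> and \<open>B = \<beta> - v\<close>; in this
  form \<open>v\<close> enters through \<open>par v\<close> alone.\<close>

definition Nf :: "real \<Rightarrow> real measure" where
  "Nf v = arc_measure (bf (par v) - \<beta>) (Rf (par v)) (hf (par v))"

lemma soft_edge_dom:
  assumes p: "p \<in> dom"
  shows "soft_edge t g (\<Phi> p) p (Sf p) (Rf p) (1 - p\<^sup>2) (Rf p / 2 * (p + 1 / p))"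
proof
  note d = domD[OF p]
  have "bf p * Rf p = 2 * g * p / (1 - p\<^sup>2)" using d by (simp add: bf_def)
  thus "(Rf p / 2 * (p + 1 / p) + \<Phi> p) * Rf p = 2 * g * p / (1 - p\<^sup>2)" by (simp add: \<Phi>_def)
qed (use t g domD[OF p] in \<open>auto simp: Sf_def Rf_def\<close>)

lemma hf_eq_ang: "p \<in> dom \<Longrightarrow> hf p = soft_edge.ang t g p (Sf p) (1 - p\<^sup>2)"
  by (simp add: hf_def soft_edge.ang_def[OF soft_edge_dom])

lemma hf_pos: "p \<in> dom \<Longrightarrow> sin \<theta> \<noteq> 0 \<Longrightarrow> 0 < hf p \<theta>" "p \<in> dom \<Longrightarrow> 0 \<le> hf p \<theta>"
  using soft_edge.ang_pos[OF soft_edge_dom] soft_edge.ang_nonneg[OF soft_edge_dom] by (auto simp: hf_eq_ang)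

lemma par_soft: "soft_edge t g (\<beta> - v) (par v) (Sf (par v)) (Rf (par v)) (1 - (par v)\<^sup>2) (Rf (par v) / 2 * (par v + 1 / par v))"
  using soft_edge_dom[OF par(1)[of v]] by (simp add: par(2))

lemma center_eq: "Rf (par v) / 2 * (par v + 1 / par v) - v = bf (par v) - \<beta>"
  using par(2)[of v] by (simp add: \<Phi>_def)

lemma Nf_eq: "Nf v = soft_edge.N t g (par v) (Sf (par v)) (Rf (par v)) (1 - (par v)\<^sup>2) (Rf (par v) / 2 * (par v + 1 / par v)) v"
  unfolding soft_edge.N_def[OF par_soft] center_eq Nf_def hf_eq_ang[OF par(1)] ..

lemma arc_Nf: "arc (hf (par v))"
  using hf_pos(2)[OF par(1)] domD[OF par(1)[of v]]
  by unfold_locales (auto simp: hf_def intro!: continuous_arc_density)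

lemma Nf_sets: "sets (Nf v) = sets borel"
  unfolding Nf_def by (rule arc.sets_arc[OF arc_Nf])

lemma Nf_finite: "finite_measure (Nf v)"
proof -
  interpret soft_edge t g "\<beta> - v" "par v" "Sf (par v)" "Rf (par v)" "1 - (par v)\<^sup>2" "Rf (par v) / 2 * (par v + 1 / par v)"
    by (rule par_soft)
  interpret poisson_arc "bf (par v) - \<beta>" "Rf (par v)" "t + g" "- g * par v / (1 - (par v)\<^sup>2)" "- Sf (par v) / 4" "- g" "- par v"
    by (rule arc_locale)
  have "emeasure (Nf v) UNIV = ennreal (t + g + - g)" using mass(1) by (simp only: Nf_def hf_def)
  thus ?thesis using sets_eq_imp_space_eq[OF Nf_sets] by (intro finite_measureI) simp
qed

definition seg :: "real \<Rightarrow> real set" where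
  "seg v = {bf (par v) - \<beta> - Rf (par v)..bf (par v) - \<beta> + Rf (par v)}"

lemma Nf_AE: "AE x in Nf v. x \<in> seg v"
  using soft_edge.N_AE[OF par_soft, of v v] unfolding Nf_eq seg_def center_eq .

text \<open>The density is positive wherever \<open>sin \<theta> \<noteq> 0\<close>, so every
  neighbourhood of a point of the arc receives mass. The exact support matters because test
  functions are assumed analytic on the support, and \<open>Nf_analytic\<close> asks for analyticity
  on the whole arc.\<close>

lemma Nf_support: "measure_support (Nf v) = seg v"
proof
  have c: "emeasure (Nf v) (- seg v) = 0"
    using Nf_AE[of v] Nf_sets[of v] sets_eq_imp_space_eq[OF Nf_sets[of v]]
    by (subst (asm) AE_iff_measurable[of "- seg v"]) (auto simp: seg_def)
  show "measure_support (Nf v) \<subseteq> seg v"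
  proof
    fix x assume x: "x \<in> measure_support (Nf v)"
    show "x \<in> seg v"
    proof (rule ccontr)
      assume "x \<notin> seg v"
      moreover have "open (- seg v)" by (simp add: seg_def open_Compl)
      ultimately have "0 < emeasure (Nf v) (- seg v)" using x by (auto simp: measure_support_def)
      thus False using c by simp
    qed
  qed
  show "seg v \<subseteq> measure_support (Nf v)"
  proof
    fix x assume x: "x \<in> seg v"
    let ?m = "bf (par v) - \<beta>" and ?R = "Rf (par v)"
    have R: "0 < ?R" by (rule domD(4)[OF par(1)])
    define \<phi> where "\<phi> = arccos ((x - ?m) / ?R)"
    have b: "-1 \<le> (x - ?m) / ?R" "(x - ?m) / ?R \<le> 1" using x R by (auto simp: seg_def field_simps)
    have \<phi>: "0 \<le> \<phi>" "\<phi> \<le> pi" "x = ?m + ?R * cos \<phi>"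
      using b R by (auto simp: \<phi>_def arccos_lbound arccos_ubound cos_arccos)
    show "x \<in> measure_support (Nf v)"
      unfolding measure_support_def
    proof safe
      fix U :: "real set" assume U: "open U" "x \<in> U"
      interpret arc ?m ?R "hf (par v)" by (rule arc_Nf)
      let ?V = "(\<lambda>\<theta>. ?m + ?R * cos \<theta>) -` U"
      have oV: "open ?V" by (rule open_vimage[OF U(1)]) (intro continuous_intros)
      have "\<phi> \<in> ?V" using U \<phi> by simp
      \<comment> \<open>An endpoint of the arc corresponds to the angle 0 or \<open>pi\<close>,
        where the density vanishes; the open set also meets the open interval of angles.\<close>
      moreover have "\<phi> \<in> closure {0<..<pi}" using \<phi> by simp
      ultimately have "?V \<inter> {0<..<pi} \<noteq> {}" using open_Int_closure_eq_empty[OF oV, of "{0<..<pi}"] by blast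
      then obtain y where y: "y \<in> ?V \<inter> {0<..<pi}" by blast
      have "open (?V \<inter> {0<..<pi})" using oV by (intro open_Int) auto
      then obtain e where e: "0 < e" "ball y e \<subseteq> ?V \<inter> {0<..<pi}" using y by (meson open_contains_ball)
      show "0 < emeasure (Nf v) U"
      proof (rule ccontr)
        assume "\<not> ?thesis"
        hence "emeasure (Nf v) U = 0" by simp
        hence "(\<integral>\<^sup>+\<theta>. ennreal (indicator {0..2*pi} \<theta> * (hf (par v) \<theta> / (2*pi))) * indicator U (?m + ?R * cos \<theta>) \<partial>lborel) = 0"
          using arc_emeasure[of U] U by (simp add: Nf_def)
        moreover have [measurable]: "U \<in> sets borel" using U by simp
        ultimately have "AE \<theta> in lborel. ennreal (indicator {0..2*pi} \<theta> * (hf (par v) \<theta> / (2*pi))) * indicator U (?m + ?R * cos \<theta>) = 0"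
          by (subst (asm) nn_integral_0_iff_AE) auto
        hence "AE \<theta> in lborel. \<theta> \<notin> ball y e"
        proof eventually_elim
          case (elim \<theta>)
          show ?case
          proof
            assume "\<theta> \<in> ball y e"
            hence th: "?m + ?R * cos \<theta> \<in> U" "0 < \<theta>" "\<theta> < pi" using e by auto
            have "sin \<theta> > 0" using th by (intro sin_gt_zero) auto
            hence "0 < hf (par v) \<theta>" by (intro hf_pos par) auto
            hence "0 < hf (par v) \<theta> / (2 * pi)" by simp
            moreover have "ennreal (hf (par v) \<theta> / (2 * pi)) = 0" using elim th by simp
            ultimately show False by (simp only: ennreal_eq_0_iff)
          qed
        qed
        hence "ball y e \<in> null_sets lborel" by (subst AE_iff_null_sets) auto
        moreover have "ball y e = {y - e<..<y + e}" by (rule ball_eq_greaterThanLessThan)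
        ultimately show False using e by (auto simp: null_sets_def)
      qed
    qed
  qed
qed

definition integrand :: "(real \<Rightarrow> real) \<Rightarrow> real \<Rightarrow> real \<Rightarrow> real" where
  "integrand f v \<theta> = f (bf (par v) - \<beta> + Rf (par v) * cos \<theta>) * hf (par v) \<theta>"

lemma Nf_integral:
  assumes f: "f \<in> borel_measurable borel" and c: "continuous_on {0..2*pi} (integrand f v)"
  shows "(\<integral>x. f x \<partial>Nf v) = 1 / (2 * pi) * integral {0..2*pi} (integrand f v)"
proof -
  interpret arc "bf (par v) - \<beta>" "Rf (par v)" "hf (par v)" by (rule arc_Nf)
  have "(\<integral>x. f x \<partial>Nf v) = (\<integral>\<theta>. 1 / (2 * pi) * (indicator {0..2*pi} \<theta> * integrand f v \<theta>) \<partial>lborel)"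
    unfolding Nf_def arc_integral[OF f] integrand_def by (intro Bochner_Integration.integral_cong) auto
  also have "\<dots> = 1 / (2 * pi) * integral {0..2*pi} (integrand f v)"
    using has_integral_imp_lborel(2)[OF c integrable_integral[OF integrable_continuous_real[OF c]]] by simp
  finally show ?thesis .
qed

text \<open>Near the point of the arc with angle \<open>\<theta>0\<close> the test function is a
  convergent power series. Centre and half-length extend holomorphically in \<open>v\<close>, so for
  complex \<open>v\<close> close by and angles close to \<open>\<theta>0\<close> the argument of the
  series stays in its disc, and \<open>holomorphic_arc_integral\<close> applies.\<close>

lemma analytic_local:
  assumes ra: "real_analytic_at f (bf (par v) - \<beta> + Rf (par v) * cos \<theta>0)"
  shows "\<exists>d>0. \<forall>a b. a \<le> \<theta>0 \<and> \<theta>0 \<le> b \<and> b - a < d \<longrightarrow>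
    (\<forall>\<^sub>F w in nhds v. continuous_on {a..b} (integrand f w)) \<and> real_analytic_at (\<lambda>w. integral {a..b} (integrand f w)) v"
proof -
  let ?p = "par v"
  define x0 where "x0 = bf ?p - \<beta> + Rf ?p * cos \<theta>0"
  obtain F :: "complex fps" and \<rho> :: real where F: "0 < \<rho>" "ereal \<rho> \<le> fps_conv_radius F"
    "\<And>h. \<bar>h\<bar> < \<rho> \<Longrightarrow> f (x0 + h) = Re (eval_fps F (of_real h))"
    using real_analytic_at_complexify[OF ra[folded x0_def]] by blast
  obtain G W where G: "open W" "complex_of_real v \<in> W" "G holomorphic_on W"
    "\<forall>\<^sub>F w in nhds v. G (of_real w) = of_real (par w)"
    by (rule par_complex)
  have Gv: "G (of_real v) = of_real ?p" using eventually_nhds_x_imp_x[OF G(4)] .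
  define V where "V = W \<inter> G -` cdom"
  have oV: "open V" unfolding V_def
    by (rule continuous_open_preimage[OF holomorphic_on_imp_continuous_on[OF G(3)] G(1) open_cdom])
  have vV: "complex_of_real v \<in> V" using G(2) Gv dom_cdom[OF par(1)] by (simp add: V_def)
  have GV: "G holomorphic_on V" by (rule holomorphic_on_subset[OF G(3)]) (simp add: V_def)
  have comp: "(\<lambda>s. h (G s)) holomorphic_on V" if "h holomorphic_on cdom" for h
    using holomorphic_on_compose_gen[OF GV that] by (auto simp: V_def o_def)
  define A where "A s = bc (G s) - of_real \<beta>" for s
  define R where "R s = csqrt (Sc (G s))" for s
  define K1 where "K1 s = - (2 * of_real g * G s / (1 - (G s)\<^sup>2))" for s
  define K2 where "K2 s = - (Sc (G s) / 2)" for s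
  have hol: "A holomorphic_on V" "R holomorphic_on V" "K1 holomorphic_on V" "K2 holomorphic_on V" "G holomorphic_on V"
  proof -
    show "A holomorphic_on V" unfolding A_def by (intro holomorphic_intros comp holomorphic_bc)
    show "R holomorphic_on V" unfolding R_def by (rule comp[OF holomorphic_csqrt_Sc])
    show "K1 holomorphic_on V" unfolding K1_def
      by (intro holomorphic_intros GV) (auto simp: V_def cdom_def dest: one_minus_sq_c)
    show "K2 holomorphic_on V" unfolding K2_def
      by (intro holomorphic_on_minus holomorphic_on_divide comp[OF holomorphic_Sc] holomorphic_on_const) auto
  qed (rule GV)
  have Av: "A (of_real v) = of_real (bf ?p - \<beta>)" "R (of_real v) = of_real (Rf ?p)"
    unfolding A_def R_def Gv by (simp_all add: complex_ext_real[OF par(1)])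
  have cA: "continuous (at (of_real v)) A" "continuous (at (of_real v)) R"
    using holomorphic_on_imp_continuous_on[OF hol(1)] holomorphic_on_imp_continuous_on[OF hol(2)] oV vV
    by (auto simp: continuous_on_eq_continuous_at)
  have "((\<lambda>s. cmod (A s - A (of_real v)) + cmod (R s - R (of_real v))) \<longlongrightarrow>
      cmod (A (of_real v) - A (of_real v)) + cmod (R (of_real v) - R (of_real v))) (nhds (of_real v))"
    using cA unfolding isCont_def tendsto_at_iff_tendsto_nhds by (intro tendsto_intros)
  hence "\<forall>\<^sub>F s in nhds (of_real v). cmod (A s - A (of_real v)) + cmod (R s - R (of_real v)) < \<rho> / 2"
    using F(1) by (intro order_tendstoD) auto
  moreover have "\<forall>\<^sub>F s in nhds (of_real v). s \<in> V" using oV vV by (rule eventually_nhds_in_open)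
  ultimately have "\<forall>\<^sub>F s in nhds (of_real v). cmod (A s - A (of_real v)) + cmod (R s - R (of_real v)) < \<rho> / 2 \<and> s \<in> V"
    by (rule eventually_conj)
  then obtain \<delta> where \<delta>: "0 < \<delta>" "\<And>s. dist s (of_real v) < \<delta> \<Longrightarrow>
      cmod (A s - A (of_real v)) + cmod (R s - R (of_real v)) < \<rho> / 2 \<and> s \<in> V"
    by (auto simp: eventually_nhds_metric)
  let ?U = "ball (complex_of_real v) \<delta>"
  have UV: "?U \<subseteq> V" using \<delta>(2) by (auto simp: dist_commute)
  have "((\<lambda>\<theta>. Rf ?p * \<bar>cos \<theta> - cos \<theta>0\<bar>) \<longlongrightarrow> Rf ?p * \<bar>cos \<theta>0 - cos \<theta>0\<bar>) (nhds \<theta>0)"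
    by (intro tendsto_intros filterlim_ident)
  hence "\<forall>\<^sub>F \<theta> in nhds \<theta>0. Rf ?p * \<bar>cos \<theta> - cos \<theta>0\<bar> < \<rho> / 2"
    using F(1) by (intro order_tendstoD) auto
  then obtain d where d: "0 < d" "\<And>\<theta>. dist \<theta> \<theta>0 < d \<Longrightarrow> Rf ?p * \<bar>cos \<theta> - cos \<theta>0\<bar> < \<rho> / 2"
    by (auto simp: eventually_nhds_metric)
  have Rp: "0 < Rf ?p" by (rule domD(4)[OF par(1)])
  have small: "cmod (A s + R s * of_real (cos \<theta>) - of_real x0) < \<rho>" if s: "s \<in> ?U" and th: "dist \<theta> \<theta>0 < d" for s \<theta>
  proof -
    have "A s + R s * of_real (cos \<theta>) - of_real x0 =
      (A s - A (of_real v)) + (R s - R (of_real v)) * of_real (cos \<theta>) + of_real (Rf ?p * (cos \<theta> - cos \<theta>0))"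
      by (simp add: Av x0_def algebra_simps)
    also have "cmod \<dots> \<le> cmod (A s - A (of_real v)) + cmod ((R s - R (of_real v)) * of_real (cos \<theta>)) + cmod (of_real (Rf ?p * (cos \<theta> - cos \<theta>0)))"
      by (intro order_trans[OF norm_triangle_ineq] add_right_mono norm_triangle_ineq)
    also have "cmod ((R s - R (of_real v)) * of_real (cos \<theta>)) \<le> cmod (R s - R (of_real v)) * 1"
      unfolding norm_mult norm_of_real by (intro mult_left_mono) auto
    also have "cmod (of_real (Rf ?p * (cos \<theta> - cos \<theta>0))) = Rf ?p * \<bar>cos \<theta> - cos \<theta>0\<bar>"
      unfolding norm_of_real using Rp by (simp add: abs_mult)
    finally show ?thesis using \<delta>(2)[of s] d(2)[OF th] s by (simp add: dist_commute)
  qed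
  show ?thesis
  proof (intro exI[of _ d] conjI d(1) allI impI)
    fix a b assume ab: "a \<le> \<theta>0 \<and> \<theta>0 \<le> b \<and> b - a < d"
    have th: "dist \<theta> \<theta>0 < d" if "\<theta> \<in> {a..b}" for \<theta> using that ab by (auto simp: dist_real_def)
    have rad: "ereal (cmod (A s + R s * of_real (cos \<theta>) - of_real x0)) < fps_conv_radius F" if "s \<in> ?U" "\<theta> \<in> {a..b}" for s \<theta>
      using small[OF that(1) th[OF that(2)]] F(2) by (metis less_ereal.simps(1) less_le_trans)
    have Z: "cmod (G s) < 1" if "s \<in> ?U" for s using UV that by (auto simp: V_def cdom_def)
    let ?E = "\<lambda>s \<theta>. eval_fps F (A s + R s * of_real (cos \<theta>) - of_real x0) *
     (of_real (t + g) + K1 s * of_real (cos \<theta>) + K2 s * of_real (cos (2 * \<theta>))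
       - of_real g * (1 - (G s)\<^sup>2) / (1 + 2 * G s * of_real (cos \<theta>) + (G s)\<^sup>2))"
    note hU = hol[THEN holomorphic_on_subset[OF _ UV]]
    have H: "(\<lambda>s. integral {a..b} (?E s)) holomorphic_on ?U"
      "\<And>s. s \<in> ?U \<Longrightarrow> continuous_on {a..b} (?E s)"
      by (rule holomorphic_arc_integral[OF open_ball convex_ball hU rad Z]; assumption)+
    have near: "\<forall>\<^sub>F w in nhds v. of_real w \<in> ?U \<and> G (of_real w) = of_real (par w)"
    proof (rule eventually_conj[OF _ G(4)])
      have "\<forall>\<^sub>F w in nhds v. w \<in> ball v \<delta>" using \<delta>(1) by (intro eventually_nhds_in_open) auto
      thus "\<forall>\<^sub>F w in nhds v. of_real w \<in> ?U" by eventually_elim (simp add: dist_of_real)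
    qed
    have int_eq: "integrand f w \<theta> = Re (?E (of_real w) \<theta>)"
      if w: "of_real w \<in> ?U \<and> G (of_real w) = of_real (par w)" and t: "\<theta> \<in> {a..b}" for w \<theta>
    proof -
      let ?q = "par w"
      let ?h = "bf ?q - \<beta> + Rf ?q * cos \<theta> - x0"
      have AR: "A (of_real w) = of_real (bf ?q - \<beta>)" "R (of_real w) = of_real (Rf ?q)"
        using w unfolding A_def R_def by (simp_all add: complex_ext_real[OF par(1)])
      have u: "A (of_real w) + R (of_real w) * of_real (cos \<theta>) - of_real x0 = of_real ?h"
        unfolding AR by simp
      have "cmod (of_real ?h) < \<rho>" using small[OF w[THEN conjunct1] th[OF t]] unfolding u .
      hence "\<bar>?h\<bar> < \<rho>" by (simp only: norm_of_real)
      from F(3)[OF this] have "f (x0 + ?h) = Re (eval_fps F (of_real ?h))" .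
      moreover have "x0 + ?h = bf ?q - \<beta> + Rf ?q * cos \<theta>" by simp
      ultimately have fe: "f (bf ?q - \<beta> + Rf ?q * cos \<theta>) = Re (eval_fps F (of_real ?h))" by (simp only:)
      have he: "of_real (t + g) + K1 (of_real w) * of_real (cos \<theta>) + K2 (of_real w) * of_real (cos (2 * \<theta>))
         - of_real g * (1 - (G (of_real w))\<^sup>2) / (1 + 2 * G (of_real w) * of_real (cos \<theta>) + (G (of_real w))\<^sup>2) = of_real (hf ?q \<theta>)"
        using w by (simp add: hf_def arc_density_def K1_def K2_def Sc_real)
      show ?thesis unfolding integrand_def fe u he by simp
    qed
    show "\<forall>\<^sub>F w in nhds v. continuous_on {a..b} (integrand f w)"
      using near
    proof eventually_elim
      case (elim w)
      have "continuous_on {a..b} (\<lambda>\<theta>. Re (?E (of_real w) \<theta>))"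
        by (rule continuous_on_Re[OF H(2)]) (use elim in auto)
      thus ?case by (rule continuous_on_eq) (use int_eq[OF elim] in auto)
    qed
    show "real_analytic_at (\<lambda>w. integral {a..b} (integrand f w)) v"
    proof (rule real_analytic_at_of_complex)
      show "(\<lambda>s. integral {a..b} (?E s)) analytic_on {of_real v}"
        using H(1) \<delta>(1) by (auto simp: analytic_at intro!: exI[of _ ?U])
      show "\<forall>\<^sub>F w in nhds v. integral {a..b} (integrand f w) = Re (integral {a..b} (?E (of_real w)))"
        using near
      proof eventually_elim
        case (elim w)
        have "(?E (of_real w) has_integral integral {a..b} (?E (of_real w))) {a..b}"
          by (intro integrable_integral integrable_continuous_real H(2)) (use elim in auto)
        hence "((\<lambda>\<theta>. Re (?E (of_real w) \<theta>)) has_integral Re (integral {a..b} (?E (of_real w)))) {a..b}"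
          by (rule has_integral_Re)
        hence "(integrand f w has_integral Re (integral {a..b} (?E (of_real w)))) {a..b}"
          by (rule has_integral_eq[rotated]) (use int_eq[OF elim] in auto)
        thus ?case by (rule integral_unique)
      qed
    qed
  qed
qed

text \<open>Analyticity is known over short intervals of angles; \<open>Bolzano\<close> extends it
  to \<open>{0..2*pi}\<close>, since the property is stable under joining adjacent
  intervals.\<close>

lemma Nf_analytic:
  assumes f: "f \<in> borel_measurable borel" and ra: "\<And>x. x \<in> seg v \<Longrightarrow> real_analytic_at f x"
  shows "real_analytic_at (\<lambda>w. \<integral>x. f x \<partial>Nf w) v"
proof -
  let ?P = "\<lambda>a b. (\<forall>\<^sub>F w in nhds v. continuous_on {a..b} (integrand f w)) \<and> real_analytic_at (\<lambda>w. integral {a..b} (integrand f w)) v"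
  have "?P 0 (2 * pi)"
  proof (rule Bolzano[where P="?P"])
    show "0 \<le> 2 * pi" by simp
  next
    fix a b c :: real assume P: "?P a b" "?P b c" and le: "a \<le> b" "b \<le> c"
    have c: "\<forall>\<^sub>F w in nhds v. continuous_on {a..c} (integrand f w)"
      using P[THEN conjunct1]
    proof eventually_elim
      case (elim w)
      have "continuous_on ({a..b} \<union> {b..c}) (integrand f w)" by (intro continuous_on_closed_Un elim) auto
      moreover have "{a..b} \<union> {b..c} = {a..c}" using le by auto
      ultimately show ?case by simp
    qed
    have "\<forall>\<^sub>F w in nhds v. integral {a..b} (integrand f w) + integral {b..c} (integrand f w) = integral {a..c} (integrand f w)"
      using c by eventually_elim (rule Henstock_Kurzweil_Integration.integral_combine[OF le integrable_continuous_real])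
    from real_analytic_at_cong[OF real_analytic_at_add[OF P(1)[THEN conjunct2] P(2)[THEN conjunct2]] this] c
    show "?P a c" by (intro conjI)
  next
    fix \<theta> :: real
    have "bf (par v) - \<beta> + Rf (par v) * cos \<theta> \<in> seg v"
    proof -
      have "Rf (par v) * (-1) \<le> Rf (par v) * cos \<theta>" "Rf (par v) * cos \<theta> \<le> Rf (par v) * 1"
        using domD(4)[OF par(1)[of v]] by (intro mult_left_mono; simp)+
      thus ?thesis by (simp add: seg_def)
    qed
    thus "\<exists>d>0. \<forall>a b. a \<le> \<theta> \<and> \<theta> \<le> b \<and> b - a < d \<longrightarrow> ?P a b" by (intro analytic_local ra)
  qed
  note P = this
  have "\<forall>\<^sub>F w in nhds v. 1 / (2 * pi) * integral {0..2*pi} (integrand f w) = (\<integral>x. f x \<partial>Nf w)"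
    using P[THEN conjunct1] by eventually_elim (simp add: Nf_integral[OF f])
  with real_analytic_at_cmult[OF P[THEN conjunct2]] show ?thesis by (rule real_analytic_at_cong)
qed

lemma Nf_analytic_family: "analytic_measure_family I Nf"
  unfolding analytic_measure_family_def
proof (intro ballI conjI allI impI)
  fix v
  show "sets (Nf v) = sets borel" "finite_measure (Nf v)" by (rule Nf_sets, rule Nf_finite)
  show "compact (measure_support (Nf v))" unfolding Nf_support seg_def by simp
  fix f :: "real \<Rightarrow> real" assume "f \<in> borel_measurable borel \<and> (\<forall>x\<in>measure_support (Nf v). real_analytic_at f x)"
  thus "real_analytic_at (\<lambda>w. \<integral>x. f x \<partial>Nf w) v" by (intro Nf_analytic) (auto simp: Nf_support)
qed

end

section \<open>The quartic equation and the limit density\<close>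

lemma integral_cos_symmetric:
  fixes k :: "real \<Rightarrow> real"
  assumes c: "continuous_on UNIV (\<lambda>\<theta>. k (cos \<theta>))"
  shows "integral {0..2*pi} (\<lambda>\<theta>. k (cos \<theta>)) = 2 * integral {0..pi} (\<lambda>\<theta>. k (- cos \<theta>))"
proof -
  have i: "(\<lambda>\<theta>. k (cos \<theta>)) integrable_on {0..2*pi}"
    using c by (intro integrable_continuous_real) (auto intro: continuous_on_subset)
  have "integral {0..2*pi} (\<lambda>\<theta>. k (cos \<theta>)) = integral {0..pi} (\<lambda>\<theta>. k (cos \<theta>)) + integral {pi..2*pi} (\<lambda>\<theta>. k (cos \<theta>))"
    by (rule Henstock_Kurzweil_Integration.integral_combine[symmetric, OF _ _ i]) auto
  also have "integral {pi..2*pi} (\<lambda>\<theta>. k (cos \<theta>)) = integral {0..pi} (\<lambda>\<theta>. k (- cos \<theta>))"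
    using integral_shift_Icc_real[of 0 pi "\<lambda>\<theta>. k (cos \<theta>)" pi] by (simp add: o_def cos_add)
  also have "integral {0..pi} (\<lambda>\<theta>. k (cos \<theta>)) = integral {- pi..0} (\<lambda>\<theta>. k (- cos \<theta>))"
    using integral_shift_Icc_real[of "- pi" 0 "\<lambda>\<theta>. k (cos \<theta>)" pi] by (simp add: o_def cos_add)
  also have "\<dots> = integral {0..pi} (\<lambda>\<theta>. k (- cos \<theta>))"
    using Henstock_Kurzweil_Integration.integral_reflect_real[of pi 0 "\<lambda>\<theta>. k (- cos \<theta>)"] by simp
  finally show ?thesis by simp
qed

context soft_family
begin

lemma bf_pos: "p \<in> dom \<Longrightarrow> 0 < bf p"
  unfolding bf_def using g by (intro divide_pos_pos mult_pos_pos) (auto dest: domD)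

lemma Rf_sq: "p \<in> dom \<Longrightarrow> (Rf p)\<^sup>2 = Sf p"
  by (simp add: Rf_def domD(3) less_imp_le)

text \<open>With \<open>m = - (b + \<beta>)\<close> and half-length \<open>R\<close>, the quartic
  says \<open>b\<^sup>2 * (m\<^sup>2 - R\<^sup>2) = g\<^sup>2\<close>. As
  \<open>m\<^sup>2 - R\<^sup>2\<close> is the product of the endpoints, this means that
  \<open>(x - b) * sqrt ((x - a2) * (x - a3))\<close> has the value \<open>g\<close> at
  \<open>x = 0\<close>, the residue that the charge imposes.\<close>

lemma root_of_par:
  defines "b \<equiv> - bf (par 0)" and "R \<equiv> Rf (par 0)"
  shows "(b - \<beta>)\<^sup>2 - \<beta>\<^sup>2 - 3 * b\<^sup>2 + 2 * (t - (- g)) = R\<^sup>2"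
    and "endpoint_a2 \<beta> (- g) t b = - (b + \<beta>) - R" and "endpoint_a3 \<beta> (- g) t b = - (b + \<beta>) + R"
    and "admissible_root \<beta> (- g) t b"
proof -
  let ?p = "par 0"
  define p where "p = ?p"
  have pd: "p \<in> dom" by (simp add: p_def par)
  note d = domD[OF pd]
  define Q where "Q = 1 - p\<^sup>2"
  have Q: "0 < Q" using d by (simp add: Q_def)
  have R: "0 < R" "R\<^sup>2 = Sf p" using d Rf_sq[OF pd] by (auto simp: R_def p_def)
  define m where "m = R / 2 * (p + 1 / p)"
  have "bf ?p - m = \<beta> - 0" unfolding m_def R_def p_def \<Phi>_def[symmetric] by (rule par(2))
  hence m: "m = - (b + \<beta>)" by (simp add: b_def)
  have b: "b = - (2 * g * p / (Q * R))" by (simp add: b_def bf_def Q_def R_def p_def)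
  have bm: "b * m = - (g * (1 + p\<^sup>2) / Q)"
    unfolding b m_def using Q R d by (simp add: field_simps power2_eq_square)
  have R2: "R\<^sup>2 = 2 * (b * m) + 2 * (t + g)"
  proof -
    have "2 * t - 4 * g * p\<^sup>2 / Q = 2 * (- (g * (1 + p\<^sup>2) / Q)) + 2 * (t + g)"
    proof -
      have "g = g * Q / Q" using Q by simp
      hence "2 * g = 2 * (g * (1 - p\<^sup>2) / Q)" by (simp add: Q_def)
      thus ?thesis by (simp add: algebra_simps add_divide_distrib diff_divide_distrib)
    qed
    thus ?thesis unfolding R(2) bm by (simp add: Sf_def Q_def)
  qed
  show rad: "(b - \<beta>)\<^sup>2 - \<beta>\<^sup>2 - 3 * b\<^sup>2 + 2 * (t - (- g)) = R\<^sup>2"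
    unfolding R2 m by (simp add: power2_eq_square algebra_simps)
  have sq: "sqrt ((b - \<beta>)\<^sup>2 - \<beta>\<^sup>2 - 3 * b\<^sup>2 + 2 * (t - (- g))) = R"
    unfolding rad using R(1) by simp
  show e2: "endpoint_a2 \<beta> (- g) t b = - (b + \<beta>) - R" and e3: "endpoint_a3 \<beta> (- g) t b = - (b + \<beta>) + R"
    unfolding endpoint_a2_def endpoint_a3_def sq by simp_all
  have b0: "b < 0" using bf_pos[OF par(1)] by (simp add: b_def)
  have pr: "b\<^sup>2 * (m\<^sup>2 - R\<^sup>2) = g\<^sup>2"
  proof -
    have "m\<^sup>2 - R\<^sup>2 = (R * Q / (2 * p))\<^sup>2"
      unfolding m_def Q_def using d by (simp add: field_simps power2_eq_square)
    moreover have "b * (R * Q / (2 * p)) = - g" unfolding b using Q R d by simp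
    ultimately show ?thesis by (metis power2_minus power_mult_distrib)
  qed
  have "m\<^sup>2 - R\<^sup>2 = 3 * b\<^sup>2 + 4 * b * \<beta> + \<beta>\<^sup>2 - 2 * (t + g)"
    unfolding R2 m by (simp add: power2_eq_square algebra_simps)
  with pr have "b\<^sup>2 * (3 * b\<^sup>2 + 4 * b * \<beta> + \<beta>\<^sup>2 - 2 * (t + g)) = g\<^sup>2" by simp
  hence quart: "3 * b ^ 4 + 4 * \<beta> * b ^ 3 + (\<beta>\<^sup>2 + 2 * ((- g) - t)) * b\<^sup>2 - (- g)\<^sup>2 = 0"
    by (simp add: power2_eq_square power3_eq_cube power4_eq_xxxx algebra_simps)
  have "R < m"
    using soft_edge.m0_gt_R[OF soft_edge_dom[OF pd]] by (simp add: m_def R_def p_def)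
  thus "admissible_root \<beta> (- g) t b"
    unfolding admissible_root_def using b0 quart R by (simp add: e2 e3 m)
qed

text \<open>An admissible root determines \<open>p\<close>: positivity of the left endpoint says
  \<open>m / R > 1\<close>, so a coordinate in \<open>(0, 1)\<close> exists, and the quartic and the
  radicand turn into the equations that characterize \<open>par 0\<close>. In particular the
  admissible root is unique.\<close>

lemma admissible_root_par:
  assumes b: "admissible_root \<beta> (- g) t b"
  shows "b = - bf (par 0)"
proof -
  define rad where "rad = (b - \<beta>)\<^sup>2 - \<beta>\<^sup>2 - 3 * b\<^sup>2 + 2 * (t - (- g))"
  define R where "R = sqrt rad"
  define m where "m = - (b + \<beta>)"
  have b0: "b < 0" and quart: "3 * b ^ 4 + 4 * \<beta> * b ^ 3 + (\<beta>\<^sup>2 + 2 * ((- g) - t)) * b\<^sup>2 - (- g)\<^sup>2 = 0"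
    and mR: "0 < m - R" and R: "0 < R"
    using b by (simp_all add: admissible_root_def endpoint_a2_def endpoint_a3_def rad_def R_def m_def)
  have R2: "R\<^sup>2 = rad" using R by (simp add: R_def)
  have "1 < \<bar>m / R\<bar>" using mR R by (simp add: field_simps)
  then obtain p where p: "m / R = (p + 1 / p) / 2" "0 < \<bar>p\<bar>" "\<bar>p\<bar> < 1" "0 < p \<longleftrightarrow> 0 < m / R"
    by (rule joukowski)
  have p0: "0 < p" "p < 1" using p mR R by auto
  have mp: "m = R / 2 * (p + 1 / p)" using p(1) R by (simp add: field_simps)
  define Q where "Q = 1 - p\<^sup>2"
  have Q: "0 < Q" using one_minus_sq[OF p0] by (simp add: Q_def)
  have mm: "m\<^sup>2 - R\<^sup>2 = (R * Q / (2 * p))\<^sup>2"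
    unfolding mp Q_def using p0 by (simp add: field_simps power2_eq_square)
  have "m\<^sup>2 - R\<^sup>2 = 3 * b\<^sup>2 + 4 * b * \<beta> + \<beta>\<^sup>2 - 2 * (t + g)"
    unfolding R2 m_def rad_def by (simp add: power2_eq_square algebra_simps)
  moreover have "b\<^sup>2 * (3 * b\<^sup>2 + 4 * b * \<beta> + \<beta>\<^sup>2 - 2 * (t + g)) = g\<^sup>2"
    using quart by (simp add: power2_eq_square power3_eq_cube power4_eq_xxxx algebra_simps)
  ultimately have "b\<^sup>2 * (m\<^sup>2 - R\<^sup>2) = g\<^sup>2" by (simp only:)
  hence sq: "((- b) * (R * Q / (2 * p)))\<^sup>2 = g\<^sup>2"
    unfolding mm power_mult_distrib[of "- b"] power2_minus .
  \<comment> \<open>The sign of \<open>b\<close> selects the root \<open>g\<close> of the squared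
    equation rather than \<open>- g\<close>.\<close>
  have "0 \<le> (- b) * (R * Q / (2 * p))"
    using b0 R Q p0 by (intro mult_nonneg_nonneg divide_nonneg_nonneg) auto
  hence "(- b) * (R * Q / (2 * p)) = g"
    by (rule power2_eq_imp_eq[OF sq]) (use g in simp)
  hence be: "- b = 2 * g * p / (Q * R)" using R Q p0 by (simp add: field_simps)
  have bm: "b * m = - (g * (1 + p\<^sup>2) / Q)"
  proof -
    have "(- b) * m = g * (1 + p\<^sup>2) / Q"
      unfolding be mp using Q R p0 by (simp add: field_simps power2_eq_square)
    thus ?thesis by simp
  qed
  have "rad = 2 * (b * m) + 2 * (t + g)"
    unfolding rad_def m_def by (simp add: power2_eq_square algebra_simps)
  also have "\<dots> = 2 * t - 4 * g * p\<^sup>2 / Q"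
  proof -
    have "g = g * Q / Q" using Q by simp
    hence "2 * g = 2 * (g * (1 - p\<^sup>2) / Q)" by (simp add: Q_def)
    thus ?thesis unfolding bm by (simp add: algebra_simps add_divide_distrib diff_divide_distrib)
  qed
  finally have rS: "rad = Sf p" by (simp add: Sf_def Q_def)
  have RR: "Rf p = R" by (simp add: Rf_def R_def rS)
  have pd: "p \<in> dom" using p0 R2 R by (simp add: dom_def rS[symmetric] flip: R2)
  have bb: "bf p = - b" unfolding be by (simp add: bf_def RR Q_def)
  have "\<Phi> p = \<beta> - 0" unfolding \<Phi>_def bb RR mp[symmetric] by (simp add: m_def)
  hence "p = par 0" by (rule par_unique[OF pd])
  thus ?thesis using bb by simp
qed

lemma integrand_continuous:
  assumes "continuous_on UNIV f"
  shows "continuous_on S (integrand f v)"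
proof -
  have "continuous_on S (hf (par v))"
    unfolding hf_def using domD[OF par(1)[of v]] by (intro continuous_arc_density) auto
  moreover have "continuous_on S (\<lambda>\<theta>. f (bf (par v) - \<beta> + Rf (par v) * cos \<theta>))"
    by (rule continuous_on_compose2[OF assms]) (auto intro!: continuous_intros)
  ultimately show ?thesis unfolding integrand_def by (intro continuous_on_mult)
qed

text \<open>The substitution \<open>x = m - R * cos \<theta>\<close> turns the square root into
  \<open>R * sin \<theta>\<close>, so the density times the Jacobian is, up to
  \<open>1 / pi\<close>, the squared sine times \<open>R\<^sup>2 * (x - b) / x\<close>, the product
  found in \<open>ang_eq\<close>; the upper and lower half circle contribute equally.\<close>

lemma sigma_integral:
  fixes f :: "real \<Rightarrow> real"
  assumes f: "continuous_on UNIV f"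
  shows "(\<integral>x. f x \<partial>sigma_measure \<beta> (- g) t (- bf (par 0))) = (\<integral>x. f x \<partial>Nf 0)"
proof -
  define p where "p = par 0"
  define b where "b = - bf p"
  define R where "R = Rf p"
  define m where "m = bf p - \<beta>"
  have pd: "p \<in> dom" by (simp add: p_def par)
  note d = domD[OF pd]
  have R: "0 < R" using d by (simp add: R_def)
  interpret se: soft_edge t g "\<Phi> p" p "Sf p" "Rf p" "1 - p\<^sup>2" "Rf p / 2 * (p + 1 / p)"
    by (rule soft_edge_dom[OF pd])
  have mm: "m = R / 2 * (p + 1 / p)" using center_eq[of 0] by (simp add: m_def p_def R_def)
  have mR: "R < m" using se.m0_gt_R by (simp add: mm R_def)
  have a: "endpoint_a2 \<beta> (- g) t b = m - R" "endpoint_a3 \<beta> (- g) t b = m + R"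
    using root_of_par(2,3) by (simp_all add: b_def m_def R_def p_def)
  define D where "D x = 1 / pi * ((x - b) * sqrt ((x - (m - R)) * (m + R - x)) / x)" for x
  have b0: "b < 0" using bf_pos[OF pd] by (simp add: b_def)
  have D0: "0 \<le> D x" if "x \<in> {m - R..m + R}" for x
    unfolding D_def using that b0 mR by (intro mult_nonneg_nonneg divide_nonneg_nonneg) auto
  \<comment> \<open>The density vanishes at the endpoints, so the open interval in
    \<open>sigma_measure\<close> may be replaced by the closed one of the substitution rule.\<close>
  have De: "indicator {m - R<..<m + R} x * D x = indicator {m - R..m + R} x * D x" for x
    by (cases "x = m - R \<or> x = m + R") (auto simp: D_def indicator_def)
  have Dm [measurable]: "D \<in> borel_measurable borel" unfolding D_def[abs_def] by measurable
  have fm [measurable]: "f \<in> borel_measurable borel" using f by (rule borel_measurable_continuous_onI)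
  have "indicator {m - R<..<m + R} x * (1 / pi * ((x - b) * sqrt ((x - (m - R)) * (m + R - x)) / x))
    = indicator {m - R..m + R} x * D x" for x
    using De[of x] by (simp only: D_def)
  hence "sigma_measure \<beta> (- g) t b = density lborel (\<lambda>x. ennreal (indicator {m - R..m + R} x * D x))"
    unfolding sigma_measure_def Let_def a by (simp only:)
  hence "(\<integral>x. f x \<partial>sigma_measure \<beta> (- g) t b) = (\<integral>x. (indicator {m - R..m + R} x * D x) * f x \<partial>lborel)"
    using D0 by (simp add: integral_real_density indicator_def)
  also have "\<dots> = (\<integral>x. (D x * f x) * indicator {m - R * cos 0..m - R * cos pi} x \<partial>lborel)"
    by (intro Bochner_Integration.integral_cong) (auto simp: mult_ac)
  \<comment> \<open>The minus sign makes the substitution increasing on \<open>{0..pi}\<close>; the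
    angle of \<open>hf\<close> is therefore \<open>pi - \<theta>\<close>.\<close>
  also have "\<dots> = (\<integral>\<theta>. (D (m - R * cos \<theta>) * f (m - R * cos \<theta>)) * (R * sin \<theta>) * indicator {0..pi} \<theta> \<partial>lborel)"
  proof (rule integral_substitution(2))
    have "continuous_on {m - R..m + R} (\<lambda>x. D x * f x)"
      unfolding D_def using mR by (intro continuous_intros continuous_on_subset[OF f]) auto
    thus "set_integrable lborel {m - R * cos 0..m - R * cos pi} (\<lambda>x. D x * f x)"
      by (simp add: borel_integrable_atLeastAtMost')
    show "((\<lambda>\<theta>. m - R * cos \<theta>) has_real_derivative R * sin \<theta>) (at \<theta>)" for \<theta>
      by (auto intro!: derivative_eq_intros)
    show "continuous_on {0..pi} (\<lambda>\<theta>. R * sin \<theta>)" by (intro continuous_intros)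
    show "0 \<le> R * sin \<theta>" if "\<theta> \<in> {0..pi}" for \<theta> using that R by (intro mult_nonneg_nonneg sin_ge_zero) auto
  qed simp
  also have "\<dots> = (\<integral>\<theta>. indicator {0..pi} \<theta> * (1 / pi * (f (m - R * cos \<theta>) * hf p (pi - \<theta>))) \<partial>lborel)"
  proof (rule Bochner_Integration.integral_cong[OF refl])
    fix \<theta> :: real
    show "(D (m - R * cos \<theta>) * f (m - R * cos \<theta>)) * (R * sin \<theta>) * indicator {0..pi} \<theta> =
      indicator {0..pi} \<theta> * (1 / pi * (f (m - R * cos \<theta>) * hf p (pi - \<theta>)))"
    proof (cases "\<theta> \<in> {0..pi}")
      case True
      define c where "c = - cos \<theta>"
      define y where "y = m + R * c"
      define E where "E = 1 + 2 * p * c + p\<^sup>2"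
      have s0: "0 \<le> sin \<theta>" using True by (auto intro: sin_ge_zero)
      have E: "0 < E" using se.D_pos[of "pi - \<theta>"] by (simp add: E_def c_def)
      have yE: "y = R / (2 * p) * E" using se.y_eq[of c] by (simp add: y_def E_def mm R_def)
      have y0: "y \<noteq> 0" using yE E R d by auto
      have "(y - (m - R)) * (m + R - y) = R\<^sup>2 * (1 - c\<^sup>2)" by (simp add: y_def power2_eq_square algebra_simps)
      also have "1 - c\<^sup>2 = (sin \<theta>)\<^sup>2" by (simp add: c_def sin_squared_eq)
      finally have "sqrt ((y - (m - R)) * (m + R - y)) = R * sin \<theta>"
        using R s0 by (simp add: real_sqrt_mult)
      hence "D y * (R * sin \<theta>) = 1 / pi * ((sin \<theta>)\<^sup>2 * (R\<^sup>2 * ((y - b) / y)))"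
        by (simp add: D_def power2_eq_square)
      also have "R\<^sup>2 * ((y - b) / y) = Sf p + 4 * g * p\<^sup>2 / ((1 - p\<^sup>2) * E)"
      proof -
        have "R\<^sup>2 * ((y - b) / y) = R\<^sup>2 + R\<^sup>2 * bf p / y" using y0 by (simp add: b_def field_simps)
        also have "R\<^sup>2 * bf p / y = 4 * g * p\<^sup>2 / ((1 - p\<^sup>2) * E)"
          unfolding yE bf_def R_def[symmetric] using R E d by (simp add: field_simps power2_eq_square)
        finally show ?thesis using Rf_sq[OF pd] by (simp add: R_def)
      qed
      also have "(sin \<theta>)\<^sup>2 * (Sf p + 4 * g * p\<^sup>2 / ((1 - p\<^sup>2) * E)) = hf p (pi - \<theta>)"
        unfolding hf_eq_ang[OF pd] se.ang_eq by (simp add: E_def c_def)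
      finally have e: "D y * (R * sin \<theta>) = 1 / pi * hf p (pi - \<theta>)" .
      have "(D y * f y) * (R * sin \<theta>) = (D y * (R * sin \<theta>)) * f y" by (simp only: mult_ac)
      also have "\<dots> = 1 / pi * (f y * hf p (pi - \<theta>))" unfolding e by (simp only: mult_ac)
      finally have "(D y * f y) * (R * sin \<theta>) = 1 / pi * (f y * hf p (pi - \<theta>))" .
      moreover have "y = m - R * cos \<theta>" by (simp add: y_def c_def)
      ultimately show ?thesis using True by (simp only: indicator_simps mult_1_left mult_1_right)
    qed simp
  qed
  also have "\<dots> = 1 / pi * integral {0..pi} (\<lambda>\<theta>. f (m - R * cos \<theta>) * hf p (pi - \<theta>))"
  proof -
    let ?k = "\<lambda>\<theta>. f (m - R * cos \<theta>) * hf p (pi - \<theta>)"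
    have "continuous_on {0..pi} (\<lambda>\<theta>. hf p (pi - \<theta>))"
      unfolding hf_def using d by (intro continuous_on_compose2[OF continuous_arc_density[of "- p" UNIV]] continuous_intros) auto
    moreover have "continuous_on {0..pi} (\<lambda>\<theta>. f (m - R * cos \<theta>))"
      by (rule continuous_on_compose2[OF f]) (auto intro!: continuous_intros)
    ultimately have c: "continuous_on {0..pi} ?k" by (intro continuous_on_mult)
    have eq: "indicator {0..pi} \<theta> * (1 / pi * ?k \<theta>) = 1 / pi * (indicator {0..pi} \<theta> * ?k \<theta>)" for \<theta> by simp
    show ?thesis
      unfolding eq using has_integral_imp_lborel(2)[OF c integrable_integral[OF integrable_continuous_real[OF c]]] by simp
  qed
  also have "\<dots> = 1 / (2 * pi) * integral {0..2*pi} (integrand f 0)"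
  proof -
    define k where "k c = f (m + R * c) * (t + g + 2 * (- g * p / (1 - p\<^sup>2)) * c + 2 * (- Sf p / 4) * (2 * c\<^sup>2 - 1)
      + (- g) * (1 - (- p)\<^sup>2) / (1 - 2 * (- p) * c + (- p)\<^sup>2))" for c
    have k1: "integrand f 0 \<theta> = k (cos \<theta>)" for \<theta>
      unfolding integrand_def k_def hf_def arc_density_def cos_double_cos p_def m_def R_def by simp
    have k2: "f (m - R * cos \<theta>) * hf p (pi - \<theta>) = k (- cos \<theta>)" for \<theta>
      unfolding k_def hf_def arc_density_def cos_double_cos by simp
    have "continuous_on UNIV (\<lambda>\<theta>. k (cos \<theta>))"
      using integrand_continuous[OF f, of UNIV 0] unfolding k1[symmetric] by simp
    from integral_cos_symmetric[OF this] show ?thesis unfolding k1[abs_def] k2 by simp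
  qed
  also have "\<dots> = (\<integral>x. f x \<partial>Nf 0)"
    by (rule Nf_integral[OF fm integrand_continuous[OF f], symmetric])
  finally show ?thesis by (simp add: b_def p_def)
qed

section \<open>Convergence as v tends to 0\<close>

lemma par_tendsto: "(par \<longlongrightarrow> par v) (nhds v)"
  using par_near[of _ v] by (auto simp: tendsto_iff dist_real_def)

text \<open>After transfer to angles the integral is a continuous function of \<open>p\<close> on
  \<open>dom\<close>, composed with the continuous function \<open>par\<close>.\<close>

lemma Nf_weak_tendsto:
  fixes f :: "real \<Rightarrow> real"
  assumes f: "continuous_on UNIV f"
  shows "((\<lambda>v. \<integral>x. f x \<partial>Nf v) \<longlongrightarrow> (\<integral>x. f x \<partial>Nf 0)) (nhds 0)"
proof -
  let ?F = "\<lambda>p \<theta>. f (bf p - \<beta> + Rf p * cos \<theta>) * hf p \<theta>"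
  have cR: "continuous_on dom Rf"
    using Rf_deriv by (meson DERIV_isCont continuous_at_imp_continuous_on)
  have c: "continuous_on (dom \<times> {0..2*pi}) (\<lambda>x. ?F (fst x) (snd x))"
  proof (rule continuous_on_mult)
    have cR': "continuous_on (dom \<times> {0..2*pi}) (\<lambda>x. Rf (fst x))"
      by (rule continuous_on_compose2[OF cR continuous_on_fst[OF continuous_on_id]]) auto
    have ne: "(1 - (fst x)\<^sup>2) * Rf (fst x) \<noteq> 0" "1 - (fst x)\<^sup>2 \<noteq> 0" if "x \<in> dom \<times> {0..2*pi}" for x :: "real \<times> real"
      using domD[of "fst x"] that by auto
    have D: "1 - 2 * (- fst x) * cos (snd x) + (- fst x)\<^sup>2 \<noteq> 0" if "x \<in> dom \<times> {0..2*pi}" for x :: "real \<times> real"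
      using poisson_denom_pos[of "- fst x" "snd x"] domD[of "fst x"] that by auto
    have "continuous_on (dom \<times> {0..2*pi}) (\<lambda>x. bf (fst x) - \<beta> + Rf (fst x) * cos (snd x))"
      unfolding bf_def by (intro continuous_intros cR' ballI ne)
    thus "continuous_on (dom \<times> {0..2*pi}) (\<lambda>x. f (bf (fst x) - \<beta> + Rf (fst x) * cos (snd x)))"
      by (rule continuous_on_compose2[OF f]) auto
    show "continuous_on (dom \<times> {0..2*pi}) (\<lambda>x. hf (fst x) (snd x))"
      unfolding hf_def arc_density_def Sf_def by (intro continuous_intros) (use ne D in auto)
  qed
  have "continuous_on dom (\<lambda>p. integral (cbox 0 (2*pi)) (?F p))"
    by (rule integral_continuous_on_param) (use c in \<open>simp add: split_beta' cbox_interval\<close>)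
  hence J: "continuous_on dom (\<lambda>p. integral {0..2*pi} (?F p))" by (simp add: cbox_interval)
  obtain N where N: "open N" "par 0 \<in> N" "\<And>x. x \<in> N \<Longrightarrow> x \<in> dom"
    using dom_nhds[OF par(1)[of 0]] by (auto simp: eventually_nhds)
  have "isCont (\<lambda>p. integral {0..2*pi} (?F p)) (par 0)"
    using continuous_on_subset[OF J, of N] N by (auto simp: continuous_on_eq_continuous_at)
  hence "((\<lambda>v. integral {0..2*pi} (?F (par v))) \<longlongrightarrow> integral {0..2*pi} (?F (par 0))) (nhds 0)"
    by (rule isCont_tendsto_compose[OF _ par_tendsto])
  hence "((\<lambda>v. 1 / (2*pi) * integral {0..2*pi} (integrand f v)) \<longlongrightarrow> 1 / (2*pi) * integral {0..2*pi} (integrand f 0)) (nhds 0)"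
    unfolding integrand_def[abs_def] by (intro tendsto_mult tendsto_const)
  thus ?thesis
    by (simp only: Nf_integral[OF borel_measurable_continuous_onI[OF f] integrand_continuous[OF f]])
qed

text \<open>At \<open>v = 0\<close> the left endpoint is positive, as the arc lies strictly to the
  right of the charge; continuity preserves this near 0.\<close>

lemma edge_positive: "\<forall>\<^sub>F v in nhds 0. 0 \<le> bf (par v) - \<beta> - Rf (par v)"
proof -
  have pd: "par 0 \<in> dom" by (rule par(1))
  note d = domD[OF pd]
  have cR: "isCont Rf (par 0)" using Rf_deriv[OF pd] by (rule DERIV_isCont)
  hence c: "isCont (\<lambda>p. bf p - \<beta> - Rf p) (par 0)"
    unfolding bf_def using d by (intro continuous_intros) auto
  have "((\<lambda>v. bf (par v) - \<beta> - Rf (par v)) \<longlongrightarrow> bf (par 0) - \<beta> - Rf (par 0)) (nhds 0)"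
    by (rule isCont_tendsto_compose[OF c par_tendsto])
  moreover have "0 < bf (par 0) - \<beta> - Rf (par 0)"
    using soft_edge.m0_gt_R[OF par_soft[of 0]] center_eq[of 0] by simp
  ultimately have "\<forall>\<^sub>F v in nhds 0. 0 < bf (par v) - \<beta> - Rf (par v)" by (rule order_tendstoD(1))
  thus ?thesis by eventually_elim simp
qed

lemma equilibrium_eq_Nf:
  assumes "0 < v" "0 \<le> bf (par v) - \<beta> - Rf (par v)"
    and "equilibrium_measure {0..} (\<lambda>x. x\<^sup>2 / 2 + \<beta> * x + (- g) * ln (x + v)) t \<nu>"
  shows "\<nu> = Nf v"
  unfolding Nf_eq
  by (rule soft_edge.equilibrium_eq_N[OF par_soft assms(1) _ refl assms(3)])
     (use assms(2) center_eq[of v] in simp)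

end

theorem theorem2p3:
  fixes \<beta> \<gamma> t :: real and \<nu> :: "real \<Rightarrow> real measure"
  assumes t_pos: "t > 0"
    and nu: "\<And>v. v > 0 \<Longrightarrow>
      equilibrium_measure {0..} (\<lambda>x. x\<^sup>2 / 2 + \<beta> * x + \<gamma> * ln (x + v)) t (\<nu> v)"
  shows
    "(\<gamma> < 0 \<longrightarrow>
        (\<exists>b1. admissible_root \<beta> \<gamma> t b1) \<and>
        (\<forall>b1. admissible_root \<beta> \<gamma> t b1 \<longrightarrow>
           weak_star_tendsto \<nu> (sigma_measure \<beta> \<gamma> t b1) (at_right 0)) \<and>
        (\<exists>\<epsilon>>0. \<exists>N. analytic_measure_family {..<\<epsilon>} N \<and> (\<forall>v. 0 < v \<and> v < \<epsilon> \<longrightarrow> N v = \<nu> v)))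
     \<and>
     (\<gamma> > 0 \<longrightarrow>
        (t \<le> \<gamma> \<longrightarrow>
           weak_star_tendsto \<nu> (scale_measure (ennreal t) (dirac 0)) (at_right 0)) \<and>
        (t > \<gamma> \<longrightarrow>
           (\<forall>\<rho>. equilibrium_measure {0..} (normalized_field \<beta> (t - \<gamma>)) 1 \<rho> \<longrightarrow>
              weak_star_tendsto \<nu>
                (measure_plus (scale_measure (ennreal \<gamma>) (dirac 0))
                              (scale_measure (ennreal (t - \<gamma>)) \<rho>))
                (at_right 0))))"
proof (intro conjI impI)
  assume \<gamma>: "\<gamma> < 0"
  interpret soft_family t "- \<gamma>" \<beta> by unfold_locales (use t_pos \<gamma> in auto)
  have nu': "equilibrium_measure {0..} (\<lambda>x. x\<^sup>2 / 2 + \<beta> * x + (- (- \<gamma>)) * ln (x + v)) t (\<nu> v)" if "0 < v" for v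
    using nu[OF that] by simp
  show "\<exists>b1. admissible_root \<beta> \<gamma> t b1" using root_of_par(4) by auto
  \<comment> \<open>For \<open>0 < v < \<epsilon>\<close> the arc lies in the half-line and the
    explicit measure is the equilibrium measure; the family itself is analytic for all real
    \<open>v\<close>.\<close>
  obtain \<epsilon> where \<epsilon>: "0 < \<epsilon>" "\<And>v. \<bar>v\<bar> < \<epsilon> \<Longrightarrow> 0 \<le> bf (par v) - \<beta> - Rf (par v)"
    using edge_positive by (auto simp: eventually_nhds_metric dist_real_def)
  have eq: "Nf v = \<nu> v" if "0 < v" "v < \<epsilon>" for v
    using equilibrium_eq_Nf[OF that(1) \<epsilon>(2) nu'] that by simp
  show "\<exists>\<epsilon>>0. \<exists>N. analytic_measure_family {..<\<epsilon>} N \<and> (\<forall>v. 0 < v \<and> v < \<epsilon> \<longrightarrow> N v = \<nu> v)"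
    using \<epsilon>(1) eq Nf_analytic_family by blast
  show "\<forall>b1. admissible_root \<beta> \<gamma> t b1 \<longrightarrow> weak_star_tendsto \<nu> (sigma_measure \<beta> \<gamma> t b1) (at_right 0)"
  proof (intro allI impI)
    fix b1 assume "admissible_root \<beta> \<gamma> t b1"
    hence b1: "b1 = - bf (par 0)" using admissible_root_par[of b1] by simp
    show "weak_star_tendsto \<nu> (sigma_measure \<beta> \<gamma> t b1) (at_right 0)"
      unfolding weak_star_tendsto_def
    proof (intro allI impI)
      fix f :: "real \<Rightarrow> real" assume f: "continuous_on UNIV f \<and> bounded (range f)"
      have "((\<lambda>v. \<integral>x. f x \<partial>Nf v) \<longlongrightarrow> (\<integral>x. f x \<partial>Nf 0)) (at_right 0)"
        by (rule tendsto_mono[OF _ Nf_weak_tendsto]) (use f in \<open>simp_all add: at_within_def\<close>)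
      moreover have "\<forall>\<^sub>F v in at_right 0. (\<integral>x. f x \<partial>Nf v) = (\<integral>x. f x \<partial>\<nu> v)"
        using eq \<epsilon>(1) by (auto simp: eventually_at_right_field intro!: exI[of _ \<epsilon>])
      ultimately have "((\<lambda>v. \<integral>x. f x \<partial>\<nu> v) \<longlongrightarrow> (\<integral>x. f x \<partial>Nf 0)) (at_right 0)"
        by (rule Lim_transform_eventually)
      thus "((\<lambda>v. \<integral>x. f x \<partial>\<nu> v) \<longlongrightarrow> (\<integral>x. f x \<partial>sigma_measure \<beta> \<gamma> t b1)) (at_right 0)"
        using sigma_integral[of f] f by (simp add: b1)
    qed
  qed
next
  assume "0 < \<gamma>" "t \<le> \<gamma>"
  thus "weak_star_tendsto \<nu> (scale_measure (ennreal t) (dirac 0)) (at_right 0)"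
    by (intro limit_subcritical[OF t_pos _ nu])
next
  assume "0 < \<gamma>" "\<gamma> < t"
  thus "\<forall>\<rho>. equilibrium_measure {0..} (normalized_field \<beta> (t - \<gamma>)) 1 \<rho> \<longrightarrow>
      weak_star_tendsto \<nu> (combo \<gamma> (dirac 0) (t - \<gamma>) \<rho>) (at_right 0)"
    using limit_supercritical[OF _ _ nu] by blast
qed

end
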